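(* Let $n\ge 2$, let $U \subset \mathbb{R}^n$ be a bounded open set, and let $f$ be a real analytic function on an open neighborhood of $\overline{U}$ such that $\operatorname{codim}_p(Z_f) \geq 2$ for every $p \in Z_f \cap \overline{U}$, where $Z_f=\{f=0\}$. Then $\log|f| \in W^{1,1}(U)$.
   Context: For a real analytic subset $X$ of an open set in $\mathbb{R}^n$, a point $p \in X$ is a smooth point of dimension $d$ if there is an open neighborhood $W$ of $p$ such that $W\cap X$ is a real analytic submanifold of $W$ of dimension $d$. The dimension of $X$ at $p$, $\dim_p X$, is the largest $d$ such that $p$ lies in the closure of the set of smooth points of $X$ of dimension $d$, and $\operatorname{codim}_p X := n - \dim_p X$. $W^{1,1}(U)$ denotes the functions in $L^1(U)$ whose distributional gradient on $U$ lies in $L^1(U)$. *)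

theory Defs
  imports "HOL-Analysis.Analysis"
begin

definition monomial_at :: "real^'n \<Rightarrow> ('n \<Rightarrow> nat) \<Rightarrow> real^'n \<Rightarrow> real" where
  "monomial_at p \<alpha> x = (\<Prod>i\<in>UNIV. (x$i - p$i) ^ \<alpha> i)"

definition real_analytic_on :: "(real^'n \<Rightarrow> real) \<Rightarrow> (real^'n) set \<Rightarrow> bool" where
  "real_analytic_on g V \<longleftrightarrow>
     (\<forall>p\<in>V. \<exists>r>0. \<exists>c::('n \<Rightarrow> nat) \<Rightarrow> real.
        \<forall>x\<in>ball p r. ((\<lambda>\<alpha>. c \<alpha> * monomial_at p \<alpha> x) has_sum g x) UNIV)"

definition real_analytic_map_on :: "(real^'n \<Rightarrow> real^'m) \<Rightarrow> (real^'n) set \<Rightarrow> bool" where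
  "real_analytic_map_on \<phi> V \<longleftrightarrow> (\<forall>i. real_analytic_on (\<lambda>x. \<phi> x $ i) V)"

definition analytic_submanifold :: "(real^'n) set \<Rightarrow> (real^'n) set \<Rightarrow> nat \<Rightarrow> bool" where
  "analytic_submanifold M W d \<longleftrightarrow> M \<subseteq> W \<and>
     (\<forall>q\<in>M. \<exists>Q (\<phi>::real^'n \<Rightarrow> real^'n) (\<psi>::real^'n \<Rightarrow> real^'n) L. open Q \<and> q \<in> Q \<and> Q \<subseteq> W \<and>
        open (\<phi> ` Q) \<and> real_analytic_map_on \<phi> Q \<and> real_analytic_map_on \<psi> (\<phi> ` Q) \<and>
        (\<forall>x\<in>Q. \<psi> (\<phi> x) = x) \<and>
        subspace L \<and> dim L = d \<and> \<phi> ` (Q \<inter> M) = \<phi> ` Q \<inter> L)"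

definition smooth_point :: "(real^'n) set \<Rightarrow> nat \<Rightarrow> real^'n \<Rightarrow> bool" where
  "smooth_point X d p \<longleftrightarrow> p \<in> X \<and>
     (\<exists>W. open W \<and> p \<in> W \<and> analytic_submanifold (W \<inter> X) W d)"

definition analytic_dim_at :: "(real^'n) set \<Rightarrow> real^'n \<Rightarrow> nat" where
  "analytic_dim_at X p = (GREATEST d. p \<in> closure {q. smooth_point X d q})"

definition analytic_codim_at :: "(real^'n) set \<Rightarrow> real^'n \<Rightarrow> nat" where
  "analytic_codim_at X p = CARD('n) - analytic_dim_at X p"

fun Ck_on :: "nat \<Rightarrow> (real^'n) set \<Rightarrow> (real^'n \<Rightarrow> real) \<Rightarrow> bool" where
  "Ck_on 0 S g = continuous_on S g"
| "Ck_on (Suc k) S g = ((\<forall>x\<in>S. g differentiable (at x)) \<and>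
      (\<forall>i. Ck_on k S (\<lambda>x. frechet_derivative g (at x) (axis i 1))))"

definition test_function :: "(real^'n) set \<Rightarrow> (real^'n \<Rightarrow> real) \<Rightarrow> bool" where
  "test_function U \<phi> \<longleftrightarrow> (\<forall>k. Ck_on k UNIV \<phi>) \<and>
     compact (closure {x. \<phi> x \<noteq> 0}) \<and> closure {x. \<phi> x \<noteq> 0} \<subseteq> U"

definition W11 :: "(real^'n) set \<Rightarrow> (real^'n \<Rightarrow> real) set" where
  "W11 U = {g. set_integrable lebesgue U g \<and>
     (\<exists>G :: 'n \<Rightarrow> real^'n \<Rightarrow> real. \<forall>i. set_integrable lebesgue U (G i) \<and>
        (\<forall>\<phi>. test_function U \<phi> \<longrightarrow>
           (LINT x:U|lebesgue. g x * frechet_derivative \<phi> (at x) (axis i 1))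
             = - (LINT x:U|lebesgue. G i x * \<phi> x)))}"

end

theory Submission
  imports Defs "HOL-Complex_Analysis.Conformal_Mappings"
begin

text \<open>
  Complexify \<open>f\<close> near a zero \<open>p\<close> and fix a real direction \<open>v\<close> along which \<open>f\<close> does not vanish
  identically at \<open>p\<close>. For base points \<open>x\<close> near \<open>p\<close> the function \<open>s \<mapsto> f (x + s v)\<close> has boundedly many
  complex zeros in a fixed disc, it is bounded below by a multiple of the product of the distances to
  them, and its logarithmic derivative is a sum of simple poles up to a bounded error. The power sums
  of the zeros are contour integrals, hence analytic in \<open>x\<close>.

  The product bound and Tonelli along \<open>v\<close> show that some negative power of any nonzero analytic function is
  locally integrable. For the gradient let \<open>k\<close> be the maximal number of distinct zeros over real base
  points near \<open>p\<close>, and \<open>D\<close> the symmetric function of the zeros that is nonzero iff there are exactly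
  \<open>k\<close> distinct ones. Where \<open>D x \<noteq> 0\<close> the zeros vary analytically, and a real one would stay real, so that
  the zero set of \<open>f\<close> would be a hypersurface there; codimension two excludes this. Hence all zeros
  are nonreal, they come in conjugate pairs, and their imaginary parts are bounded below by a multiple of
  \<open>\<bar>D x\<bar>\<close>. So the integral of \<open>\<bar>\<partial>\<^sub>v f / f\<bar>\<close> along the line is at most a small negative power of \<open>\<bar>D x\<bar>\<close>, which
  is integrable. Finally \<open>ln (f\<^sup>2 + \<epsilon>) / 2\<close> and its gradient are dominated by \<open>\<bar>ln \<bar>f\<bar>\<bar>\<close> plus a constant and
  by \<open>\<bar>\<nabla>f / f\<bar>\<close>, so the weak gradient is obtained by dominated convergence.
\<close>

subsection \<open>Functions holomorphic along complex lines\<close>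

text \<open>A real zero \<open>r\<close> on a line would contribute a pole
  \<open>1 / \<bar>s - r\<bar>\<close>, which is not integrable, and excluding real zeros gives no
  uniform gap: the nonreal zeros may still come arbitrarily close to the real axis. Interpolation
  bridges this. For real \<open>s\<close> the distance to a nonreal \<open>r\<close> is at least
  \<open>\<bar>s - Re r\<bar>\<close> and at least \<open>\<bar>Im r\<bar>\<close>, whence \<open>1
  / cmod (s - r) \<le> \<bar>s - Re r\<bar> powr (\<tau> - 1) * \<bar>Im r\<bar> powr
  (-\<tau>)\<close>. The first factor is integrable in \<open>s\<close>, uniformly in
  \<open>r\<close>, for every \<open>\<tau> > 0\<close>; so \<open>\<tau>\<close> may be taken as
  small as the integrability of a negative power of the discriminant demands. A second obstacle is
  the choice of directions. The line through \<open>p\<close> must not lie in the zero set near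
  \<open>p\<close>, and a coordinate axis may do just that. Vectors \<open>x - p\<close> with
  \<open>f x \<noteq> 0\<close> are always admissible, and partial derivatives are recovered from
  two of them. Multiplicities are carried as weights throughout: contour integrals see zeros with
  multiplicity, whereas the discriminant has to count distinct ones.\<close>

definition cvec :: "real^'n \<Rightarrow> complex^'n" where
  "cvec x = (\<chi> i. complex_of_real (x $ i))"

lemma cvec_nth [simp]: "cvec x $ i = complex_of_real (x $ i)"
  by (simp add: cvec_def)

lemma cvec_add: "cvec (x + y) = cvec x + cvec y"
  by (simp add: vec_eq_iff)

lemma cvec_diff: "cvec (x - y) = cvec x - cvec y"
  by (simp add: vec_eq_iff)

lemma cvec_scaleR: "cvec (t *\<^sub>R x) = complex_of_real t *s cvec x"
  by (simp add: vec_eq_iff)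

lemma norm_cvec [simp]: "norm (cvec x) = norm x"
  by (simp add: norm_vec_def L2_set_def)

lemma dist_cvec [simp]: "dist (cvec x) (cvec y) = dist x y"
  by (simp add: dist_norm flip: cvec_diff)

lemma continuous_on_cvec [continuous_intros]:
  "continuous_on S f \<Longrightarrow> continuous_on S (\<lambda>x. cvec (f x))"
  unfolding cvec_def by (intro continuous_intros)

lemma norm_vector_smult: "norm (s *s (v::complex^'n)) = cmod s * norm v"
proof -
  have "norm (s *s v) = L2_set (\<lambda>i. cmod s * norm (v $ i)) UNIV"
    by (simp add: norm_vec_def norm_mult)
  also have "\<dots> = cmod s * norm v"
    by (simp add: norm_vec_def L2_set_right_distrib)
  finally show ?thesis .
qed

lemma continuous_on_vector_smult [continuous_intros]:
  fixes g :: "'a::topological_space \<Rightarrow> complex^'n"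
  assumes "continuous_on S f" "continuous_on S g"
  shows "continuous_on S (\<lambda>x. f x *s g x)"
  unfolding vector_scalar_mult_def using assms by (intro continuous_intros)

text \<open>Analyticity in several complex variables, in the form that passes to parameter integrals by one-variable
theorems.\<close>

definition line_holomorphic_on :: "(complex^'n \<Rightarrow> complex) \<Rightarrow> (complex^'n) set \<Rightarrow> bool" where
  "line_holomorphic_on G \<Omega> \<longleftrightarrow> open \<Omega> \<and> continuous_on \<Omega> G \<and>
     (\<forall>z\<in>\<Omega>. \<forall>v. (\<lambda>s. G (z + s *s v)) field_differentiable (at 0))"

definition line_deriv :: "complex^'n \<Rightarrow> (complex^'n \<Rightarrow> complex) \<Rightarrow> complex^'n \<Rightarrow> complex" where
  "line_deriv v G z = deriv (\<lambda>s. G (z + s *s v)) 0"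

lemma open_line_preimage:
  assumes "open (\<Omega> :: (complex^'n) set)"
  shows "open {s. z + s *s v \<in> \<Omega>}"
proof -
  have "continuous_on UNIV (\<lambda>s. z + s *s v)" by (intro continuous_intros)
  thus ?thesis
    using continuous_open_preimage[of UNIV "\<lambda>s. z + s *s v" \<Omega>] assms by (simp add: vimage_def)
qed

lemma line_holomorphic_on_line_at:
  assumes "line_holomorphic_on G \<Omega>" "z + a *s v \<in> \<Omega>"
  shows "((\<lambda>s. G (z + s *s v)) has_field_derivative line_deriv v G (z + a *s v)) (at a)"
proof -
  have "((\<lambda>s. G ((z + a *s v) + s *s v)) has_field_derivative line_deriv v G (z + a *s v)) (at 0)"
    unfolding line_deriv_def using assms
    by (metis field_differentiable_derivI line_holomorphic_on_def)
  hence "((\<lambda>s. G ((z + a *s v) + (s - a) *s v)) has_field_derivative line_deriv v G (z + a *s v)) (at a)"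
    using DERIV_shift[of "\<lambda>s. G ((z + a *s v) + (s - a) *s v)" "line_deriv v G (z + a *s v)" 0 a]
    by (simp add: add.commute)
  moreover have "(z + a *s v) + (s - a) *s v = z + s *s v" for s
    by (simp add: vec_eq_iff algebra_simps)
  ultimately show ?thesis by simp
qed

lemma line_holomorphic_on_line:
  assumes "line_holomorphic_on G \<Omega>"
  shows "(\<lambda>s. G (z + s *s v)) holomorphic_on {s. z + s *s v \<in> \<Omega>}"
  unfolding holomorphic_on_def
  using line_holomorphic_on_line_at[OF assms] field_differentiable_at_within field_differentiable_def
  by blast

lemma line_holomorphic_onI:
  assumes "open \<Omega>" "continuous_on \<Omega> G"
    and "\<And>z v. z \<in> \<Omega> \<Longrightarrow> \<exists>e>0. (\<lambda>s. G (z + s *s v)) holomorphic_on ball 0 e"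
  shows "line_holomorphic_on G \<Omega>"
  unfolding line_holomorphic_on_def
  using assms by (meson centre_in_ball holomorphic_on_imp_differentiable_at open_ball)

lemma line_holomorphic_on_open: "line_holomorphic_on G \<Omega> \<Longrightarrow> open \<Omega>"
  by (simp add: line_holomorphic_on_def)

lemma line_holomorphic_on_continuous: "line_holomorphic_on G \<Omega> \<Longrightarrow> continuous_on \<Omega> G"
  by (simp add: line_holomorphic_on_def)

lemma line_holomorphic_on_subset:
  "line_holomorphic_on G \<Omega> \<Longrightarrow> open T \<Longrightarrow> T \<subseteq> \<Omega> \<Longrightarrow> line_holomorphic_on G T"
  unfolding line_holomorphic_on_def using continuous_on_subset by blast

lemma line_holomorphic_on_cong:
  assumes "line_holomorphic_on G \<Omega>" "\<And>z. z \<in> \<Omega> \<Longrightarrow> G z = G' z"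
  shows "line_holomorphic_on G' \<Omega>"
proof (rule line_holomorphic_onI)
  show "open \<Omega>" using assms by (simp add: line_holomorphic_on_def)
  show "continuous_on \<Omega> G'"
    using line_holomorphic_on_continuous[OF assms(1)] assms(2) continuous_on_cong by metis
  fix z v assume z: "z \<in> \<Omega>"
  have "open {s. z + s *s v \<in> \<Omega>}" "0 \<in> {s. z + s *s v \<in> \<Omega>}"
    using open_line_preimage[OF \<open>open \<Omega>\<close>] z by auto
  then obtain e where e: "e > 0" "ball 0 e \<subseteq> {s. z + s *s v \<in> \<Omega>}"
    using openE by blast
  have "(\<lambda>s. G (z + s *s v)) holomorphic_on ball 0 e"
    using line_holomorphic_on_line[OF assms(1)] e holomorphic_on_subset by blast
  hence "(\<lambda>s. G' (z + s *s v)) holomorphic_on ball 0 e"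
    by (rule holomorphic_transform) (use e assms(2) in auto)
  with e show "\<exists>e>0. (\<lambda>s. G' (z + s *s v)) holomorphic_on ball 0 e" by blast
qed

lemma line_holomorphic_on_local:
  assumes "\<And>z. z \<in> \<Omega> \<Longrightarrow> \<exists>e>0. line_holomorphic_on G (ball z e)" "open \<Omega>"
  shows "line_holomorphic_on G \<Omega>"
  unfolding line_holomorphic_on_def
proof (intro conjI ballI allI)
  show "open \<Omega>" by fact
  show "continuous_on \<Omega> G"
    unfolding continuous_on_eq_continuous_at[OF assms(2)]
    by (meson assms(1) centre_in_ball continuous_on_eq_continuous_at line_holomorphic_on_def open_ball)
  show "(\<lambda>s. G (z + s *s v)) field_differentiable at 0" if "z \<in> \<Omega>" for z v
    using assms(1)[OF that] by (auto simp: line_holomorphic_on_def)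
qed

lemma line_holomorphic_on_const: "open \<Omega> \<Longrightarrow> line_holomorphic_on (\<lambda>z. c) \<Omega>"
  by (simp add: line_holomorphic_on_def)

lemma line_holomorphic_on_nth: "open \<Omega> \<Longrightarrow> line_holomorphic_on (\<lambda>z. z $ i) \<Omega>"
  by (auto simp: line_holomorphic_on_def intro!: continuous_intros derivative_intros)

lemma line_holomorphic_on_add:
  "line_holomorphic_on G \<Omega> \<Longrightarrow> line_holomorphic_on K \<Omega> \<Longrightarrow> line_holomorphic_on (\<lambda>z. G z + K z) \<Omega>"
  by (auto simp: line_holomorphic_on_def intro!: continuous_intros field_differentiable_add)

lemma line_holomorphic_on_mult:
  "line_holomorphic_on G \<Omega> \<Longrightarrow> line_holomorphic_on K \<Omega> \<Longrightarrow> line_holomorphic_on (\<lambda>z. G z * K z) \<Omega>"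
  by (auto simp: line_holomorphic_on_def intro!: continuous_intros field_differentiable_mult)

lemma line_holomorphic_on_diff:
  "line_holomorphic_on G \<Omega> \<Longrightarrow> line_holomorphic_on K \<Omega> \<Longrightarrow> line_holomorphic_on (\<lambda>z. G z - K z) \<Omega>"
  by (auto simp: line_holomorphic_on_def intro!: continuous_intros field_differentiable_diff)

lemma line_holomorphic_on_divide:
  "line_holomorphic_on G \<Omega> \<Longrightarrow> line_holomorphic_on K \<Omega> \<Longrightarrow> (\<And>z. z \<in> \<Omega> \<Longrightarrow> K z \<noteq> 0) \<Longrightarrow>
    line_holomorphic_on (\<lambda>z. G z / K z) \<Omega>"
  by (auto simp: line_holomorphic_on_def intro!: continuous_intros field_differentiable_divide)

lemma line_holomorphic_on_sum:
  assumes "open \<Omega>" "\<And>i. i \<in> I \<Longrightarrow> line_holomorphic_on (G i) \<Omega>"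
  shows "line_holomorphic_on (\<lambda>z. \<Sum>i\<in>I. G i z) \<Omega>"
  using assms by (induction I rule: infinite_finite_induct)
    (auto intro: line_holomorphic_on_const line_holomorphic_on_add)

lemma line_holomorphic_on_prod:
  assumes "open \<Omega>" "\<And>i. i \<in> I \<Longrightarrow> line_holomorphic_on (G i) \<Omega>"
  shows "line_holomorphic_on (\<lambda>z. \<Prod>i\<in>I. G i z) \<Omega>"
  using assms by (induction I rule: infinite_finite_induct)
    (auto intro: line_holomorphic_on_const line_holomorphic_on_mult)

text \<open>Complex lines go to complex lines; \<open>B\<close> is the linear part of
  \<open>A\<close>. Shifts, freezing a coordinate and projecting along a vector are all of this
  kind.\<close>

lemma line_holomorphic_on_affine:
  assumes G: "line_holomorphic_on G \<Omega>" and cont: "continuous_on UNIV A"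
    and A: "\<And>z s v. A (z + s *s v) = A z + s *s B v"
  shows "line_holomorphic_on (\<lambda>z. G (A z)) {z. A z \<in> \<Omega>}"
  unfolding line_holomorphic_on_def
proof (intro conjI ballI allI)
  show "open {z. A z \<in> \<Omega>}"
    using continuous_open_preimage[OF cont open_UNIV line_holomorphic_on_open[OF G]]
    by (simp add: vimage_def)
  show "continuous_on {z. A z \<in> \<Omega>} (\<lambda>z. G (A z))"
    by (rule continuous_on_compose2[OF line_holomorphic_on_continuous[OF G] continuous_on_subset[OF cont]]) auto
  show "(\<lambda>s. G (A (z + s *s v))) field_differentiable at 0" if "z \<in> {z. A z \<in> \<Omega>}" for z v
    using G that unfolding A by (simp add: line_holomorphic_on_def)
qed

lemma line_holomorphic_on_shift:
  assumes G: "line_holomorphic_on G \<Omega>" and "open T" "\<And>z. z \<in> T \<Longrightarrow> z + a \<in> \<Omega>"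
  shows "line_holomorphic_on (\<lambda>z. G (z + a)) T"
  by (rule line_holomorphic_on_subset[OF line_holomorphic_on_affine[OF G, of "\<lambda>z. z + a" "\<lambda>v. v"]])
     (use assms in \<open>auto intro!: continuous_intros simp: algebra_simps\<close>)

text \<open>Cauchy's formula on the circle of radius \<open>r\<close> turns the derivative into an
  integral of \<open>k\<close> itself, which depends continuously on \<open>s\<close> and
  \<open>t\<close> together. This is the continuity of the derivative that the Leibniz rule asks
  for.\<close>

lemma continuous_on_deriv_param:
  fixes k :: "complex \<Rightarrow> real \<Rightarrow> complex"
  assumes cont: "continuous_on (cball s0 r \<times> {0..1}) (\<lambda>(s,t). k s t)" and r: "r > 0"
    and hol: "\<And>t. t \<in> {0..1} \<Longrightarrow> (\<lambda>s. k s t) holomorphic_on ball s0 r"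
  shows "continuous_on (ball s0 r \<times> {0..1}) (\<lambda>(s,t). deriv (\<lambda>s. k s t) s)"
proof -
  define c where "c = circlepath s0 r"
  have c_in: "c u \<in> sphere s0 r" if "u \<in> {0..1}" for u
    using that r path_image_circlepath_nonneg[of r s0] unfolding c_def path_image_def by auto
  have dc: "vector_derivative c (at u) = 2 * of_real pi * \<i> * r * exp (2 * of_real pi * \<i> * u)" for u
    by (simp add: c_def vector_derivative_circlepath)
  have cc: "continuous_on T c" for T
    unfolding c_def circlepath by (intro continuous_intros)
  have eq: "deriv (\<lambda>s. k s t) s = inverse (2 * of_real pi * \<i>) * integral {0..1}
       (\<lambda>u. k (c u) t / (c u - s)\<^sup>2 * (2 * of_real pi * \<i> * r * exp (2 * of_real pi * \<i> * u)))"
    if "s \<in> ball s0 r" "t \<in> {0..1}" for s t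
  proof -
    have "continuous_on (cball s0 r) (\<lambda>s. k s t)"
      by (rule continuous_on_compose2[OF cont, of _ "\<lambda>s. (s, t)", simplified]) (use that in \<open>auto intro!: continuous_intros\<close>)
    from Cauchy_has_contour_integral_higher_derivative_circlepath[OF this hol[OF that(2)] that(1), of 1]
    have "contour_integral c (\<lambda>u. k u t / (u - s)\<^sup>2) = 2 * of_real pi * \<i> * deriv (\<lambda>s. k s t) s"
      by (simp add: c_def contour_integral_unique numeral_2_eq_2)
    thus ?thesis by (simp add: contour_integral_integral dc field_simps)
  qed
  have "continuous_on ((ball s0 r \<times> {0..1}) \<times> cbox 0 1)
     (\<lambda>(p, u). k (c u) (snd p) / (c u - fst p)\<^sup>2 * (2 * of_real pi * \<i> * r * exp (2 * of_real pi * \<i> * u)))"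
  proof -
    have kc: "continuous_on ((ball s0 r \<times> {0..1::real}) \<times> cbox 0 (1::real)) (\<lambda>q. k (c (snd q)) (snd (fst q)))"
      by (rule continuous_on_compose2[OF cont, of _ "\<lambda>q. (c (snd q), snd (fst q))", simplified])
         (use c_in in \<open>force intro!: continuous_intros continuous_on_compose2[OF cc[of UNIV]]\<close>)+
    show ?thesis
      unfolding case_prod_unfold
      by (intro continuous_intros kc continuous_on_compose2[OF cc[of UNIV]])
         (use c_in in \<open>force simp: dist_norm\<close>)+
  qed
  from integral_continuous_on_param[OF this]
  have "continuous_on (ball s0 r \<times> {0..1}) (\<lambda>p. inverse (2 * of_real pi * \<i>) * integral {0..1}
     (\<lambda>u. k (c u) (snd p) / (c u - fst p)\<^sup>2 * (2 * of_real pi * \<i> * r * exp (2 * of_real pi * \<i> * u))))"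
    by (intro continuous_intros) simp
  thus ?thesis
    by (rule continuous_on_cong[THEN iffD1, rotated 2]) (auto simp: eq)
qed

lemma holomorphic_on_param_integral:
  fixes k :: "complex \<Rightarrow> real \<Rightarrow> complex"
  assumes "open A" and cont: "continuous_on (A \<times> {0..1}) (\<lambda>(s,t). k s t)"
    and hol: "\<And>t. t \<in> {0..1} \<Longrightarrow> (\<lambda>s. k s t) holomorphic_on A"
  shows "(\<lambda>s. integral {0..1} (k s)) holomorphic_on A"
proof -
  have "(\<lambda>s. integral {0..1} (k s)) field_differentiable at s0" if "s0 \<in> A" for s0
  proof -
    obtain r where r: "r > 0" "cball s0 r \<subseteq> A"
      using \<open>open A\<close> \<open>s0 \<in> A\<close> open_contains_cball by blast
    have bA: "ball s0 r \<subseteq> A" using r ball_subset_cball by blast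
    have "(\<lambda>s. integral (cbox 0 1) (k s)) holomorphic_on ball s0 r"
    proof (rule leibniz_rule_holomorphic[where fx = "\<lambda>s t. deriv (\<lambda>s. k s t) s"])
      show "((\<lambda>s. k s t) has_field_derivative deriv (\<lambda>s. k s t) s) (at s within ball s0 r)"
        if "s \<in> ball s0 r" "t \<in> cbox 0 1" for s t
        using hol[of t] that bA
        by (metis box_real(2) has_field_derivative_at_within holomorphic_derivI holomorphic_on_subset open_ball)
      show "k s integrable_on cbox 0 1" if "s \<in> ball s0 r" for s
        by (intro integrable_continuous continuous_on_compose2[OF cont, of _ "\<lambda>t. (s, t)", simplified])
           (use that bA in \<open>auto intro!: continuous_intros\<close>)
      show "continuous_on (ball s0 r \<times> cbox 0 1) (\<lambda>(s, t). deriv (\<lambda>s. k s t) s)"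
        unfolding box_real
        by (rule continuous_on_deriv_param)
           (use r bA hol in \<open>auto intro: continuous_on_subset[OF cont] holomorphic_on_subset\<close>)
    qed auto
    thus ?thesis using r
      by (metis box_real(2) centre_in_ball holomorphic_on_imp_differentiable_at open_ball)
  qed
  thus ?thesis
    by (meson field_differentiable_at_within holomorphic_on_def)
qed

text \<open>Restriction to a complex line reduces this to one variable. The contour integrals below
  are fed to it after their path has been pulled back to \<open>{0..1}\<close>.\<close>

lemma line_holomorphic_on_param_integral:
  assumes \<Omega>: "open \<Omega>" and cont: "continuous_on (\<Omega> \<times> {0..1}) (\<lambda>(z,t). K z t)"
    and hol: "\<And>t. t \<in> {0..1} \<Longrightarrow> line_holomorphic_on (\<lambda>z. K z t) \<Omega>"
  shows "line_holomorphic_on (\<lambda>z. integral {0..1::real} (K z)) \<Omega>"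
proof (rule line_holomorphic_onI)
  show "open \<Omega>" by fact
  show "continuous_on \<Omega> (\<lambda>z. integral {0..1} (K z))"
    using integral_continuous_on_param[of \<Omega> 0 "1::real" K] cont by simp
  fix z v assume z: "z \<in> \<Omega>"
  let ?A = "{s. z + s *s v \<in> \<Omega>}"
  have A: "open ?A" by (rule open_line_preimage[OF \<Omega>])
  have "(\<lambda>s. integral {0..1} (\<lambda>t. K (z + s *s v) t)) holomorphic_on ?A"
  proof (rule holomorphic_on_param_integral[OF A])
    show "continuous_on (?A \<times> {0..1}) (\<lambda>(s, t). K (z + s *s v) t)"
      unfolding case_prod_unfold
      by (rule continuous_on_compose2[OF cont, of _ "\<lambda>q. (z + fst q *s v, snd q)", simplified])
         (auto intro!: continuous_intros)
    show "(\<lambda>s. K (z + s *s v) t) holomorphic_on ?A" if "t \<in> {0..1}" for t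
      using line_holomorphic_on_line[OF hol[OF that]] .
  qed
  moreover obtain e where "e > 0" "ball 0 e \<subseteq> ?A"
    using openE[OF A, of 0] z by auto
  ultimately show "\<exists>e>0. (\<lambda>s. integral {0..1} (K (z + s *s v))) holomorphic_on ball 0 e"
    using holomorphic_on_subset by blast
qed

text \<open>The derivative along \<open>v\<close> is a Cauchy integral over a small circle of the
  translates \<open>G (z + u *s v)\<close>, each of which is holomorphic in
  \<open>z\<close>.\<close>

lemma line_holomorphic_on_line_deriv:
  assumes G: "line_holomorphic_on G \<Omega>"
  shows "line_holomorphic_on (line_deriv v G) \<Omega>"
proof (rule line_holomorphic_on_local)
  show "open \<Omega>" using G by (rule line_holomorphic_on_open)
  fix z0 assume "z0 \<in> \<Omega>"
  then obtain e where e: "e > 0" "ball z0 e \<subseteq> \<Omega>"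
    using \<open>open \<Omega>\<close> openE by blast
  \<comment> \<open>Small enough that \<open>cmod s \<le> \<eta>\<close> moves a point by at most
    \<open>e / 2\<close>, so one circle serves the whole half-size ball; the added 1 covers
    \<open>v = 0\<close>.\<close>
  define \<eta> where "\<eta> = e / (2 * (norm v + 1))"
  have \<eta>: "\<eta> > 0" "\<eta> * norm v \<le> e / 2"
    using e by (auto simp: \<eta>_def field_simps add_pos_nonneg)
  have in\<Omega>: "z + s *s v \<in> \<Omega>" if "z \<in> ball z0 (e/2)" "cmod s \<le> \<eta>" for z s
  proof -
    have "dist z0 (z + s *s v) \<le> dist z0 z + norm (s *s v)"
      by (metis add.commute add_diff_cancel_right' dist_commute dist_norm dist_triangle)
    also have "norm (s *s v) \<le> \<eta> * norm v"
      using that by (simp add: norm_vector_smult mult_right_mono)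
    finally have "dist z0 (z + s *s v) < e"
      using \<eta> that by simp
    thus ?thesis using e by auto
  qed
  define c where "c = circlepath 0 \<eta>"
  have c_in: "cmod (c u) = \<eta>" if "u \<in> {0..1}" for u
    using that \<eta> path_image_circlepath_nonneg[of \<eta> 0] unfolding c_def path_image_def by fastforce
  have dc: "vector_derivative c (at u) = 2 * of_real pi * \<i> * \<eta> * exp (2 * of_real pi * \<i> * u)" for u
    by (simp add: c_def vector_derivative_circlepath)
  have cc: "continuous_on UNIV c"
    unfolding c_def circlepath by (intro continuous_intros)
  define K where "K = (\<lambda>z t. inverse (2 * of_real pi * \<i>) * (G (z + c t *s v) * (vector_derivative c (at t) / (c t)\<^sup>2)))"
  have eq: "line_deriv v G z = integral {0..1} (K z)" if "z \<in> ball z0 (e/2)" for z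
  proof -
    have sub: "cball 0 \<eta> \<subseteq> {s. z + s *s v \<in> \<Omega>}" using in\<Omega>[OF that] by auto
    have h: "(\<lambda>s. G (z + s *s v)) holomorphic_on cball 0 \<eta>"
      using line_holomorphic_on_line[OF G] sub holomorphic_on_subset by blast
    have "contour_integral c (\<lambda>u. G (z + u *s v) / u\<^sup>2) = 2 * of_real pi * \<i> * line_deriv v G z"
      using Cauchy_has_contour_integral_higher_derivative_circlepath
          [OF holomorphic_on_imp_continuous_on[OF h] holomorphic_on_subset[OF h ball_subset_cball], of 0 1] \<eta>
      by (simp add: c_def contour_integral_unique numeral_2_eq_2 line_deriv_def)
    moreover have "contour_integral c (\<lambda>u. G (z + u *s v) / u\<^sup>2) = 2 * of_real pi * \<i> * integral {0..1} (K z)"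
      unfolding contour_integral_integral K_def integral_mult_right
      by (simp add: field_simps)
    ultimately show ?thesis by simp
  qed
  have "line_holomorphic_on (\<lambda>z. integral {0..1} (K z)) (ball z0 (e/2))"
  proof (rule line_holomorphic_on_param_integral)
    have kc: "continuous_on (ball z0 (e/2) \<times> {0..1}) (\<lambda>q. G (fst q + c (snd q) *s v))"
      by (rule continuous_on_compose2[OF line_holomorphic_on_continuous[OF G]])
         (use in\<Omega> c_in in \<open>force intro!: continuous_intros continuous_on_compose2[OF cc]\<close>)+
    show "continuous_on (ball z0 (e/2) \<times> {0..1}) (\<lambda>(z, t). K z t)"
      unfolding K_def case_prod_unfold dc
      by (intro continuous_intros kc continuous_on_compose2[OF cc])
         (use c_in \<eta> in \<open>force+\<close>)
    show "line_holomorphic_on (\<lambda>z. K z t) (ball z0 (e/2))" if "t \<in> {0..1}" for t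
      unfolding K_def
      by (intro line_holomorphic_on_mult line_holomorphic_on_const line_holomorphic_on_shift[OF G])
         (use in\<Omega> c_in that in auto)
  qed auto
  hence "line_holomorphic_on (line_deriv v G) (ball z0 (e/2))"
    by (rule line_holomorphic_on_cong) (simp add: eq)
  thus "\<exists>e>0. line_holomorphic_on (line_deriv v G) (ball z0 e)"
    using e half_gt_zero by blast
qed

lemma line_holomorphic_on_uniform_limit:
  assumes \<Omega>: "open \<Omega>" and ev: "\<forall>\<^sub>F X in F. line_holomorphic_on (f X) \<Omega>"
    and lim: "uniform_limit \<Omega> f g F" and F: "F \<noteq> bot"
  shows "line_holomorphic_on g \<Omega>"
proof (rule line_holomorphic_onI)
  show "open \<Omega>" by fact
  show "continuous_on \<Omega> g"
    by (rule uniform_limit_theorem[OF _ lim F])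
       (use ev in \<open>auto elim!: eventually_mono intro: line_holomorphic_on_continuous\<close>)
  fix z v assume "z \<in> \<Omega>"
  then obtain e where e: "e > 0" "cball 0 e \<subseteq> {s. z + s *s v \<in> \<Omega>}"
    using open_contains_cball[THEN iffD1, OF open_line_preimage[OF \<Omega>, of z v], rule_format, of 0] by auto
  have ul: "uniform_limit (cball 0 e) (\<lambda>X s. f X (z + s *s v)) (\<lambda>s. g (z + s *s v)) F"
    by (rule uniform_limit_compose'[OF lim]) (use e in auto)
  have ev': "\<forall>\<^sub>F X in F. continuous_on (cball 0 e) (\<lambda>s. f X (z + s *s v)) \<and> (\<lambda>s. f X (z + s *s v)) holomorphic_on ball 0 e"
    using ev
  proof eventually_elim
    case (elim X)
    have "(\<lambda>s. f X (z + s *s v)) holomorphic_on cball 0 e"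
      using line_holomorphic_on_line[OF elim] e holomorphic_on_subset by blast
    thus ?case
      using holomorphic_on_imp_continuous_on holomorphic_on_subset ball_subset_cball by blast
  qed
  have "(\<lambda>s. g (z + s *s v)) holomorphic_on ball 0 e"
    by (rule holomorphic_uniform_limit[OF ev' ul F])
  with e show "\<exists>e>0. (\<lambda>s. g (z + s *s v)) holomorphic_on ball 0 e" by blast
qed

text \<open>The real power series is evaluated at complex arguments. Its absolute convergence at a
  single real point, all of whose coordinate offsets equal \<open>\<delta>\<close>, gives a majorant
  on a complex polydisc; real coefficients give the symmetry under conjugation.\<close>

lemma real_analytic_complexification:
  fixes f :: "real^'n \<Rightarrow> real"
  assumes "real_analytic_on f V" "p \<in> V"
  obtains \<epsilon> F where "\<epsilon> > 0" "line_holomorphic_on F (ball (cvec p) \<epsilon>)"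
    "\<And>x. x \<in> ball p \<epsilon> \<Longrightarrow> F (cvec x) = of_real (f x)"
    "\<And>z. z \<in> ball (cvec p) \<epsilon> \<Longrightarrow> F (\<chi> i. cnj (z $ i)) = cnj (F z)"
proof -
  obtain r c where r: "r > 0"
    and c: "\<And>x. x \<in> ball p r \<Longrightarrow> ((\<lambda>\<alpha>. c \<alpha> * monomial_at p \<alpha> x) has_sum f x) UNIV"
    using assms unfolding real_analytic_on_def by meson
  \<comment> \<open>Offsets of this size in all \<open>CARD('n)\<close> coordinates have l1 norm
    \<open>r / 2\<close>, so the corner point \<open>x1\<close> lies in the ball of
    convergence.\<close>
  define \<delta> where "\<delta> = r / (2 * real CARD('n))"
  have \<delta>: "\<delta> > 0" "\<delta> \<le> r" "real CARD('n) * \<delta> < r"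
  proof -
    define N where "N = real CARD('n)"
    have "N \<ge> 1" by (simp add: N_def Suc_leI)
    thus "\<delta> > 0" "\<delta> \<le> r" "real CARD('n) * \<delta> < r"
      using r unfolding \<delta>_def N_def[symmetric] by (auto simp: field_simps)
  qed
  define x1 where "x1 = p + (\<chi> i. \<delta>)"
  have "norm ((\<chi> i. \<delta>)::real^'n) \<le> (\<Sum>i\<in>(UNIV::'n set). \<bar>\<delta>\<bar>)"
    using norm_le_l1_cart[of "(\<chi> i. \<delta>)::real^'n"] by simp
  also have "\<dots> < r" using \<delta> by simp
  finally have "x1 \<in> ball p r" by (simp add: x1_def dist_norm)
  from c[OF this] have "(\<lambda>\<alpha>. c \<alpha> * (\<Prod>i\<in>UNIV. \<delta> ^ \<alpha> i)) summable_on UNIV"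
    by (auto simp: monomial_at_def x1_def summable_on_def)
  \<comment> \<open>For real families unordered summability is already absolute.\<close>
  hence sumM: "(\<lambda>\<alpha>. \<bar>c \<alpha>\<bar> * (\<Prod>i\<in>UNIV. \<delta> ^ \<alpha> i)) summable_on UNIV"
    by (subst (asm) summable_on_iff_abs_summable_on_real) (use \<delta> in \<open>simp add: abs_mult abs_prod\<close>)
  define tm where "tm = (\<lambda>\<alpha> (z::complex^'n). of_real (c \<alpha>) * (\<Prod>i\<in>UNIV. (z $ i - of_real (p $ i)) ^ \<alpha> i))"
  have bound: "norm (tm \<alpha> z) \<le> \<bar>c \<alpha>\<bar> * (\<Prod>i\<in>UNIV. \<delta> ^ \<alpha> i)" if "z \<in> ball (cvec p) \<delta>" for \<alpha> z
  proof -
    have "norm (z $ i - of_real (p $ i)) \<le> \<delta>" for i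
      using that Finite_Cartesian_Product.norm_nth_le[of "z - cvec p" i] by (simp add: dist_norm norm_minus_commute)
    thus ?thesis
      unfolding tm_def norm_mult prod_norm[symmetric] norm_power norm_of_real
      by (intro mult_left_mono prod_mono conjI power_mono) auto
  qed
  define F where "F = (\<lambda>z. \<Sum>\<^sub>\<infinity>\<alpha>. tm \<alpha> z)"
  have ul: "uniform_limit (ball (cvec p) \<delta>) (\<lambda>X z. \<Sum>\<alpha>\<in>X. tm \<alpha> z) F (finite_subsets_at_top UNIV)"
    unfolding F_def by (rule Weierstrass_m_test_general[OF bound sumM])
  have sums: "((\<lambda>\<alpha>. tm \<alpha> z) has_sum F z) UNIV" if "z \<in> ball (cvec p) \<delta>" for z
    unfolding F_def
    by (rule has_sum_infsum[OF abs_summable_summable[OF Infinite_Sum.abs_summable_on_comparison_test'[OF sumM]]])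
       (rule bound[OF that])
  show ?thesis
  proof (rule that[of \<delta> F])
    show "\<delta> > 0" by fact
    have "line_holomorphic_on (\<lambda>z. z $ i - of_real (p $ i)) (ball (cvec p) \<delta>)" for i
      by (intro line_holomorphic_on_diff line_holomorphic_on_nth line_holomorphic_on_const) auto
    hence pw: "line_holomorphic_on (\<lambda>z. (z $ i - of_real (p $ i)) ^ m) (ball (cvec p) \<delta>)" for i m
      by (induction m) (auto intro!: line_holomorphic_on_mult line_holomorphic_on_const)
    show "line_holomorphic_on F (ball (cvec p) \<delta>)"
      by (rule line_holomorphic_on_uniform_limit[OF _ _ ul])
         (auto simp: tm_def intro!: always_eventually line_holomorphic_on_sum line_holomorphic_on_mult
           line_holomorphic_on_const line_holomorphic_on_prod pw)
    show "F (cvec x) = of_real (f x)" if "x \<in> ball p \<delta>" for x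
    proof -
      have "((\<lambda>\<alpha>. of_real (c \<alpha> * monomial_at p \<alpha> x)) has_sum complex_of_real (f x)) UNIV"
        using c[of x] that \<delta> by (intro has_sum_of_real) auto
      moreover have "(\<lambda>\<alpha>. of_real (c \<alpha> * monomial_at p \<alpha> x)) = (\<lambda>\<alpha>. tm \<alpha> (cvec x))"
        by (simp add: fun_eq_iff tm_def monomial_at_def)
      ultimately show ?thesis
        using sums[of "cvec x"] that has_sum_unique by fastforce
    qed
    show "F (\<chi> i. cnj (z $ i)) = cnj (F z)" if "z \<in> ball (cvec p) \<delta>" for z
      unfolding F_def infsum_cnj[symmetric] by (simp add: tm_def)
  qed
qed

subsection \<open>Power series expansion\<close>

definition vec_upd :: "'a^'n \<Rightarrow> 'n \<Rightarrow> 'a \<Rightarrow> 'a^'n" where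
  "vec_upd z j w = (\<chi> i. if i = j then w else z $ i)"

lemma vec_upd_nth: "vec_upd z j w $ i = (if i = j then w else z $ i)"
  by (simp add: vec_upd_def)

text \<open>Exponents are forced to 0 outside \<open>S\<close>, so that variables can be expanded
  one at a time by induction on \<open>S\<close>; for \<open>S = UNIV\<close> this is the full index
  set of a power series.\<close>

definition multi_indices :: "'n set \<Rightarrow> ('n \<Rightarrow> nat) set" where
  "multi_indices S = {\<alpha>. \<forall>i. i \<notin> S \<longrightarrow> \<alpha> i = 0}"

lemma multi_indices_empty: "multi_indices {} = {\<lambda>_. 0}"
  by (auto simp: multi_indices_def)

lemma has_sum_multi_indices_insert:
  assumes "j \<notin> S"
  shows "(g has_sum s) (multi_indices (insert j S)) \<longleftrightarrow>
         ((\<lambda>(\<alpha>, k). g (\<alpha>(j := k))) has_sum s) (multi_indices S \<times> UNIV)"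
  by (rule has_sum_reindex_bij_witness[where i = "\<lambda>(\<alpha>, k). \<alpha>(j := k)" and j = "\<lambda>\<alpha>. (\<alpha>(j := 0), \<alpha> j)"])
     (use assms in \<open>auto simp: multi_indices_def fun_eq_iff\<close>)

lemma multi_indices_updD: "\<alpha> \<in> multi_indices S \<Longrightarrow> j \<notin> S \<Longrightarrow> \<alpha>(j := 0) = \<alpha>"
  by (auto simp: multi_indices_def fun_eq_iff)

lemma prod_upd_insert:
  fixes t :: "'n \<Rightarrow> 'a::comm_monoid_mult"
  assumes "finite S" "j \<notin> S"
  shows "(\<Prod>i\<in>insert j S. t i ^ (\<alpha>(j := k)) i) = (\<Prod>i\<in>S. t i ^ \<alpha> i) * t j ^ k"
proof -
  have "(\<Prod>i\<in>S. t i ^ (\<alpha>(j := k)) i) = (\<Prod>i\<in>S. t i ^ \<alpha> i)"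
    by (rule prod.cong) (use assms in auto)
  thus ?thesis using assms by (simp add: mult.commute)
qed

lemma sum_upd_insert:
  fixes \<alpha> :: "'n \<Rightarrow> nat"
  assumes "finite S" "j \<notin> S"
  shows "(\<Sum>i\<in>insert j S. (\<alpha>(j := k)) i) = (\<Sum>i\<in>S. \<alpha> i) + k"
proof -
  have "(\<Sum>i\<in>S. (\<alpha>(j := k)) i) = (\<Sum>i\<in>S. \<alpha> i)"
    by (rule sum.cong) (use assms in auto)
  thus ?thesis using assms by simp
qed

text \<open>The majorant that Cauchy's estimates lead to: a product of one-variable geometric
  series.\<close>

lemma geometric_multi_summable:
  fixes t :: "'n \<Rightarrow> real"
  assumes "finite S" "\<And>i. 0 \<le> t i" "\<And>i. t i < 1"
  shows "(\<lambda>\<alpha>. \<Prod>i\<in>S. t i ^ \<alpha> i) summable_on multi_indices S"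
  using assms(1)
proof induction
  case empty
  thus ?case by (simp add: multi_indices_empty)
next
  case (insert j S)
  have geo: "((\<lambda>k. t j ^ k) has_sum (1 / (1 - t j))) UNIV"
    using geometric_sums[of "t j"] assms(2,3)[of j] by (intro norm_summable_imp_has_sum) (auto simp: norm_power summable_geometric)
  have "(\<lambda>(\<alpha>, k). (\<Prod>i\<in>S. t i ^ \<alpha> i) * t j ^ k) summable_on multi_indices S \<times> UNIV"
  proof (rule summable_on_SigmaI)
    show "((\<lambda>k. case (\<alpha>, k) of (\<alpha>, k) \<Rightarrow> (\<Prod>i\<in>S. t i ^ \<alpha> i) * t j ^ k) has_sum
            (\<Prod>i\<in>S. t i ^ \<alpha> i) * (1 / (1 - t j))) UNIV" for \<alpha>
      using has_sum_cmult_right[OF geo] by simp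
    show "(\<lambda>\<alpha>. (\<Prod>i\<in>S. t i ^ \<alpha> i) * (1 / (1 - t j))) summable_on multi_indices S"
      by (rule summable_on_cmult_left) (rule insert.IH)
  qed (auto intro!: mult_nonneg_nonneg prod_nonneg zero_le_power assms(2))
  then obtain s where "((\<lambda>(\<alpha>, k). (\<Prod>i\<in>S. t i ^ \<alpha> i) * t j ^ k) has_sum s) (multi_indices S \<times> UNIV)"
    unfolding summable_on_def by blast
  hence "((\<lambda>\<alpha>. \<Prod>i\<in>insert j S. t i ^ \<alpha> i) has_sum s) (multi_indices (insert j S))"
    unfolding has_sum_multi_indices_insert[OF insert.hyps(2)] prod_upd_insert[OF insert.hyps] .
  thus ?case unfolding summable_on_def by blast
qed

lemma vec_upd_line: "vec_upd (z + s *s (v::complex^'n)) j w = vec_upd z j w + s *s vec_upd v j 0"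
  by (simp add: vec_eq_iff vec_upd_nth)

lemma continuous_on_vec_upd [continuous_intros]:
  fixes f :: "'b::topological_space \<Rightarrow> complex^'n"
  assumes "continuous_on A f" "continuous_on A g"
  shows "continuous_on A (\<lambda>x. vec_upd (f x) j (g x))"
proof -
  have "continuous_on A (\<lambda>x. if i = j then g x else f x $ i)" for i
    using assms by (cases "i = j") (auto intro!: continuous_intros)
  thus ?thesis unfolding vec_upd_def by (intro continuous_intros)
qed

lemma vec_upd_same: "vec_upd z j (z $ j) = z"
  by (simp add: vec_eq_iff vec_upd_nth)

lemma open_polydisc: "open {z::complex^'n. \<forall>i. cmod (z $ i) < R}"
proof -
  have "open {z::complex^'n. cmod (z $ i) < R}" for i
    by (intro open_Collect_less continuous_intros)
  hence "open (\<Inter>i. {z::complex^'n. cmod (z $ i) < R})" by (intro open_INT) auto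
  thus ?thesis by (simp add: Collect_all_eq)
qed

text \<open>Cauchy's estimates lose a fixed factor of the radius in every variable unless the coefficient
functions stay holomorphic and bounded on the larger polydisc; hence the two radii.\<close>

lemma line_holomorphic_coefficients:
  fixes G :: "complex^'n \<Rightarrow> complex"
  assumes r: "0 < r" "r < R"
  defines "\<Delta> \<equiv> {z::complex^'n. \<forall>i. cmod (z $ i) < R}"
  assumes G: "line_holomorphic_on G \<Delta>" and M: "\<And>z. z \<in> \<Delta> \<Longrightarrow> cmod (G z) \<le> M"
    and "finite S"
  shows "\<exists>c. (\<forall>\<alpha>. line_holomorphic_on (c \<alpha>) \<Delta> \<and>
      (\<forall>z\<in>\<Delta>. cmod (c \<alpha> z) \<le> M / r ^ (\<Sum>i\<in>S. \<alpha> i)) \<and>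
      (\<forall>z\<in>\<Delta>. \<forall>z'\<in>\<Delta>. (\<forall>i. i \<notin> S \<longrightarrow> z $ i = z' $ i) \<longrightarrow> c \<alpha> z = c \<alpha> z')) \<and>
      (\<forall>z. (\<forall>i. cmod (z $ i) < r) \<longrightarrow>
         ((\<lambda>\<alpha>. c \<alpha> z * (\<Prod>i\<in>S. (z $ i) ^ \<alpha> i)) has_sum G z) (multi_indices S))"
    (is "\<exists>c. ?P S c")
  using \<open>finite S\<close>
proof induction
  case empty
  have "((\<lambda>\<alpha>. G z * (\<Prod>i\<in>{}. (z $ i) ^ \<alpha> i)) has_sum G z) (multi_indices {})" for z
    using has_sum_finite[of "multi_indices {}" "\<lambda>\<alpha>. G z * (\<Prod>i\<in>{}. (z $ i) ^ \<alpha> i)"]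
    by (simp add: multi_indices_empty)
  thus ?case
    by (intro exI[of _ "\<lambda>_. G"]) (use G M in \<open>auto simp: vec_eq_iff[symmetric]\<close>)
next
  case (insert j S)
  from insert.IH obtain c where c: "?P S c" by (rule exE)
  have hol: "\<And>\<alpha>. line_holomorphic_on (c \<alpha>) \<Delta>"
    and bd: "\<And>\<alpha> z. z \<in> \<Delta> \<Longrightarrow> cmod (c \<alpha> z) \<le> M / r ^ (\<Sum>i\<in>S. \<alpha> i)"
    and ind: "\<And>\<alpha> z z'. z \<in> \<Delta> \<Longrightarrow> z' \<in> \<Delta> \<Longrightarrow> (\<And>i. i \<notin> S \<Longrightarrow> z $ i = z' $ i) \<Longrightarrow> c \<alpha> z = c \<alpha> z'"
    and sm: "\<And>z. (\<And>i. cmod (z $ i) < r) \<Longrightarrow>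
         ((\<lambda>\<alpha>. c \<alpha> z * (\<Prod>i\<in>S. (z $ i) ^ \<alpha> i)) has_sum G z) (multi_indices S)"
    using c by blast+
  have op: "open \<Delta>" unfolding \<Delta>_def by (rule open_polydisc)
  have upd: "vec_upd z j w \<in> \<Delta>" if "z \<in> \<Delta>" "cmod w < R" for z w
    using that by (auto simp: \<Delta>_def vec_upd_nth)
  have hol1: "(\<lambda>w. c \<alpha> (vec_upd z j w)) holomorphic_on ball 0 R" if z: "z \<in> \<Delta>" for \<alpha> z
  proof -
    have e: "vec_upd z j w = vec_upd z j 0 + w *s axis j 1" for w
      by (simp add: vec_eq_iff vec_upd_nth axis_def)
    have "(\<lambda>w. c \<alpha> (vec_upd z j 0 + w *s axis j 1)) holomorphic_on ball 0 R"
      by (rule holomorphic_on_subset[OF line_holomorphic_on_line[OF hol]])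
         (use upd[OF z] in \<open>auto simp flip: e\<close>)
    thus ?thesis by (simp flip: e)
  qed
  have hol_r: "(\<lambda>w. c \<alpha> (vec_upd z j w)) holomorphic_on cball 0 r" if z: "z \<in> \<Delta>" for \<alpha> z
    by (rule holomorphic_on_subset[OF hol1[OF z]]) (use r in auto)
  \<comment> \<open>The Taylor coefficient of order \<open>\<beta> j\<close> at 0, in the variable
    \<open>j\<close>, of the coefficient function already found for the variables in
    \<open>S\<close>; resetting \<open>\<beta> j\<close> to 0 gives the index of the latter.\<close>
  define c' where "c' = (\<lambda>\<beta> z. (deriv ^^ \<beta> j) (\<lambda>w. c (\<beta>(j := 0)) (vec_upd z j w)) 0 / fact (\<beta> j))"
  define \<gamma> where "\<gamma> = circlepath 0 r"
  have \<gamma>_in: "cmod (\<gamma> u) = r" if "u \<in> {0..1}" for u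
    using that r path_image_circlepath_nonneg[of r 0] unfolding \<gamma>_def path_image_def by fastforce
  have d\<gamma>: "vector_derivative \<gamma> (at u) = 2 * of_real pi * \<i> * r * exp (2 * of_real pi * \<i> * u)" for u
    by (simp add: \<gamma>_def vector_derivative_circlepath)
  have c\<gamma>: "continuous_on UNIV \<gamma>"
    unfolding \<gamma>_def circlepath by (intro continuous_intros)
  have hol': "line_holomorphic_on (c' \<beta>) \<Delta>" for \<beta>
  proof -
    define \<alpha> k where "\<alpha> = \<beta>(j := 0)" and "k = \<beta> j"
    define K where "K = (\<lambda>z t. inverse (2 * of_real pi * \<i>) *
       (c \<alpha> (vec_upd z j (\<gamma> t)) * (vector_derivative \<gamma> (at t) / (\<gamma> t) ^ Suc k)))"
    \<comment> \<open>Cauchy's formula makes the Taylor coefficient a parameter integral, which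
      keeps it holomorphic on all of \<open>\<Delta>\<close> with no loss of radius.\<close>
    have "c' \<beta> z = integral {0..1} (K z)" if z: "z \<in> \<Delta>" for z
    proof -
      have "contour_integral \<gamma> (\<lambda>u. c \<alpha> (vec_upd z j u) / u ^ Suc k) = 2 * of_real pi * \<i> * c' \<beta> z"
      proof -
        have "((\<lambda>u. c \<alpha> (vec_upd z j u) / (u - 0) ^ Suc k) has_contour_integral
            of_real (2 * pi) * \<i> / fact k * (deriv ^^ k) (\<lambda>u. c \<alpha> (vec_upd z j u)) 0) \<gamma>"
          unfolding \<gamma>_def
          by (rule Cauchy_has_contour_integral_higher_derivative_circlepath
               [where f = "\<lambda>u. c \<alpha> (vec_upd z j u)" and z = 0 and w = 0 and k = k])
             (use hol_r[OF z, of \<alpha>] r in \<open>auto intro: holomorphic_on_imp_continuous_on holomorphic_on_subset[OF _ ball_subset_cball]\<close>)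
        hence "contour_integral \<gamma> (\<lambda>u. c \<alpha> (vec_upd z j u) / (u - 0) ^ Suc k) =
            of_real (2 * pi) * \<i> / fact k * (deriv ^^ k) (\<lambda>u. c \<alpha> (vec_upd z j u)) 0"
          by (rule contour_integral_unique)
        also have "(deriv ^^ k) (\<lambda>u. c \<alpha> (vec_upd z j u)) 0 = fact k * c' \<beta> z"
          unfolding c'_def \<alpha>_def[symmetric] k_def[symmetric] by simp
        finally show ?thesis by simp
      qed
      moreover have "contour_integral \<gamma> (\<lambda>u. c \<alpha> (vec_upd z j u) / u ^ Suc k) = 2 * of_real pi * \<i> * integral {0..1} (K z)"
        unfolding contour_integral_integral K_def integral_mult_right
        by (simp add: field_simps)
      ultimately show ?thesis by simp
    qed
    moreover have "line_holomorphic_on (\<lambda>z. integral {0..1} (K z)) \<Delta>"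
    proof (rule line_holomorphic_on_param_integral[OF op])
      have kc: "continuous_on (\<Delta> \<times> {0..1}) (\<lambda>q. c \<alpha> (vec_upd (fst q) j (\<gamma> (snd q))))"
        by (rule continuous_on_compose2[OF line_holomorphic_on_continuous[OF hol]])
           (use \<gamma>_in r upd in \<open>force intro!: continuous_intros continuous_on_compose2[OF c\<gamma>]\<close>)+
      show "continuous_on (\<Delta> \<times> {0..1}) (\<lambda>(z, t). K z t)"
        unfolding K_def case_prod_unfold d\<gamma>
        by (intro continuous_intros kc continuous_on_compose2[OF c\<gamma>])
           (use \<gamma>_in r in \<open>force+\<close>)
      show "line_holomorphic_on (\<lambda>z. K z t) \<Delta>" if "t \<in> {0..1}" for t
        unfolding K_def
      proof (intro line_holomorphic_on_mult line_holomorphic_on_const op)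
        show "line_holomorphic_on (\<lambda>z. c \<alpha> (vec_upd z j (\<gamma> t))) \<Delta>"
          by (rule line_holomorphic_on_subset[OF line_holomorphic_on_affine[OF hol, of "\<lambda>z. vec_upd z j (\<gamma> t)" "\<lambda>v. vec_upd v j 0"]])
             (use op \<gamma>_in[OF that] r upd in \<open>auto intro!: continuous_intros simp: vec_upd_line\<close>)
      qed
    qed
    ultimately show ?thesis using line_holomorphic_on_cong by metis
  qed
  have bd': "cmod (c' \<beta> z) \<le> M / r ^ (\<Sum>i\<in>insert j S. \<beta> i)" if z: "z \<in> \<Delta>" for \<beta> z
  proof -
    define \<alpha> k where "\<alpha> = \<beta>(j := 0)" and "k = \<beta> j"
    have "cmod ((deriv ^^ k) (\<lambda>w. c \<alpha> (vec_upd z j w)) 0) \<le> fact k * (M / r ^ (\<Sum>i\<in>S. \<alpha> i)) / r ^ k"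
      by (rule Cauchy_inequality)
         (use hol_r[OF z] r upd[OF z] bd in \<open>auto intro: holomorphic_on_imp_continuous_on holomorphic_on_subset[OF _ ball_subset_cball]\<close>)
    hence "cmod (c' \<beta> z) \<le> (M / r ^ (\<Sum>i\<in>S. \<alpha> i)) / r ^ k"
      by (simp add: c'_def norm_divide \<alpha>_def k_def field_simps)
    also have "\<dots> = M / r ^ ((\<Sum>i\<in>S. \<alpha> i) + k)" by (simp add: power_add)
    also have "(\<Sum>i\<in>S. \<alpha> i) + k = (\<Sum>i\<in>insert j S. \<beta> i)"
      using sum_upd_insert[OF insert.hyps, of \<alpha> k] by (simp add: \<alpha>_def k_def)
    finally show ?thesis .
  qed
  \<comment> \<open>\<open>vec_upd\<close> overwrites coordinate \<open>j\<close>, so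
    \<open>z $ j\<close> no longer enters.\<close>
  have ind': "c' \<beta> z = c' \<beta> z'" if "z \<in> \<Delta>" "z' \<in> \<Delta>" "\<And>i. i \<notin> insert j S \<Longrightarrow> z $ i = z' $ i" for \<beta> z z'
  proof -
    have "\<forall>\<^sub>F w in nhds 0. c (\<beta>(j := 0)) (vec_upd z j w) = c (\<beta>(j := 0)) (vec_upd z' j w)"
      unfolding eventually_nhds
      by (rule exI[of _ "ball 0 R"]) (use r in \<open>auto intro!: ind upd that simp: vec_upd_nth\<close>)
    thus ?thesis unfolding c'_def
      using higher_deriv_cong_ev[OF _ refl] by metis
  qed
  have sm': "((\<lambda>\<beta>. c' \<beta> z * (\<Prod>i\<in>insert j S. (z $ i) ^ \<beta> i)) has_sum G z) (multi_indices (insert j S))"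
    if z: "\<And>i. cmod (z $ i) < r" for z
  proof -
    have "cmod (z $ i) < R" for i using z[of i] r by linarith
    hence z\<Delta>: "z \<in> \<Delta>" by (simp add: \<Delta>_def)
    \<comment> \<open>Cauchy's bound divides by powers of \<open>r\<close>; against the powers of
      \<open>cmod (z $ i)\<close> this leaves ratios below 1.\<close>
    define t where "t = (\<lambda>i. cmod (z $ i) / r)"
    have t: "0 \<le> t i" "t i < 1" for i using r z[of i] by (auto simp: t_def)
    have bdt: "norm (c' \<beta> z * (\<Prod>i\<in>insert j S. (z $ i) ^ \<beta> i)) \<le> M * (\<Prod>i\<in>insert j S. t i ^ \<beta> i)" for \<beta>
    proof -
      have "norm (c' \<beta> z * (\<Prod>i\<in>insert j S. (z $ i) ^ \<beta> i)) \<le> M / r ^ (\<Sum>i\<in>insert j S. \<beta> i) * (\<Prod>i\<in>insert j S. cmod (z $ i) ^ \<beta> i)"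
        unfolding norm_mult prod_norm[symmetric] norm_power
        by (intro mult_right_mono bd' z\<Delta> prod_nonneg) auto
      also have "\<dots> = M * (\<Prod>i\<in>insert j S. t i ^ \<beta> i)"
        unfolding t_def power_divide prod_dividef power_sum by simp
      finally show ?thesis .
    qed
    have "(\<lambda>\<beta>. M * (\<Prod>i\<in>insert j S. t i ^ \<beta> i)) summable_on multi_indices (insert j S)"
      by (intro summable_on_cmult_right geometric_multi_summable) (use insert.hyps t in auto)
    hence "(\<lambda>\<beta>. c' \<beta> z * (\<Prod>i\<in>insert j S. (z $ i) ^ \<beta> i)) summable_on multi_indices (insert j S)"
      by (rule abs_summable_summable[OF Infinite_Sum.abs_summable_on_comparison_test']) (rule bdt)
    hence summ: "(\<lambda>(\<alpha>, k). c' (\<alpha>(j := k)) z * ((\<Prod>i\<in>S. (z $ i) ^ \<alpha> i) * (z $ j) ^ k)) summable_on multi_indices S \<times> UNIV"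
      unfolding summable_on_def has_sum_multi_indices_insert[OF insert.hyps(2)] prod_upd_insert[OF insert.hyps] .
    \<comment> \<open>Summability of the double family permits summing over the new exponent first,
      which is the one-variable Taylor series of \<open>c \<alpha>\<close>, and then over the old
      ones.\<close>
    have "((\<lambda>(\<alpha>, k). c' (\<alpha>(j := k)) z * ((\<Prod>i\<in>S. (z $ i) ^ \<alpha> i) * (z $ j) ^ k)) has_sum G z) (multi_indices S \<times> UNIV)"
    proof (rule has_sum_SigmaI[OF _ sm[OF z] summ])
      fix \<alpha> assume \<alpha>: "\<alpha> \<in> multi_indices S"
      have eq: "c' (\<alpha>(j := k)) z = (deriv ^^ k) (\<lambda>w. c \<alpha> (vec_upd z j w)) 0 / fact k" for k
        by (simp add: c'_def multi_indices_updD[OF \<alpha> insert.hyps(2)])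
      have s: "(\<lambda>k. c' (\<alpha>(j := k)) z * (z $ j) ^ k) sums c \<alpha> z"
        using holomorphic_power_series[OF holomorphic_on_subset[OF hol_r[OF z\<Delta>] ball_subset_cball], of "z $ j" \<alpha>] z[of j]
        by (simp add: eq vec_upd_same)
      have "summable (\<lambda>k. norm (c' (\<alpha>(j := k)) z * (z $ j) ^ k))"
      proof (rule summable_comparison_test')
        show "summable (\<lambda>k. M / r ^ (\<Sum>i\<in>S. \<alpha> i) * t j ^ k)"
          using t[of j] by (intro summable_mult summable_geometric) auto
        show "norm (norm (c' (\<alpha>(j := k)) z * (z $ j) ^ k)) \<le> M / r ^ (\<Sum>i\<in>S. \<alpha> i) * t j ^ k" if "k \<ge> 0" for k
        proof -
          have "cmod (c' (\<alpha>(j := k)) z) \<le> M / r ^ ((\<Sum>i\<in>S. \<alpha> i) + k)"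
            using bd'[OF z\<Delta>, of "\<alpha>(j := k)"] by (simp only: sum_upd_insert[OF insert.hyps])
          hence "cmod (c' (\<alpha>(j := k)) z) * cmod (z $ j) ^ k \<le> M / r ^ ((\<Sum>i\<in>S. \<alpha> i) + k) * cmod (z $ j) ^ k"
            by (intro mult_right_mono) auto
          thus ?thesis by (simp add: norm_mult norm_power t_def power_divide power_add)
        qed
      qed
      hence "((\<lambda>k. c' (\<alpha>(j := k)) z * (z $ j) ^ k) has_sum c \<alpha> z) UNIV"
        using s by (rule norm_summable_imp_has_sum)
      from has_sum_cmult_left[OF this, of "\<Prod>i\<in>S. (z $ i) ^ \<alpha> i"]
      show "((\<lambda>k. case (\<alpha>, k) of (\<alpha>, k) \<Rightarrow> c' (\<alpha>(j := k)) z * ((\<Prod>i\<in>S. (z $ i) ^ \<alpha> i) * (z $ j) ^ k)) has_sum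
           c \<alpha> z * (\<Prod>i\<in>S. (z $ i) ^ \<alpha> i)) UNIV"
        by (simp add: mult_ac)
    qed
    thus ?thesis
      unfolding has_sum_multi_indices_insert[OF insert.hyps(2)] prod_upd_insert[OF insert.hyps] .
  qed
  show ?case
    by (rule exI[of _ c']) (use hol' bd' ind' sm' in blast)
qed

text \<open>The converse of complexification. The charts built later arise from holomorphic
  functions, while submanifolds are defined through real power series; the real parts of the Taylor
  coefficients provide these.\<close>

lemma line_holomorphic_imp_real_analytic:
  fixes T :: "complex^'n \<Rightarrow> complex"
  assumes T: "line_holomorphic_on T \<Omega>"
  shows "real_analytic_on (\<lambda>x. Re (T (cvec x))) {x. cvec x \<in> \<Omega>}"
  unfolding real_analytic_on_def
proof
  fix p :: "real^'n" assume "p \<in> {x. cvec x \<in> \<Omega>}"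
  then obtain e where e: "e > 0" "cball (cvec p) e \<subseteq> \<Omega>"
    using line_holomorphic_on_open[OF T] open_contains_cball by blast
  \<comment> \<open>The norm is at most the sum of the moduli of the coordinates, so a polydisc of
    this radius fits into the ball of radius \<open>e\<close>.\<close>
  define R where "R = e / real CARD('n)"
  have R: "R > 0" using e by (simp add: R_def)
  define \<Delta> where "\<Delta> = {z::complex^'n. \<forall>i. cmod (z $ i) < R}"
  have sub: "z + cvec p \<in> cball (cvec p) e" if "z \<in> \<Delta>" for z
  proof -
    have "norm z \<le> (\<Sum>i\<in>UNIV. cmod (z $ i))"
      unfolding norm_vec_def by (rule L2_set_le_sum) auto
    also have "\<dots> \<le> (\<Sum>i\<in>(UNIV::'n set). R)"
      using that by (intro sum_mono) (auto simp: \<Delta>_def less_imp_le)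
    also have "\<dots> = e" by (simp add: R_def)
    finally show ?thesis by (simp add: dist_norm)
  qed
  have "compact (T ` cball (cvec p) e)"
    by (rule compact_continuous_image)
       (use e line_holomorphic_on_continuous[OF T] continuous_on_subset in auto)
  then obtain M where M: "\<And>z. z \<in> cball (cvec p) e \<Longrightarrow> cmod (T z) \<le> M"
    by (metis bounded_iff compact_imp_bounded imageI)
  have hol: "line_holomorphic_on (\<lambda>z. T (z + cvec p)) \<Delta>"
    by (rule line_holomorphic_on_shift[OF T]) (use sub e open_polydisc[of R] in \<open>auto simp: \<Delta>_def\<close>)
  have "\<exists>c. (\<forall>\<alpha>. line_holomorphic_on (c \<alpha>) \<Delta> \<and>
      (\<forall>z\<in>\<Delta>. cmod (c \<alpha> z) \<le> M / (R/2) ^ (\<Sum>i\<in>UNIV. \<alpha> i)) \<and>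
      (\<forall>z\<in>\<Delta>. \<forall>z'\<in>\<Delta>. (\<forall>i. i \<notin> UNIV \<longrightarrow> z $ i = z' $ i) \<longrightarrow> c \<alpha> z = c \<alpha> z')) \<and>
      (\<forall>z. (\<forall>i. cmod (z $ i) < R/2) \<longrightarrow>
         ((\<lambda>\<alpha>. c \<alpha> z * (\<Prod>i\<in>UNIV. (z $ i) ^ \<alpha> i)) has_sum T (z + cvec p)) (multi_indices UNIV))"
    (is "\<exists>c. ?Q c")
    unfolding \<Delta>_def
    by (rule line_holomorphic_coefficients) (use R hol M sub in \<open>auto simp: \<Delta>_def\<close>)
  then obtain c where c: "?Q c" by (rule exE)
  have ind0: "\<And>\<alpha> z z'. z \<in> \<Delta> \<Longrightarrow> z' \<in> \<Delta> \<Longrightarrow> c \<alpha> z = c \<alpha> z'"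
    and sm0: "\<And>z. (\<And>i. cmod (z $ i) < R/2) \<Longrightarrow>
         ((\<lambda>\<alpha>. c \<alpha> z * (\<Prod>i\<in>UNIV. (z $ i) ^ \<alpha> i)) has_sum T (z + cvec p)) (multi_indices UNIV)"
    using c by blast+
  \<comment> \<open>Once all variables have been expanded the coefficients depend on no coordinate,
    so they are constants and can be read off at 0.\<close>
  have ind: "c \<alpha> z = c \<alpha> 0" if "z \<in> \<Delta>" for \<alpha> z
    using that R by (intro ind0) (auto simp: \<Delta>_def)
  have sm: "((\<lambda>\<alpha>. c \<alpha> z * (\<Prod>i\<in>UNIV. (z $ i) ^ \<alpha> i)) has_sum T (z + cvec p)) UNIV"
    if "\<And>i. cmod (z $ i) < R/2" for z
    using sm0[OF that] by (simp add: multi_indices_def)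
  show "\<exists>r>0. \<exists>c. \<forall>x\<in>ball p r. ((\<lambda>\<alpha>. c \<alpha> * monomial_at p \<alpha> x) has_sum Re (T (cvec x))) UNIV"
  proof (intro exI conjI ballI)
    show "R / 2 > 0" using R by simp
    fix x assume x: "x \<in> ball p (R/2)"
    define z where "z = cvec (x - p)"
    have zi: "cmod (z $ i) < R/2" for i
      using x component_le_norm_cart[of "x - p" i]
      by (simp add: z_def dist_norm norm_minus_commute flip: of_real_diff)
    have "cmod (z $ i) < R" for i using zi[of i] R by linarith
    hence "z \<in> \<Delta>" by (simp add: \<Delta>_def)
    have eq: "c \<alpha> z * (\<Prod>i\<in>UNIV. (z $ i) ^ \<alpha> i) = c \<alpha> 0 * of_real (monomial_at p \<alpha> x)" for \<alpha>
      using ind[OF \<open>z \<in> \<Delta>\<close>] by (simp add: z_def monomial_at_def)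
    have "((\<lambda>\<alpha>. Re (c \<alpha> z * (\<Prod>i\<in>UNIV. (z $ i) ^ \<alpha> i))) has_sum Re (T (z + cvec p))) UNIV"
      by (intro has_sum_Re sm zi)
    thus "((\<lambda>\<alpha>. Re (c \<alpha> 0) * monomial_at p \<alpha> x) has_sum Re (T (cvec x))) UNIV"
      unfolding eq by (simp add: z_def cvec_diff)
  qed
qed

subsection \<open>Zeros of a holomorphic function on a disc\<close>

lemma not_constant_on:
  assumes "a \<in> A" "b \<in> A" "f a \<noteq> f b"
  shows "\<not> f constant_on A"
  using assms unfolding constant_on_def by metis

text \<open>Induction on the number of zeros: one zero is divided out to its full order, which
  leaves the others untouched.\<close>

lemma finite_zeros_factorization:
  assumes "open A" "connected A" "H holomorphic_on A" "finite {s\<in>A. H s = 0}" "\<exists>s\<in>A. H s \<noteq> 0"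
  shows "\<exists>m U. U holomorphic_on A \<and> (\<forall>s\<in>A. U s \<noteq> 0) \<and> (\<forall>r\<in>{s\<in>A. H s = 0}. m r \<ge> (1::nat)) \<and>
           (\<forall>s\<in>A. H s = (\<Prod>r\<in>{s\<in>A. H s = 0}. (s - r) ^ m r) * U s)"
  using assms(3-)
proof (induction "card {s\<in>A. H s = 0}" arbitrary: H)
  case 0
  hence "{s\<in>A. H s = 0} = {}" by simp
  hence "\<forall>s\<in>A. H s \<noteq> 0" by blast
  thus ?case unfolding \<open>{s\<in>A. H s = 0} = {}\<close> using "0.prems"(1)
    by (intro exI[of _ "\<lambda>_. 1"] exI[of _ H] conjI) simp_all
next
  case (Suc k)
  hence "{s\<in>A. H s = 0} \<noteq> {}" by (metis card.empty nat.distinct(1))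
  then obtain \<xi> where \<xi>: "\<xi> \<in> A" "H \<xi> = 0" by blast
  have nc: "\<not> H constant_on A"
    using Suc.prems(3) \<xi> not_constant_on[of \<xi> A _ H] by metis
  obtain g r n where g: "0 < n" "0 < r" "ball \<xi> r \<subseteq> A" "g holomorphic_on ball \<xi> r"
      "\<And>w. w \<in> ball \<xi> r \<Longrightarrow> H w = (w - \<xi>) ^ n * g w" "\<And>w. w \<in> ball \<xi> r \<Longrightarrow> g w \<noteq> 0"
    by (rule holomorphic_factor_zero_nonconstant[OF Suc.prems(1) assms(1,2) \<xi> nc]) blast
  \<comment> \<open>The quotient by \<open>(s - \<xi>) ^ n\<close>; the local cofactor
    \<open>g\<close> supplies its value at \<open>\<xi>\<close>, and the two formulas agree on the
    overlap.\<close>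
  define H1 where "H1 = (\<lambda>s. if s \<in> ball \<xi> r then g s else H s / (s - \<xi>) ^ n)"
  have H1: "H s = (s - \<xi>) ^ n * H1 s" if "s \<in> A" for s
    using g(2) g(5)[of s] by (auto simp: H1_def)
  have 1: "H1 holomorphic_on ball \<xi> r"
    by (rule holomorphic_transform[OF g(4)]) (simp add: H1_def)
  have 2: "H1 holomorphic_on (A - {\<xi>})"
  proof (rule holomorphic_transform)
    show "(\<lambda>s. H s / (s - \<xi>) ^ n) holomorphic_on (A - {\<xi>})"
      by (intro holomorphic_intros holomorphic_on_subset[OF Suc.prems(1)]) auto
  qed (use H1 in auto)
  have "H1 holomorphic_on (ball \<xi> r \<union> (A - {\<xi>}))"
    using 1 2 assms(1) by (intro holomorphic_on_Un) auto
  moreover have "ball \<xi> r \<union> (A - {\<xi>}) = A" using g \<xi> by auto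
  ultimately have hol: "H1 holomorphic_on A" by simp
  have "H1 \<xi> \<noteq> 0" using g by (auto simp: H1_def)
  hence Z: "{s\<in>A. H s = 0} = insert \<xi> {s\<in>A. H1 s = 0}" "\<xi> \<notin> {s\<in>A. H1 s = 0}"
    using H1 \<xi> g(1) by auto
  have fin: "finite {s\<in>A. H1 s = 0}" using Suc.prems(2) Z by auto
  have "k = card {s\<in>A. H1 s = 0}" using Suc.hyps(2) fin Z by simp
  moreover have "\<exists>s\<in>A. H1 s \<noteq> 0" using \<xi> \<open>H1 \<xi> \<noteq> 0\<close> by blast
  ultimately obtain m U where mU: "U holomorphic_on A" "\<forall>s\<in>A. U s \<noteq> 0" "\<forall>r\<in>{s\<in>A. H1 s = 0}. m r \<ge> (1::nat)"
      "\<forall>s\<in>A. H1 s = (\<Prod>r\<in>{s\<in>A. H1 s = 0}. (s - r) ^ m r) * U s"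
    using Suc.hyps(1)[of H1] hol fin by blast
  define Z1 where "Z1 = {s\<in>A. H1 s = 0}"
  have "H s = (\<Prod>r\<in>{s\<in>A. H s = 0}. (s - r) ^ (m(\<xi> := n)) r) * U s" if s: "s \<in> A" for s
  proof -
    have "(\<Prod>r\<in>Z1. (s - r) ^ (m(\<xi> := n)) r) = (\<Prod>r\<in>Z1. (s - r) ^ m r)"
      by (rule prod.cong) (use Z(2) in \<open>auto simp: Z1_def\<close>)
    hence "(\<Prod>r\<in>insert \<xi> Z1. (s - r) ^ (m(\<xi> := n)) r) = (s - \<xi>) ^ n * (\<Prod>r\<in>Z1. (s - r) ^ m r)"
      using fin Z(2) unfolding Z1_def[symmetric] by simp
    moreover have "H s = (s - \<xi>) ^ n * ((\<Prod>r\<in>Z1. (s - r) ^ m r) * U s)"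
      unfolding H1[OF s] Z1_def using mU(4) s by (rule_tac arg_cong[where f = "(*) ((s - \<xi>) ^ n)"]) blast
    ultimately show ?thesis unfolding Z(1) Z1_def[symmetric] by (simp only: mult.assoc)
  qed
  moreover have "\<forall>r\<in>{s\<in>A. H s = 0}. (m(\<xi> := n)) r \<ge> 1" using mU(3) g(1) Z by auto
  ultimately show ?case using mU(1,2) by (intro exI[of _ "m(\<xi> := n)"] exI[of _ U]) blast
qed

text \<open>The nested radii do the work. Zeros satisfy \<open>cmod r < 2 * \<sigma>\<close> and the
  contour has radius \<open>3 * \<sigma>\<close>, hence it keeps distance at least
  \<open>\<sigma>\<close> from each zero and, because of \<open>5 * \<sigma> \<le> 1\<close>, at
  most 1. With \<open>U\<close> the zero-free cofactor, the maximum principle inside the contour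
  gives both pointwise estimates: applied to \<open>1 / U\<close> it bounds \<open>H\<close> below,
  applied to \<open>deriv U s / U s\<close> it bounds the logarithmic derivative apart from its
  poles.\<close>

lemma zeros_on_disc:
  fixes H :: "complex \<Rightarrow> complex"
  assumes \<sigma>: "0 < \<sigma>" "\<sigma> \<le> 1 / 5" and hol: "H holomorphic_on ball 0 (4 * \<sigma>)"
    and c: "c > 0" "\<And>s. 2 * \<sigma> \<le> cmod s \<Longrightarrow> cmod s < 4 * \<sigma> \<Longrightarrow> c \<le> cmod (H s)"
    and M: "\<And>s. cmod s = 3 * \<sigma> \<Longrightarrow> cmod (deriv H s) \<le> M"
  defines "R \<equiv> {s\<in>ball 0 (4 * \<sigma>). H s = 0}"
  shows "finite R \<and> (\<exists>m::complex \<Rightarrow> nat. (\<forall>r\<in>R. m r \<ge> 1) \<and>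
    (\<forall>j. contour_integral (circlepath 0 (3 * \<sigma>)) (\<lambda>s. s ^ j * (deriv H s / H s)) =
         2 * of_real pi * \<i> * (\<Sum>r\<in>R. of_nat (m r) * r ^ j)) \<and>
    real (\<Sum>r\<in>R. m r) \<le> 3 * \<sigma> * M / c \<and>
    (\<forall>s\<in>ball 0 (3 * \<sigma>). (\<Prod>r\<in>R. cmod (s - r) ^ m r) \<le> cmod (H s) / c) \<and>
    (\<forall>s\<in>ball 0 (3 * \<sigma>) - R. cmod (deriv H s) \<le> cmod (H s) * (4 * M / c + (\<Sum>r\<in>R. real (m r) / cmod (s - r)))))"
proof -
  define A where "A = ball (0::complex) (4 * \<sigma>)"
  have A: "open A" "connected A" "H holomorphic_on A" using hol by (auto simp: A_def)
  have nz: "H s \<noteq> 0" if "2 * \<sigma> \<le> cmod s" "cmod s < 4 * \<sigma>" for s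
    using c(2)[OF that] c(1) by auto
  have "cmod (of_real (3 * \<sigma>)) = 3 * \<sigma>" using \<sigma> by (simp add: norm_mult)
  hence s3: "of_real (3 * \<sigma>) \<in> A" "H (of_real (3 * \<sigma>)) \<noteq> 0"
    using nz[of "of_real (3 * \<sigma>)"] \<sigma> by (auto simp: A_def)
  have Rsmall: "cmod r < 2 * \<sigma>" if "r \<in> R" for r
    using that nz[of r] by (force simp: R_def)
  have finR: "finite R"
  proof (cases "R = {}")
    case False
    then obtain r where "r \<in> A" "H r = 0" by (auto simp: R_def A_def)
    hence "\<not> H constant_on A" using not_constant_on[OF _ s3(1)] s3(2) by metis
    moreover have "cball 0 (2 * \<sigma>) \<subseteq> A" using \<sigma> by (auto simp: A_def)
    ultimately have "finite {z\<in>cball 0 (2 * \<sigma>). H z = 0}"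
      by (intro holomorphic_compact_finite_zeros[OF A(3,1,2) compact_cball])
    moreover have "R \<subseteq> {z\<in>cball 0 (2 * \<sigma>). H z = 0}"
      using Rsmall by (auto simp: R_def less_imp_le)
    ultimately show ?thesis using finite_subset by blast
  qed auto
  have RA: "R = {s\<in>A. H s = 0}" by (simp add: R_def A_def)
  obtain m U where U: "U holomorphic_on A" "\<And>s. s \<in> A \<Longrightarrow> U s \<noteq> 0"
      and m: "\<And>r. r \<in> R \<Longrightarrow> m r \<ge> (1::nat)"
      and fac: "\<And>s. s \<in> A \<Longrightarrow> H s = (\<Prod>r\<in>R. (s - r) ^ m r) * U s"
  proof -
    have "\<exists>m U. U holomorphic_on A \<and> (\<forall>s\<in>A. U s \<noteq> 0) \<and> (\<forall>r\<in>R. m r \<ge> (1::nat)) \<and>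
           (\<forall>s\<in>A. H s = (\<Prod>r\<in>R. (s - r) ^ m r) * U s)"
      using finite_zeros_factorization[OF A] finR s3 unfolding RA by blast
    thus ?thesis using that by (elim exE conjE) blast
  qed
  define L where "L = (\<lambda>s. deriv U s / U s)"
  have Lhol: "L holomorphic_on A"
    unfolding L_def using U A(1) by (intro holomorphic_intros) auto
  have logd: "deriv H s / H s = (\<Sum>r\<in>R. of_nat (m r) / (s - r)) + L s" if s: "s \<in> A" "s \<notin> R" for s
  proof -
    let ?P = "\<lambda>s. \<Prod>r\<in>R. (s - r) ^ m r"
    have ne: "s - r \<noteq> 0" if "r \<in> R" for r using that s by auto
    have "((\<lambda>s. (s - r) ^ m r) has_field_derivative of_nat (m r) * (s - r) ^ (m r - 1)) (at s)" for r
      by (auto intro!: derivative_eq_intros)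
    hence "(?P has_field_derivative ?P s * (\<Sum>r\<in>R. of_nat (m r) * (s - r) ^ (m r - 1) / (s - r) ^ m r)) (at s)"
      by (intro has_field_derivative_prod') (use ne in auto)
    moreover have "(\<Sum>r\<in>R. of_nat (m r) * (s - r) ^ (m r - 1) / (s - r) ^ m r) = (\<Sum>r\<in>R. of_nat (m r) / (s - r))"
    proof (rule sum.cong[OF refl])
      fix r assume r: "r \<in> R"
      have "(s - r) ^ m r = (s - r) * (s - r) ^ (m r - 1)"
        using m[OF r] by (metis Suc_diff_1 less_le_trans power_Suc zero_less_one)
      thus "of_nat (m r) * (s - r) ^ (m r - 1) / (s - r) ^ m r = of_nat (m r) / (s - r)"
        using ne[OF r] by simp
    qed
    ultimately have P: "(?P has_field_derivative ?P s * (\<Sum>r\<in>R. of_nat (m r) / (s - r))) (at s)" by simp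
    have "(U has_field_derivative deriv U s) (at s)"
      using U(1) A(1) s(1) holomorphic_derivI by blast
    from DERIV_mult[OF P this]
    have "((\<lambda>s. ?P s * U s) has_field_derivative
        ?P s * (\<Sum>r\<in>R. of_nat (m r) / (s - r)) * U s + deriv U s * ?P s) (at s)" .
    hence "(H has_field_derivative
        ?P s * (\<Sum>r\<in>R. of_nat (m r) / (s - r)) * U s + deriv U s * ?P s) (at s)"
      by (rule has_field_derivative_transform_within_open[OF _ A(1) s(1)]) (simp add: fac)
    hence "deriv H s = ?P s * (\<Sum>r\<in>R. of_nat (m r) / (s - r)) * U s + deriv U s * ?P s"
      by (rule DERIV_imp_deriv)
    moreover have "?P s \<noteq> 0" using ne finR by simp
    ultimately show ?thesis
      using U(2)[OF s(1)] fac[OF s(1)] by (simp add: L_def field_simps)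
  qed
  define \<gamma> where "\<gamma> = circlepath (0::complex) (3 * \<sigma>)"
  have \<gamma>: "path_image \<gamma> = sphere 0 (3 * \<sigma>)" "valid_path \<gamma>" using \<sigma> by (auto simp: \<gamma>_def)
  have cb: "cball 0 (3 * \<sigma>) \<subseteq> A" using \<sigma> by (auto simp: A_def)
  have Une: "U s \<noteq> 0" if "cmod s \<le> 3 * \<sigma>" for s
    using U(2)[of s] cb that by auto
  have onc: "s \<in> A" "s \<notin> R" "cmod s = 3 * \<sigma>" if "s \<in> path_image \<gamma>" for s
    using that \<sigma> Rsmall[of s] by (auto simp: \<gamma> A_def)
  have ps: "contour_integral \<gamma> (\<lambda>s. s ^ j * (deriv H s / H s)) = 2 * of_real pi * \<i> * (\<Sum>r\<in>R. of_nat (m r) * r ^ j)" for j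
  proof -
    have "((\<lambda>s. of_nat (m r) * (s ^ j / (s - r))) has_contour_integral of_nat (m r) * (2 * of_real pi * \<i> * r ^ j)) \<gamma>"
      if "r \<in> R" for r
      unfolding \<gamma>_def using Rsmall[OF that] \<sigma>
      by (intro has_contour_integral_lmul Cauchy_integral_circlepath_simple holomorphic_intros) auto
    hence 1: "((\<lambda>s. \<Sum>r\<in>R. of_nat (m r) * (s ^ j / (s - r))) has_contour_integral
        (\<Sum>r\<in>R. of_nat (m r) * (2 * of_real pi * \<i> * r ^ j))) \<gamma>"
      using finR by (intro has_contour_integral_sum) auto
    \<comment> \<open>The regular part of the logarithmic derivative integrates to 0 by Cauchy's
      theorem, so only the poles contribute.\<close>
    have "(\<lambda>s. s ^ j * L s) holomorphic_on ball 0 (4 * \<sigma>)"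
      using Lhol unfolding A_def by (intro holomorphic_intros)
    hence 2: "((\<lambda>s. s ^ j * L s) has_contour_integral 0) \<gamma>"
      by (rule Cauchy_theorem_disc_simple) (use \<gamma> \<sigma> in \<open>auto simp: \<gamma>_def\<close>)
    have "((\<lambda>s. s ^ j * (deriv H s / H s)) has_contour_integral
        (\<Sum>r\<in>R. of_nat (m r) * (2 * of_real pi * \<i> * r ^ j)) + 0) \<gamma>"
      by (rule has_contour_integral_eq[OF has_contour_integral_add[OF 1 2]])
         (use onc logd in \<open>auto simp: algebra_simps sum_distrib_left\<close>)
    thus ?thesis
      by (simp add: contour_integral_unique sum_distrib_left mult_ac)
  qed
  have lgb: "cmod (deriv H s / H s) \<le> M / c" if "cmod s = 3 * \<sigma>" for s
    unfolding norm_divide using M[OF that] c(1) c(2)[of s] that \<sigma>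
    by (intro frac_le) (auto intro: order_trans[OF norm_ge_zero])
  \<comment> \<open>The case \<open>j = 0\<close> is the argument principle; contour length times
    \<open>M / c\<close>, divided by \<open>2 * pi\<close>, bounds the total multiplicity.\<close>
  have N: "real (\<Sum>r\<in>R. m r) \<le> 3 * \<sigma> * M / c"
  proof -
    have ci: "(\<lambda>s. s ^ 0 * (deriv H s / H s)) contour_integrable_on \<gamma>"
      unfolding \<gamma>_def
    proof (rule contour_integrable_continuous_circlepath)
      have "continuous_on (A - R) (\<lambda>s. deriv H s / H s)"
        by (intro continuous_intros holomorphic_on_imp_continuous_on holomorphic_on_subset[OF holomorphic_deriv[OF A(3,1)]]
             holomorphic_on_subset[OF A(3)]) (auto simp: RA)
      thus "continuous_on (path_image (circlepath 0 (3 * \<sigma>))) (\<lambda>s. s ^ 0 * (deriv H s / H s))"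
        by (simp only: power_0 mult_1) (rule continuous_on_subset, use onc in \<open>auto simp: \<gamma>_def\<close>)
    qed
    have "cmod (contour_integral \<gamma> (\<lambda>s. s ^ 0 * (deriv H s / H s))) \<le> M / c * (2 * pi * (3 * \<sigma>))"
    proof (rule has_contour_integral_bound_circlepath[of "\<lambda>s. s ^ 0 * (deriv H s / H s)"])
      show "((\<lambda>s. s ^ 0 * (deriv H s / H s)) has_contour_integral contour_integral \<gamma> (\<lambda>s. s ^ 0 * (deriv H s / H s))) (circlepath 0 (3 * \<sigma>))"
        using ci has_contour_integral_integral by (simp add: \<gamma>_def)
      show "0 \<le> M / c" using lgb[of "of_real (3 * \<sigma>)"] \<open>cmod (of_real (3 * \<sigma>)) = 3 * \<sigma>\<close> norm_ge_zero order_trans by blast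
    qed (use lgb \<sigma> in auto)
    also have "contour_integral \<gamma> (\<lambda>s. s ^ 0 * (deriv H s / H s)) = 2 * of_real pi * \<i> * of_nat (\<Sum>r\<in>R. m r)"
      unfolding ps by simp
    also have "cmod \<dots> = 2 * pi * real (\<Sum>r\<in>R. m r)" by (simp only: norm_mult norm_of_nat norm_ii norm_of_real) simp
    finally have "2 * pi * real (\<Sum>r\<in>R. m r) \<le> 2 * pi * (3 * \<sigma> * M / c)" by (simp add: mult_ac)
    thus ?thesis by (simp only: mult_le_cancel_left_pos[of "2 * pi"] pi_gt_zero mult_pos_pos zero_less_numeral)
  qed
  have dist5: "\<sigma> \<le> cmod (s - r)" "cmod (s - r) \<le> 1" if "r \<in> R" "cmod s = 3 * \<sigma>" for s r
    using norm_triangle_ineq4[of s r] norm_triangle_ineq2[of s r] Rsmall[OF that(1)] that(2) \<sigma> by linarith+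
  have prod_le: "(\<Prod>r\<in>R. cmod (s - r) ^ m r) \<le> cmod (H s) / c" if s: "s \<in> ball 0 (3 * \<sigma>)" for s
  proof -
    \<comment> \<open>On the contour the product of the distances is at most 1, so there
      \<open>cmod (U s)\<close> is at least \<open>cmod (H s)\<close>, hence at least
      \<open>c\<close>.\<close>
    have "cmod (1 / U s) \<le> 1 / c"
    proof (rule maximum_modulus_frontier[of "\<lambda>s. 1 / U s" "ball 0 (3 * \<sigma>)"])
      show "(\<lambda>s. 1 / U s) holomorphic_on interior (ball 0 (3 * \<sigma>))"
        using Une cb by (intro holomorphic_intros holomorphic_on_subset[OF U(1)]) auto
      show "continuous_on (closure (ball 0 (3 * \<sigma>))) (\<lambda>s. 1 / U s)"
        using Une cb \<sigma> by (intro continuous_intros holomorphic_on_imp_continuous_on holomorphic_on_subset[OF U(1)]) auto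
      fix s :: complex assume "s \<in> frontier (ball 0 (3 * \<sigma>))"
      hence s: "cmod s = 3 * \<sigma>" using \<sigma> by (simp add: frontier_ball)
      hence sA: "s \<in> A" using \<sigma> by (simp add: A_def)
      have "cmod (1 / U s) = (\<Prod>r\<in>R. cmod (s - r) ^ m r) / cmod (H s)"
        using fac[OF sA] U(2)[OF sA] dist5(1)[OF _ s] \<sigma> finR
        by (force simp: norm_mult norm_divide prod_norm[symmetric] norm_power)
      also have "\<dots> \<le> 1 / c"
        using dist5(2)[OF _ s] c(1) c(2)[of s] s \<sigma>
        by (intro frac_le prod_le_1 conjI power_le_one zero_le_power prod_nonneg) auto
      finally show "cmod (1 / U s) \<le> 1 / c" .
    qed (use s in auto)
    hence "c \<le> cmod (U s)" using c(1) U(2)[of s] s cb by (force simp: norm_divide field_simps)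
    hence "(\<Prod>r\<in>R. cmod (s - r) ^ m r) * c \<le> (\<Prod>r\<in>R. cmod (s - r) ^ m r) * cmod (U s)"
      by (intro mult_left_mono prod_nonneg) auto
    also have "\<dots> = cmod (H s)"
      using fac[of s] s cb by (force simp: norm_mult prod_norm[symmetric] norm_power)
    finally show ?thesis using c(1) by (simp add: field_simps)
  qed
  \<comment> \<open>The 4 is 1 + 3: on the contour \<open>deriv H s / H s\<close> gives
    \<open>M / c\<close>, and poles of total multiplicity at most
    \<open>3 * \<sigma> * M / c\<close> give at most \<open>1 / \<sigma>\<close> each.\<close>
  have Lb: "cmod (L s) \<le> 4 * M / c" if s: "s \<in> ball 0 (3 * \<sigma>)" for s
  proof (rule maximum_modulus_frontier[of L "ball 0 (3 * \<sigma>)"])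
    show "L holomorphic_on interior (ball 0 (3 * \<sigma>))"
      using cb by (intro holomorphic_on_subset[OF Lhol]) auto
    show "continuous_on (closure (ball 0 (3 * \<sigma>))) L"
      using cb \<sigma> by (intro holomorphic_on_imp_continuous_on holomorphic_on_subset[OF Lhol]) auto
    fix s :: complex assume "s \<in> frontier (ball 0 (3 * \<sigma>))"
    hence s: "cmod s = 3 * \<sigma>" using \<sigma> by (simp add: frontier_ball)
    hence "s \<in> path_image \<gamma>" using \<sigma> by (simp add: \<gamma>)
    from logd[OF onc(1,2)[OF this]] have "L s = deriv H s / H s - (\<Sum>r\<in>R. of_nat (m r) / (s - r))" by simp
    hence "cmod (L s) \<le> cmod (deriv H s / H s) + cmod (\<Sum>r\<in>R. of_nat (m r) / (s - r))"
      using norm_triangle_ineq4 by metis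
    also have "cmod (\<Sum>r\<in>R. of_nat (m r) / (s - r)) \<le> (\<Sum>r\<in>R. cmod (of_nat (m r) / (s - r)))"
      by (rule norm_sum)
    also have "(\<Sum>r\<in>R. cmod (of_nat (m r) / (s - r))) \<le> (\<Sum>r\<in>R. real (m r) / \<sigma>)"
      using dist5(1)[OF _ s] \<sigma> by (intro sum_mono) (auto simp: norm_divide intro!: divide_left_mono mult_pos_pos intro: less_le_trans)
    also have "\<dots> = real (\<Sum>r\<in>R. m r) / \<sigma>" by (simp add: sum_divide_distrib)
    also have "\<dots> \<le> (3 * \<sigma> * M / c) / \<sigma>" using N \<sigma> by (intro divide_right_mono) auto
    also have "\<dots> = 3 * M / c" using \<sigma> by simp
    finally show "cmod (L s) \<le> 4 * M / c" using lgb[OF s] by simp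
  qed (use s in auto)
  have "cmod (deriv H s) \<le> cmod (H s) * (4 * M / c + (\<Sum>r\<in>R. real (m r) / cmod (s - r)))"
    if s: "s \<in> ball 0 (3 * \<sigma>) - R" for s
  proof -
    have sA: "s \<in> A" using s cb by auto
    have "H s \<noteq> 0" using s sA RA by auto
    hence "cmod (deriv H s) = cmod (H s) * cmod (deriv H s / H s)" by (simp add: norm_divide)
    also have "cmod (deriv H s / H s) \<le> cmod (\<Sum>r\<in>R. of_nat (m r) / (s - r)) + cmod (L s)"
      using logd[OF sA] s norm_triangle_ineq by auto
    also have "cmod (\<Sum>r\<in>R. of_nat (m r) / (s - r)) \<le> (\<Sum>r\<in>R. real (m r) / cmod (s - r))"
      by (rule order_trans[OF norm_sum]) (simp add: norm_divide)
    also have "cmod (L s) \<le> 4 * M / c" using Lb s by simp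
    finally show ?thesis by (simp add: mult_left_mono add.commute)
  qed
  thus ?thesis using finR m ps N prod_le unfolding \<gamma>_def
    by (intro conjI exI[of _ m] ballI allI) blast+
qed

section \<open>Zeros on parallel complex lines, uniformly in the base point\<close>

definition line_zeros :: "(complex^'n \<Rightarrow> complex) \<Rightarrow> complex^'n \<Rightarrow> real \<Rightarrow> complex^'n \<Rightarrow> complex set" where
  "line_zeros G v \<rho> z = {s. cmod s < \<rho> \<and> G (z + s *s v) = 0}"

text \<open>\<open>m z\<close> are the multiplicities of the zeros of \<open>s \<mapsto> G (z + s v)\<close>, and \<open>S j\<close> is their \<open>j\<close>-th power sum.\<close>

locale controlled_zeros =
  fixes G :: "complex^'n \<Rightarrow> complex" and \<Omega> :: "(complex^'n) set" and v P :: "complex^'n"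
    and \<sigma> \<eta> C :: real and m :: "complex^'n \<Rightarrow> complex \<Rightarrow> nat" and S :: "nat \<Rightarrow> complex^'n \<Rightarrow> complex"
  assumes \<sigma>_pos: "0 < \<sigma>" and \<sigma>_le: "\<sigma> \<le> 1 / 5" and \<eta>_pos: "0 < \<eta>" and C_pos: "0 < C"
    and in_domain: "\<And>z s. z \<in> ball P \<eta> \<Longrightarrow> cmod s < 4 * \<sigma> \<Longrightarrow> z + s *s v \<in> \<Omega>"
    and power_sum_holomorphic: "\<And>j. line_holomorphic_on (S j) (ball P \<eta>)"
    and finite_zeros: "\<And>z. z \<in> ball P \<eta> \<Longrightarrow> finite (line_zeros G v (4 * \<sigma>) z)"
    and zeros_small: "\<And>z r. z \<in> ball P \<eta> \<Longrightarrow> r \<in> line_zeros G v (4 * \<sigma>) z \<Longrightarrow> cmod r < 2 * \<sigma>"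
    and mult_pos: "\<And>z r. z \<in> ball P \<eta> \<Longrightarrow> r \<in> line_zeros G v (4 * \<sigma>) z \<Longrightarrow> m z r \<ge> 1"
    and mult_sum_le: "\<And>z. z \<in> ball P \<eta> \<Longrightarrow> real (\<Sum>r\<in>line_zeros G v (4 * \<sigma>) z. m z r) \<le> C"
    and power_sum_eq: "\<And>z j. z \<in> ball P \<eta> \<Longrightarrow> S j z = (\<Sum>r\<in>line_zeros G v (4 * \<sigma>) z. of_nat (m z r) * r ^ j)"
    and prod_zeros_le: "\<And>z s. z \<in> ball P \<eta> \<Longrightarrow> cmod s < 3 * \<sigma> \<Longrightarrow>
       (\<Prod>r\<in>line_zeros G v (4 * \<sigma>) z. cmod (s - r) ^ m z r) \<le> C * cmod (G (z + s *s v))"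
    and line_deriv_le: "\<And>z s. z \<in> ball P \<eta> \<Longrightarrow> cmod s < 3 * \<sigma> \<Longrightarrow> G (z + s *s v) \<noteq> 0 \<Longrightarrow>
       cmod (line_deriv v G (z + s *s v)) \<le>
         cmod (G (z + s *s v)) * (C + (\<Sum>r\<in>line_zeros G v (4 * \<sigma>) z. real (m z r) / cmod (s - r)))"

lemma line_zeros_isolated:
  assumes G: "line_holomorphic_on G \<Omega>" and P: "P \<in> \<Omega>"
    and nz: "\<not> (\<forall>\<^sub>F s in nhds 0. G (P + s *s v) = 0)"
  shows "\<exists>r>0. \<forall>s. 0 < cmod s \<longrightarrow> cmod s < r \<longrightarrow> G (P + s *s v) \<noteq> 0"
proof -
  have op: "open {s. P + s *s v \<in> \<Omega>}" by (rule open_line_preimage[OF line_holomorphic_on_open[OF G]])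
  then obtain r0 where r0: "r0 > 0" "ball 0 r0 \<subseteq> {s. P + s *s v \<in> \<Omega>}"
    by (rule openE[of _ "0::complex"]) (use P in auto)
  have hol: "(\<lambda>s. G (P + s *s v)) holomorphic_on ball 0 r0"
    using line_holomorphic_on_line[OF G] r0 holomorphic_on_subset by blast
  have "\<exists>s\<in>ball 0 r0. G (P + s *s v) \<noteq> 0"
  proof (rule ccontr)
    assume "\<not> ?thesis"
    hence "\<forall>\<^sub>F s in nhds 0. G (P + s *s v) = 0"
      unfolding eventually_nhds by (intro exI[of _ "ball 0 r0"]) (use r0 in auto)
    thus False using nz by simp
  qed
  then obtain \<beta> where \<beta>: "\<beta> \<in> ball 0 r0" "G (P + \<beta> *s v) \<noteq> 0" by blast
  show ?thesis
  proof (cases "G (P + 0 *s v) = 0")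
    case True
    obtain r where r: "0 < r" "\<And>z. z \<in> ball 0 r - {0} \<Longrightarrow> G (P + z *s v) \<noteq> 0"
      by (rule isolated_zeros[OF hol open_ball connected_ball _ True \<beta>(1) \<beta>(2)]) (use r0 in auto)
    thus ?thesis by (intro exI[of _ r]) auto
  next
    case False
    have "isCont (\<lambda>s. G (P + s *s v)) 0"
      using holomorphic_on_imp_continuous_on[OF hol] r0 by (simp add: continuous_on_eq_continuous_at)
    from continuous_at_avoid[OF this, of 0] False obtain r where "0 < r" "\<And>y. dist 0 y < r \<Longrightarrow> G (P + y *s v) \<noteq> 0"
      by (auto simp: dist_commute)
    thus ?thesis by (intro exI[of _ r]) auto
  qed
qed

text \<open>On the line through \<open>P\<close> zeros are isolated, so \<open>G\<close> is bounded
  below on an annulus around \<open>s = 0\<close>. Uniform continuity carries half of that bound to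
  all base points near \<open>P\<close>, and the one-variable estimates then hold with constants
  independent of the base point. The demand \<open>\<sigma> < e\<close> allows the same control to
  be used again around a single zero at an arbitrarily small scale.\<close>

lemma controlled_zeros_exist:
  fixes G :: "complex^'n \<Rightarrow> complex"
  assumes G: "line_holomorphic_on G \<Omega>" and P: "P \<in> \<Omega>"
    and nz: "\<not> (\<forall>\<^sub>F s in nhds 0. G (P + s *s v) = 0)" and e: "e > 0"
  shows "\<exists>\<sigma> \<eta> C m S. controlled_zeros G \<Omega> v P \<sigma> \<eta> C m S \<and> \<sigma> < e"
proof -
  obtain \<delta> where \<delta>: "\<delta> > 0" "cball P \<delta> \<subseteq> \<Omega>"
    using line_holomorphic_on_open[OF G] P open_contains_cball by blast
  obtain r1 where r1: "r1 > 0" "\<And>s. 0 < cmod s \<Longrightarrow> cmod s < r1 \<Longrightarrow> G (P + s *s v) \<noteq> 0"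
    using line_zeros_isolated[OF G P nz] by blast
  \<comment> \<open>In this order: the bound asked for by the one-variable lemma;
    \<open>\<sigma> < e\<close>; \<open>4 * \<sigma> < r1\<close>, so that the annulus contains no
    zero; and shifts of length at most \<open>\<delta> / 2\<close> for
    \<open>cmod s \<le> 4 * \<sigma>\<close>.\<close>
  define \<sigma> where "\<sigma> = Min {1/5, e/2, r1/8, \<delta> / (8 * (norm v + 1))}"
  have nv: "norm v + 1 > 0" by (simp add: add_nonneg_pos)
  have "\<sigma> > 0" using e r1(1) \<delta>(1) nv by (simp add: \<sigma>_def)
  have \<sigma>_bounds: "\<sigma> \<le> 1/5" "\<sigma> \<le> e/2" "\<sigma> \<le> r1/8" "\<sigma> \<le> \<delta> / (8 * (norm v + 1))"
    unfolding \<sigma>_def by (rule Min_le; simp)+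
  hence \<sigma>: "\<sigma> > 0" "\<sigma> \<le> 1/5" "\<sigma> < e" "4 * \<sigma> < r1"
    using e r1(1) \<open>\<sigma> > 0\<close> by auto
  have "\<sigma> * (8 * (norm v + 1)) \<le> \<delta>"
    using \<sigma>_bounds(4) nv by (simp only: pos_le_divide_eq mult_pos_pos zero_less_numeral)
  hence \<sigma>v: "4 * \<sigma> * norm v \<le> \<delta> / 2"
    using \<sigma>(1) by (simp add: algebra_simps)
  have inball: "z + s *s v \<in> cball P \<delta>" if "z \<in> cball P (\<delta>/2)" "cmod s \<le> 4 * \<sigma>" for z s
  proof -
    have "dist P (z + s *s v) \<le> dist P z + norm (s *s v)"
      by (metis add.commute add_diff_cancel_right' dist_commute dist_norm dist_triangle)
    also have "norm (s *s v) \<le> 4 * \<sigma> * norm v"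
      using that by (simp add: norm_vector_smult mult_right_mono)
    finally show ?thesis using \<sigma>v that by simp
  qed
  have contG: "continuous_on (cball P \<delta>) G"
    using line_holomorphic_on_continuous[OF G] \<delta> continuous_on_subset by blast
  have contD: "continuous_on (cball P \<delta>) (line_deriv v G)"
    using line_holomorphic_on_continuous[OF line_holomorphic_on_line_deriv[OF G]] \<delta> continuous_on_subset by blast
  have "bounded (line_deriv v G ` cball P \<delta>)"
    by (intro compact_imp_bounded compact_continuous_image contD) auto
  then obtain M where M: "M > 0" "\<And>z. z \<in> cball P \<delta> \<Longrightarrow> cmod (line_deriv v G z) \<le> M"
    unfolding bounded_pos by auto
  define K where "K = cball (0::complex) (4 * \<sigma>) - ball 0 (2 * \<sigma>)"
  have K: "compact K" "of_real (3 * \<sigma>) \<in> K"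
    using \<sigma>(1) by (auto simp: K_def norm_mult intro!: compact_diff)
  have "continuous_on K (\<lambda>s. cmod (G (P + s *s v)))"
    by (intro continuous_intros continuous_on_compose2[OF contG]) (use inball \<delta>(1) in \<open>auto simp: K_def\<close>)
  then obtain s0 where s0: "s0 \<in> K" "\<And>s. s \<in> K \<Longrightarrow> cmod (G (P + s0 *s v)) \<le> cmod (G (P + s *s v))"
    using continuous_attains_inf[OF K(1)] K(2) by blast
  \<comment> \<open>Half of the minimum: a perturbation smaller than \<open>c\<close> still leaves
    \<open>c\<close>.\<close>
  define c where "c = cmod (G (P + s0 *s v)) / 2"
  have "0 < cmod s0" "cmod s0 < r1" using s0(1) \<sigma> by (auto simp: K_def)
  hence c: "c > 0" using r1(2)[of s0] by (simp add: c_def)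
  have "uniformly_continuous_on (cball P \<delta>) G"
    by (intro compact_uniformly_continuous contG) auto
  then obtain \<eta>0 where \<eta>0: "\<eta>0 > 0" "\<And>z z'. z \<in> cball P \<delta> \<Longrightarrow> z' \<in> cball P \<delta> \<Longrightarrow> dist z' z < \<eta>0 \<Longrightarrow> dist (G z') (G z) < c"
    using c unfolding uniformly_continuous_on_def by metis
  define \<eta> where "\<eta> = min \<eta>0 (\<delta> / 2)"
  have \<eta>: "\<eta> > 0" "\<eta> \<le> \<delta> / 2" "\<eta> \<le> \<eta>0" using \<eta>0 \<delta> by (auto simp: \<eta>_def)
  have lower: "c \<le> cmod (G (z + s *s v))" if z: "z \<in> ball P \<eta>" and s: "2 * \<sigma> \<le> cmod s" "cmod s \<le> 4 * \<sigma>" for z s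
  proof -
    have "dist (z + s *s v) (P + s *s v) < \<eta>0" using z \<eta> by (simp add: dist_commute)
    hence "dist (G (z + s *s v)) (G (P + s *s v)) < c"
      using z \<eta> \<delta> s by (intro \<eta>0(2) inball) auto
    moreover have "2 * c \<le> cmod (G (P + s *s v))" using s0(2)[of s] s by (auto simp: c_def K_def)
    ultimately show ?thesis
      using norm_triangle_ineq2[of "G (P + s *s v)" "G (z + s *s v)"] by (simp add: dist_norm norm_minus_commute)
  qed
  have hol: "(\<lambda>s. G (z + s *s v)) holomorphic_on ball 0 (4 * \<sigma>)" if z: "z \<in> ball P \<eta>" for z
    by (rule holomorphic_on_subset[OF line_holomorphic_on_line[OF G]])
       (use inball[of z] z \<eta> \<delta> in \<open>auto simp: subset_iff\<close>)
  have der: "deriv (\<lambda>s. G (z + s *s v)) s = line_deriv v G (z + s *s v)" if z: "z \<in> ball P \<eta>" and s: "cmod s \<le> 4 * \<sigma>" for z s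
    by (rule DERIV_imp_deriv[OF line_holomorphic_on_line_at[OF G]])
       (use inball[of z s] z s \<eta> \<delta> in \<open>auto simp: subset_iff\<close>)
  define R where "R = line_zeros G v (4 * \<sigma>)"
  have R: "R z = {s\<in>ball 0 (4 * \<sigma>). G (z + s *s v) = 0}" for z by (auto simp: R_def line_zeros_def)
  define \<gamma> where "\<gamma> = circlepath (0::complex) (3 * \<sigma>)"
  define C where "C = 4 * M / c + 1 / c"
  have C: "C > 0" "4 * M / c \<le> C" "1 / c \<le> C" "3 * \<sigma> * M / c \<le> C"
  proof -
    show "C > 0" "4 * M / c \<le> C" "1 / c \<le> C" using M(1) c by (auto simp: C_def intro: add_pos_pos)
    have "3 * \<sigma> * M / c \<le> 4 * M / c" using \<sigma> M(1) c by (intro divide_right_mono mult_right_mono) auto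
    thus "3 * \<sigma> * M / c \<le> C" using c by (simp add: C_def add_increasing2)
  qed
  have ex: "finite (R z) \<and> (\<exists>m::complex \<Rightarrow> nat. (\<forall>r\<in>R z. m r \<ge> 1) \<and>
    (\<forall>j. contour_integral \<gamma> (\<lambda>s. s ^ j * (deriv (\<lambda>s. G (z + s *s v)) s / G (z + s *s v))) =
         2 * of_real pi * \<i> * (\<Sum>r\<in>R z. of_nat (m r) * r ^ j)) \<and>
    real (\<Sum>r\<in>R z. m r) \<le> 3 * \<sigma> * M / c \<and>
    (\<forall>s\<in>ball 0 (3 * \<sigma>). (\<Prod>r\<in>R z. cmod (s - r) ^ m r) \<le> cmod (G (z + s *s v)) / c) \<and>
    (\<forall>s\<in>ball 0 (3 * \<sigma>) - R z. cmod (deriv (\<lambda>s. G (z + s *s v)) s) \<le>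
       cmod (G (z + s *s v)) * (4 * M / c + (\<Sum>r\<in>R z. real (m r) / cmod (s - r)))))" (is "_ \<and> (\<exists>m. ?Q z m)")
    if z: "z \<in> ball P \<eta>" for z
    unfolding R \<gamma>_def
  proof (rule zeros_on_disc[OF \<sigma>(1,2) hol[OF z] c])
    show "c \<le> cmod (G (z + s *s v))" if "2 * \<sigma> \<le> cmod s" "cmod s < 4 * \<sigma>" for s
      using lower[OF z] that by simp
    show "cmod (deriv (\<lambda>s. G (z + s *s v)) s) \<le> M" if "cmod s = 3 * \<sigma>" for s
    proof -
      have "z + s *s v \<in> cball P \<delta>" using that \<sigma>(1) z \<eta> by (intro inball) auto
      thus ?thesis using M(2) der[OF z, of s] that \<sigma>(1) by simp
    qed
  qed
  \<comment> \<open>Multiplicities are chosen separately for every \<open>z\<close>. No regularity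
    in \<open>z\<close> is claimed for them, only for the power sums.\<close>
  define m where "m = (\<lambda>z. SOME m. ?Q z m)"
  have Q: "?Q z (m z)" if "z \<in> ball P \<eta>" for z
    unfolding m_def by (rule someI_ex[OF conjunct2[OF ex[OF that]]])
  \<comment> \<open>Defined as a contour integral, from which holomorphy in \<open>z\<close> is
    visible; the residue computation identifies it with the power sum.\<close>
  define S where "S = (\<lambda>j z. inverse (2 * of_real pi * \<i>) * contour_integral \<gamma> (\<lambda>s. s ^ j * (line_deriv v G (z + s *s v) / G (z + s *s v))))"
  have \<gamma>_in: "cmod (\<gamma> u) = 3 * \<sigma>" if "u \<in> {0..1}" for u
    using that \<sigma>(1) path_image_circlepath_nonneg[of "3 * \<sigma>" 0] unfolding \<gamma>_def path_image_def by fastforce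
  have d\<gamma>: "vector_derivative \<gamma> (at u) = 2 * of_real pi * \<i> * (3 * \<sigma>) * exp (2 * of_real pi * \<i> * u)" for u
    by (simp add: \<gamma>_def vector_derivative_circlepath)
  have c\<gamma>: "continuous_on UNIV \<gamma>"
    unfolding \<gamma>_def circlepath by (intro continuous_intros)
  have in\<gamma>: "z + \<gamma> u *s v \<in> cball P \<delta>" if "z \<in> ball P \<eta>" "u \<in> {0..1}" for z u
    using that \<gamma>_in[of u] \<sigma>(1) \<eta> by (intro inball) auto
  have ne\<gamma>: "G (z + \<gamma> u *s v) \<noteq> 0" if "z \<in> ball P \<eta>" "u \<in> {0..1}" for z u
    using lower[of z "\<gamma> u"] that \<gamma>_in[of u] \<sigma>(1) c by auto
  have Shol: "line_holomorphic_on (S j) (ball P \<eta>)" for j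
    unfolding S_def contour_integral_integral
  proof (intro line_holomorphic_on_mult line_holomorphic_on_const line_holomorphic_on_param_integral)
    have q: "continuous_on (ball P \<eta> \<times> {0..1}) (\<lambda>q. fst q + \<gamma> (snd q) *s v)"
      by (intro continuous_intros continuous_on_compose2[OF c\<gamma>]) auto
    have 1: "continuous_on (ball P \<eta> \<times> {0..1}) (\<lambda>q. line_deriv v G (fst q + \<gamma> (snd q) *s v))"
      by (rule continuous_on_compose2[OF contD q]) (use in\<gamma> in auto)
    have 2: "continuous_on (ball P \<eta> \<times> {0..1}) (\<lambda>q. G (fst q + \<gamma> (snd q) *s v))"
      by (rule continuous_on_compose2[OF contG q]) (use in\<gamma> in auto)
    show "continuous_on (ball P \<eta> \<times> {0..1}) (\<lambda>(z, t). \<gamma> t ^ j * (line_deriv v G (z + \<gamma> t *s v) / G (z + \<gamma> t *s v)) *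
         vector_derivative \<gamma> (at t))"
      unfolding case_prod_unfold d\<gamma>
      by (intro continuous_intros 1 2 continuous_on_compose2[OF c\<gamma>]) (use ne\<gamma> in auto)
    fix t :: real assume t: "t \<in> {0..1}"
    show "line_holomorphic_on (\<lambda>z. line_deriv v G (z + \<gamma> t *s v) / G (z + \<gamma> t *s v)) (ball P \<eta>)"
      by (intro line_holomorphic_on_divide line_holomorphic_on_shift[OF G]
           line_holomorphic_on_shift[OF line_holomorphic_on_line_deriv[OF G]])
         (use in\<gamma>[OF _ t] ne\<gamma>[OF _ t] \<delta> in \<open>auto simp: subset_iff\<close>)
  qed auto
  have "controlled_zeros G \<Omega> v P \<sigma> \<eta> C m S"
  proof
    fix z assume z: "z \<in> ball P \<eta>"
    note q = Q[OF z]
    show "z + s *s v \<in> \<Omega>" if "cmod s < 4 * \<sigma>" for s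
      using inball[of z s] z that \<eta> \<delta> by (auto simp: subset_iff)
    show "finite (line_zeros G v (4 * \<sigma>) z)" using ex[OF z] by (simp add: R_def)
    show "cmod r < 2 * \<sigma>" if "r \<in> line_zeros G v (4 * \<sigma>) z" for r
      using that lower[OF z, of r] c by (force simp: line_zeros_def)
    show "1 \<le> m z r" if "r \<in> line_zeros G v (4 * \<sigma>) z" for r
      using q that by (simp add: R_def)
    show "real (\<Sum>r\<in>line_zeros G v (4 * \<sigma>) z. m z r) \<le> C"
      using conjunct1[OF conjunct2[OF conjunct2[OF q]]] C(4) by (simp add: R_def)
    show "S j z = (\<Sum>r\<in>line_zeros G v (4 * \<sigma>) z. of_nat (m z r) * r ^ j)" for j
    proof -
      have "contour_integral \<gamma> (\<lambda>s. s ^ j * (line_deriv v G (z + s *s v) / G (z + s *s v))) =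
            contour_integral \<gamma> (\<lambda>s. s ^ j * (deriv (\<lambda>s. G (z + s *s v)) s / G (z + s *s v)))"
        by (rule contour_integral_cong)
           (use \<sigma>(1) in \<open>auto simp: \<gamma>_def intro!: disjI2 arg_cong2[where f = divide] der[OF z, symmetric]\<close>)
      thus ?thesis
        using conjunct1[OF conjunct2[OF q]] by (simp add: S_def R_def field_simps)
    qed
    fix s :: complex assume s: "cmod s < 3 * \<sigma>"
    have "(\<Prod>r\<in>R z. cmod (s - r) ^ m z r) \<le> cmod (G (z + s *s v)) / c"
      using conjunct1[OF conjunct2[OF conjunct2[OF conjunct2[OF q]]]] s by simp
    also have "\<dots> \<le> C * cmod (G (z + s *s v))"
      using mult_right_mono[OF C(3), of "cmod (G (z + s *s v))"] by simp
    finally show "(\<Prod>r\<in>line_zeros G v (4 * \<sigma>) z. cmod (s - r) ^ m z r) \<le> C * cmod (G (z + s *s v))"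
      by (simp add: R_def)
    assume "G (z + s *s v) \<noteq> 0"
    hence "s \<in> ball 0 (3 * \<sigma>) - R z" using s by (simp add: R)
    hence "cmod (deriv (\<lambda>s. G (z + s *s v)) s) \<le>
       cmod (G (z + s *s v)) * (4 * M / c + (\<Sum>r\<in>R z. real (m z r) / cmod (s - r)))"
      using conjunct2[OF conjunct2[OF conjunct2[OF conjunct2[OF q]]]] by blast
    also have "\<dots> \<le> cmod (G (z + s *s v)) * (C + (\<Sum>r\<in>R z. real (m z r) / cmod (s - r)))"
      using C(2) by (intro mult_left_mono add_right_mono) auto
    finally show "cmod (line_deriv v G (z + s *s v)) \<le>
         cmod (G (z + s *s v)) * (C + (\<Sum>r\<in>line_zeros G v (4 * \<sigma>) z. real (m z r) / cmod (s - r)))"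
      using s \<sigma>(1) by (subst (asm) der[OF z]) (auto simp: R_def)
  qed (use \<sigma> \<eta> C Shol in auto)
  thus ?thesis using \<sigma>(3) by blast
qed

subsection \<open>Averaging along lines\<close>

lemma nn_integral_lborel_translate:
  fixes h :: "'a::euclidean_space \<Rightarrow> ennreal"
  assumes [measurable]: "h \<in> borel_measurable borel"
  shows "(\<integral>\<^sup>+x. h (x + a) \<partial>lborel) = (\<integral>\<^sup>+x. h x \<partial>lborel)"
proof -
  have "(\<integral>\<^sup>+x. h x \<partial>lborel) = (\<integral>\<^sup>+x. h x \<partial>(distr lborel borel ((+) a)))"
    by (simp add: lborel_distr_plus)
  also have "\<dots> = (\<integral>\<^sup>+x. h (a + x) \<partial>lborel)"
    by (rule nn_integral_distr) auto
  finally show ?thesis by (simp add: add.commute)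
qed

text \<open>Averaging over translates replaces an integration in coordinates adapted to the direction \<open>v\<close>.\<close>

lemma line_average:
  fixes h :: "'a::euclidean_space \<Rightarrow> ennreal"
  assumes [measurable]: "h \<in> borel_measurable borel" and \<delta>: "\<delta> * norm v \<le> \<eta> / 2"
  shows "ennreal \<delta> * (\<integral>\<^sup>+x. h x * indicator (ball p (\<eta>/2)) x \<partial>lborel) \<le>
    (\<integral>\<^sup>+x. (\<integral>\<^sup>+s. h (x + s *\<^sub>R v) * indicator {0..\<delta>} s \<partial>lborel) * indicator (ball p \<eta>) x \<partial>lborel)"
proof -
  have [measurable]: "ball p r \<in> sets borel" for r by simp
  let ?I = "\<integral>\<^sup>+x. h x * indicator (ball p (\<eta>/2)) x \<partial>lborel"
  \<comment> \<open>The shift has length at most \<open>\<eta> / 2\<close>, which is why the outer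
    integral runs over a ball of twice the radius.\<close>
  have 1: "?I \<le> (\<integral>\<^sup>+x. h (x + s *\<^sub>R v) * indicator (ball p \<eta>) x \<partial>lborel)" if s: "s \<in> {0..\<delta>}" for s
  proof -
    have "?I = (\<integral>\<^sup>+x. h (x + s *\<^sub>R v) * indicator (ball p (\<eta>/2)) (x + s *\<^sub>R v) \<partial>lborel)"
      by (rule nn_integral_lborel_translate[symmetric]) measurable
    also have "\<dots> \<le> (\<integral>\<^sup>+x. h (x + s *\<^sub>R v) * indicator (ball p \<eta>) x \<partial>lborel)"
    proof (intro nn_integral_mono mult_left_mono)
      fix x
      have "x \<in> ball p \<eta>" if "x + s *\<^sub>R v \<in> ball p (\<eta>/2)"
      proof -
        have "dist p x \<le> dist p (x + s *\<^sub>R v) + norm (s *\<^sub>R v)"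
          by (metis add_diff_cancel_left' dist_norm dist_triangle)
        also have "norm (s *\<^sub>R v) \<le> \<delta> * norm v" using s by (simp add: mult_right_mono)
        finally show ?thesis using that \<delta> by simp
      qed
      thus "indicator (ball p (\<eta>/2)) (x + s *\<^sub>R v) \<le> (indicator (ball p \<eta>) x :: ennreal)"
        by (auto simp: indicator_def)
    qed auto
    finally show ?thesis .
  qed
  have "ennreal \<delta> * ?I = (\<integral>\<^sup>+s. ?I * indicator {0..\<delta>} (s::real) \<partial>lborel)"
    by (subst nn_integral_cmult_indicator) (cases "\<delta> \<ge> 0"; simp add: mult.commute ennreal_neg)+
  also have "\<dots> \<le> (\<integral>\<^sup>+s. (\<integral>\<^sup>+x. h (x + s *\<^sub>R v) * indicator (ball p \<eta>) x * indicator {0..\<delta>} s \<partial>lborel) \<partial>lborel)"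
    by (intro nn_integral_mono) (use 1 in \<open>auto simp: indicator_def\<close>)
  also have "\<dots> = (\<integral>\<^sup>+x. (\<integral>\<^sup>+s. h (x + s *\<^sub>R v) * indicator (ball p \<eta>) x * indicator {0..\<delta>} s \<partial>lborel) \<partial>lborel)"
    by (rule lborel_pair.Fubini') measurable
  also have "\<dots> = (\<integral>\<^sup>+x. (\<integral>\<^sup>+s. h (x + s *\<^sub>R v) * indicator {0..\<delta>} s \<partial>lborel) * indicator (ball p \<eta>) x \<partial>lborel)"
    by (intro nn_integral_cong) (auto simp: indicator_def)
  finally show ?thesis .
qed

text \<open>Uniformity in \<open>a\<close> is the point. The difference \<open>s - a\<close> stays
  in \<open>{-2..2}\<close>, so on either side of \<open>a\<close> the integrand is dominated by a
  translate or reflection of \<open>u powr (\<epsilon> - 1)\<close> on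
  \<open>{0..2}\<close>.\<close>

lemma powr_line_integral:
  assumes \<epsilon>: "\<epsilon> > 0"
  shows "\<exists>K<\<infinity>. \<forall>a \<delta>. \<bar>a\<bar> \<le> 1 \<longrightarrow> \<delta> \<le> 1 \<longrightarrow>
    (\<integral>\<^sup>+s. ennreal (\<bar>s - a\<bar> powr (\<epsilon> - 1)) * indicator {0..\<delta>} s \<partial>lborel) \<le> K"
proof -
  let ?f = "\<lambda>u::real. u powr (\<epsilon> - 1) * indicator {0..2} u"
  define I where "I = (2 powr (\<epsilon> - 1 + 1) / (\<epsilon> - 1 + 1) :: real)"
  have "((\<lambda>u. u powr (\<epsilon> - 1)) has_integral I) {0..2}"
    unfolding I_def using \<epsilon> by (intro has_integral_powr_from_0) auto
  hence "((\<lambda>u. if u \<in> {0..2} then u powr (\<epsilon> - 1) else 0) has_integral I) UNIV"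
    by (simp only: has_integral_restrict_UNIV)
  also have "(\<lambda>u. if u \<in> {0..2} then u powr (\<epsilon> - 1) else 0) = ?f"
    by (auto simp: fun_eq_iff indicator_def)
  finally have f: "(\<integral>\<^sup>+u. ennreal (?f u) \<partial>lborel) = ennreal I"
    by (intro nn_integral_has_integral_lborel) auto
  have f': "(\<integral>\<^sup>+u. ennreal (?f (-u)) \<partial>lborel) = ennreal I"
    using nn_integral_real_affine[of "\<lambda>u. ennreal (?f u)" "-1" 0] f by simp
  have "(\<integral>\<^sup>+s. ennreal (\<bar>s - a\<bar> powr (\<epsilon> - 1)) * indicator {0..\<delta>} s \<partial>lborel) \<le> ennreal I + ennreal I"
    if a: "\<bar>a\<bar> \<le> 1" and \<delta>: "\<delta> \<le> 1" for a \<delta>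
  proof -
    have "(\<integral>\<^sup>+s. ennreal (\<bar>s - a\<bar> powr (\<epsilon> - 1)) * indicator {0..\<delta>} s \<partial>lborel) \<le>
        (\<integral>\<^sup>+s. (ennreal (?f (s + (-a))) + ennreal (?f (-(s + (-a))))) \<partial>lborel)"
    proof (rule nn_integral_mono)
      fix s :: real
      show "ennreal (\<bar>s - a\<bar> powr (\<epsilon> - 1)) * indicator {0..\<delta>} s \<le> ennreal (?f (s + (-a))) + ennreal (?f (-(s + (-a))))"
        using a \<delta> by (cases "s - a \<ge> 0"; auto simp: indicator_def)
    qed
    also have "\<dots> = (\<integral>\<^sup>+s. ennreal (?f s) + ennreal (?f (-s)) \<partial>lborel)"
      by (rule nn_integral_lborel_translate[of "\<lambda>s. ennreal (?f s) + ennreal (?f (-s))"]) measurable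
    also have "\<dots> = ennreal I + ennreal I"
      by (subst nn_integral_add) (auto simp: f f')
    finally show ?thesis .
  qed
  thus ?thesis by (intro exI[of _ "ennreal I + ennreal I"]) auto
qed

text \<open>All distances are at least the smallest one, so the product is at least its power with
  the total multiplicity as exponent, and \<open>powr (-\<epsilon>)\<close> turns this into an
  exponent no worse than \<open>-1/2\<close>. Any exponent above -1 would be integrable on a line.
  The summand 1 covers the case of no zeros.\<close>

lemma prod_powr_le:
  fixes d :: "'b \<Rightarrow> real" and m :: "'b \<Rightarrow> nat"
  assumes "finite R" "\<And>r. r \<in> R \<Longrightarrow> 0 < d r" "\<And>r. r \<in> R \<Longrightarrow> d r \<le> 1"
    and \<epsilon>: "\<epsilon> \<ge> 0" "real (\<Sum>r\<in>R. m r) * \<epsilon> \<le> 1 / 2"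
  shows "(\<Prod>r\<in>R. d r ^ m r) powr (-\<epsilon>) \<le> 1 + (\<Sum>r\<in>R. d r powr (-1/2))"
proof (cases "R = {}")
  case False
  define r0 where "r0 = arg_min_on d R"
  have r0: "r0 \<in> R" "\<And>r. r \<in> R \<Longrightarrow> d r0 \<le> d r"
    using arg_min_if_finite[OF assms(1) False, of d] unfolding r0_def by (auto simp: not_less)
  have d0: "0 < d r0" "d r0 \<le> 1" using assms(2,3) r0 by auto
  have "d r0 ^ (\<Sum>r\<in>R. m r) = (\<Prod>r\<in>R. d r0 ^ m r)" by (simp add: power_sum)
  also have "\<dots> \<le> (\<Prod>r\<in>R. d r ^ m r)"
    using r0 d0 by (intro prod_mono conjI power_mono zero_le_power) auto
  finally have le: "d r0 ^ (\<Sum>r\<in>R. m r) \<le> (\<Prod>r\<in>R. d r ^ m r)" .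
  have "(\<Prod>r\<in>R. d r ^ m r) powr (-\<epsilon>) \<le> (d r0 ^ (\<Sum>r\<in>R. m r)) powr (-\<epsilon>)"
    using le d0 \<epsilon> by (intro powr_mono2') auto
  also have "\<dots> = d r0 powr (real (\<Sum>r\<in>R. m r) * (-\<epsilon>))"
    using d0 by (simp only: powr_powr flip: powr_realpow)
  also have "\<dots> \<le> d r0 powr (-1/2)"
    using d0 \<epsilon> by (intro powr_mono') auto
  also have "\<dots> \<le> (\<Sum>r\<in>R. d r powr (-1/2))"
    using r0(1) assms(1) by (intro member_le_sum) auto
  finally show ?thesis by simp
qed simp

lemma (in controlled_zeros) card_zeros_le:
  assumes "z \<in> ball P \<eta>"
  shows "real (card (line_zeros G v (4 * \<sigma>) z)) \<le> C"
proof -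
  have "card (line_zeros G v (4 * \<sigma>) z) \<le> (\<Sum>r\<in>line_zeros G v (4 * \<sigma>) z. m z r)"
    using sum_mono[of "line_zeros G v (4 * \<sigma>) z" "\<lambda>_. 1" "m z"] mult_pos[OF assms] by simp
  thus ?thesis using mult_sum_le[OF assms] by linarith
qed

text \<open>On every line \<open>cmod G\<close> dominates a product of distances with boundedly many
  factors, so for a small exponent the line integrals are bounded uniformly in the base point, and
  averaging over base points finishes. The result serves twice: for \<open>F\<close>, to integrate
  the logarithm, and for the discriminant, to pay for the gradient estimate.\<close>

lemma negative_power_integrable:
  fixes G :: "complex^'n \<Rightarrow> complex" and p w :: "real^'n"
  assumes G: "line_holomorphic_on G \<Omega>" and p: "cvec p \<in> \<Omega>"
    and nz: "\<not> (\<forall>\<^sub>F s in nhds 0. G (cvec p + s *s cvec w) = 0)"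
  shows "\<exists>\<eta>>0. \<exists>\<epsilon>>0. \<epsilon> \<le> 1/2 \<and> (AE x in lborel. x \<in> ball p \<eta> \<longrightarrow> G (cvec x) \<noteq> 0) \<and>
    (\<integral>\<^sup>+x. ennreal (cmod (G (cvec x)) powr (-\<epsilon>)) * indicator (ball p \<eta>) x \<partial>lborel) < \<infinity>"
proof -
  obtain \<sigma> \<eta> C m S where "controlled_zeros G \<Omega> (cvec w) (cvec p) \<sigma> \<eta> C m S"
    using controlled_zeros_exist[OF G p nz, of 1] by auto
  then interpret Z: controlled_zeros G \<Omega> "cvec w" "cvec p" \<sigma> \<eta> C m S .
  \<comment> \<open>The total multiplicity is at most \<open>C\<close>, and
    \<open>C * \<epsilon> \<le> 1/2\<close> is what the product estimate requires.\<close>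
  define \<epsilon> where "\<epsilon> = 1 / (2 * (C + 1))"
  have \<epsilon>: "\<epsilon> > 0" "\<epsilon> \<le> 1/2" "C * \<epsilon> \<le> 1/2" using Z.C_pos by (auto simp: \<epsilon>_def field_simps)
  \<comment> \<open>The constant 1 outside makes \<open>h\<close> equal to 1 there, so shifted
    points that leave the ball do no harm.\<close>
  define g where "g x = (if x \<in> ball p \<eta> then cmod (G (cvec x)) else 1)" for x
  have dom: "cvec x \<in> \<Omega>" if "x \<in> ball p \<eta>" for x
    using Z.in_domain[of "cvec x" 0] that Z.\<sigma>_pos by simp
  have [measurable]: "g \<in> borel_measurable borel"
    unfolding g_def
  proof (rule borel_measurable_continuous_on_if)
    show "continuous_on (ball p \<eta>) (\<lambda>x. cmod (G (cvec x)))"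
      by (intro continuous_intros continuous_on_compose2[OF line_holomorphic_on_continuous[OF G]]) (use dom in auto)
  qed auto
  \<comment> \<open>\<open>0 powr (-\<epsilon>)\<close> is 0, so the power alone would not see the
    zeros. With the value infinity the finiteness of the integral also shows that the zeros form a
    null set.\<close>
  define h where "h x = (if g x = 0 then \<infinity> else ennreal (g x powr (-\<epsilon>)))" for x
  have [measurable]: "h \<in> borel_measurable borel" unfolding h_def by measurable
  obtain K where K: "K < \<infinity>" "\<And>a \<delta>. \<bar>a\<bar> \<le> 1 \<Longrightarrow> \<delta> \<le> 1 \<Longrightarrow>
    (\<integral>\<^sup>+s. ennreal (\<bar>s - a\<bar> powr (-1/2)) * indicator {0..\<delta>} s \<partial>lborel) \<le> K"
    using powr_line_integral[of "1/2"] by auto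
  define N where "N = norm w + 1"
  define \<delta> where "\<delta> = min (2 * \<sigma>) (\<eta> / (2 * N))"
  have nw: "N > 0" by (simp add: N_def add_nonneg_pos)
  have \<delta>: "\<delta> > 0" "\<delta> \<le> 2 * \<sigma>" "\<delta> \<le> 1" "\<delta> * norm w \<le> \<eta> / 2"
  proof -
    show "\<delta> > 0" "\<delta> \<le> 2 * \<sigma>" using Z.\<sigma>_pos Z.\<eta>_pos nw by (auto simp: \<delta>_def)
    thus "\<delta> \<le> 1" using Z.\<sigma>_le by simp
    have "\<delta> * norm w \<le> \<delta> * N" using \<open>\<delta> > 0\<close> by (simp add: N_def)
    also have "\<dots> \<le> \<eta> / (2 * N) * N" using nw by (intro mult_right_mono) (auto simp: \<delta>_def)
    also have "\<dots> = \<eta> / 2" using nw by simp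
    finally show "\<delta> * norm w \<le> \<eta> / 2" .
  qed
  define B where "B = ennreal \<delta> + ennreal (C powr \<epsilon>) * (ennreal \<delta> + ennreal C * K)"
  have B: "B < \<infinity>" using K(1) unfolding B_def by (auto simp: ennreal_mult_less_top)
  have line: "(\<integral>\<^sup>+s. h (x + s *\<^sub>R w) * indicator {0..\<delta>} s \<partial>lborel) \<le> B" if x: "x \<in> ball p \<eta>" for x
  proof -
    define R where "R = line_zeros G (cvec w) (4 * \<sigma>) (cvec x)"
    have xP: "cvec x \<in> ball (cvec p) \<eta>" using x by simp
    have fin: "finite R" unfolding R_def by (rule Z.finite_zeros[OF xP])
    \<comment> \<open>For real \<open>s\<close> the distance to \<open>r\<close> is at least the
      distance to \<open>Re r\<close>; the finitely many real parts are a null set on the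
      line.\<close>
    have pt: "h (x + s *\<^sub>R w) \<le> 1 + ennreal (C powr \<epsilon>) * (1 + (\<Sum>r\<in>R. ennreal (\<bar>s - Re r\<bar> powr (-1/2))))"
      if s: "s \<in> {0..\<delta>}" "s \<notin> Re ` R" for s
    proof (cases "x + s *\<^sub>R w \<in> ball p \<eta>")
      case True
      have smod: "cmod (of_real s) < 3 * \<sigma>" using s \<delta> Z.\<sigma>_pos by simp
      have eq: "cvec (x + s *\<^sub>R w) = cvec x + of_real s *s cvec w" by (simp add: cvec_add cvec_scaleR)
      have ge: "g (x + s *\<^sub>R w) = cmod (G (cvec x + of_real s *s cvec w))" using True by (simp add: g_def eq)
      have dpos: "0 < \<bar>s - Re r\<bar>" if "r \<in> R" for r using s(2) that by auto
      have dle: "\<bar>s - Re r\<bar> \<le> cmod (of_real s - r)" for r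
        using abs_Re_le_cmod[of "of_real s - r"] by simp
      have d1: "cmod (of_real s - r) \<le> 1" if "r \<in> R" for r
        using norm_triangle_ineq4[of "of_real s" r] Z.zeros_small[OF xP, of r] that s \<delta> Z.\<sigma>_le by (auto simp: R_def)
      have Npos: "0 < (\<Prod>r\<in>R. cmod (of_real s - r) ^ m (cvec x) r)"
        using dpos dle by (intro prod_pos zero_less_power) (meson less_le_trans)
      have prod_le: "(\<Prod>r\<in>R. cmod (of_real s - r) ^ m (cvec x) r) \<le> C * g (x + s *\<^sub>R w)"
        unfolding ge R_def by (rule Z.prod_zeros_le[OF xP smod])
      hence gpos: "0 < g (x + s *\<^sub>R w)" using Npos Z.C_pos by (metis less_le_trans zero_less_mult_pos)
      have "(C * g (x + s *\<^sub>R w)) powr (-\<epsilon>) \<le> (\<Prod>r\<in>R. cmod (of_real s - r) ^ m (cvec x) r) powr (-\<epsilon>)"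
        using prod_le Npos \<epsilon> by (intro powr_mono2') auto
      also have "\<dots> \<le> 1 + (\<Sum>r\<in>R. cmod (of_real s - r) powr (-1/2))"
      proof (rule prod_powr_le[OF fin])
        show "real (\<Sum>r\<in>R. m (cvec x) r) * \<epsilon> \<le> 1/2"
          using order_trans[OF mult_right_mono[OF Z.mult_sum_le[OF xP], of \<epsilon>] \<epsilon>(3)] \<epsilon>(1)
          unfolding R_def by simp
        show "0 < cmod (of_real s - r)" if "r \<in> R" for r
          using dpos[OF that] dle[of r] by linarith
      qed (use d1 \<epsilon> in auto)
      also have "\<dots> \<le> 1 + (\<Sum>r\<in>R. \<bar>s - Re r\<bar> powr (-1/2))"
        using dpos dle by (intro add_left_mono sum_mono powr_mono2') auto
      finally have "(C * g (x + s *\<^sub>R w)) powr (-\<epsilon>) \<le> 1 + (\<Sum>r\<in>R. \<bar>s - Re r\<bar> powr (-1/2))" .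
      hence "C powr \<epsilon> * (C * g (x + s *\<^sub>R w)) powr (-\<epsilon>) \<le> C powr \<epsilon> * (1 + (\<Sum>r\<in>R. \<bar>s - Re r\<bar> powr (-1/2)))"
        by (intro mult_left_mono) auto
      also have "C powr \<epsilon> * (C * g (x + s *\<^sub>R w)) powr (-\<epsilon>) = g (x + s *\<^sub>R w) powr (-\<epsilon>)"
        using Z.C_pos gpos by (simp add: powr_mult powr_minus field_simps)
      finally have "ennreal (g (x + s *\<^sub>R w) powr (-\<epsilon>)) \<le> ennreal (C powr \<epsilon> * (1 + (\<Sum>r\<in>R. \<bar>s - Re r\<bar> powr (-1/2))))"
        by (rule ennreal_leI)
      also have "\<dots> = ennreal (C powr \<epsilon>) * (1 + (\<Sum>r\<in>R. ennreal (\<bar>s - Re r\<bar> powr (-1/2))))"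
        by (subst ennreal_mult) (auto simp: sum_nonneg sum_ennreal simp flip: ennreal_1)
      finally show ?thesis using gpos by (simp add: h_def add_increasing)
    next
      case False
      thus ?thesis by (simp add: h_def g_def)
    qed
    have "(\<integral>\<^sup>+s. h (x + s *\<^sub>R w) * indicator {0..\<delta>} s \<partial>lborel) \<le>
      (\<integral>\<^sup>+s. (indicator {0..\<delta>} s + ennreal (C powr \<epsilon>) * (indicator {0..\<delta>} s + (\<Sum>r\<in>R. ennreal (\<bar>s - Re r\<bar> powr (-1/2)) * indicator {0..\<delta>} s))) \<partial>lborel)"
    proof (rule nn_integral_mono_AE)
      have "AE s in lborel. \<forall>a\<in>Re ` R. s \<noteq> a"
        using fin by (intro AE_finite_allI AE_lborel_singleton) auto
      thus "AE s in lborel. h (x + s *\<^sub>R w) * indicator {0..\<delta>} s \<le> indicator {0..\<delta>} s + ennreal (C powr \<epsilon>) *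
          (indicator {0..\<delta>} s + (\<Sum>r\<in>R. ennreal (\<bar>s - Re r\<bar> powr (-1/2)) * indicator {0..\<delta>} s))"
      proof eventually_elim
        case (elim s)
        show ?case using pt[of s] elim by (cases "s \<in> {0..\<delta>}") auto
      qed
    qed
    also have "\<dots> = ennreal \<delta> + ennreal (C powr \<epsilon>) * (ennreal \<delta> + (\<Sum>r\<in>R. \<integral>\<^sup>+s. ennreal (\<bar>s - Re r\<bar> powr (-1/2)) * indicator {0..\<delta>} s \<partial>lborel))"
      using \<delta>(1) by (simp add: nn_integral_add nn_integral_cmult nn_integral_sum)
    also have "\<dots> \<le> ennreal \<delta> + ennreal (C powr \<epsilon>) * (ennreal \<delta> + (\<Sum>r\<in>R. K))"
    proof (intro add_left_mono mult_left_mono sum_mono K(2))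
      fix r assume "r \<in> R"
      hence "cmod r < 2 * \<sigma>" using Z.zeros_small[OF xP] by (simp add: R_def)
      thus "\<bar>Re r\<bar> \<le> 1" using abs_Re_le_cmod[of r] Z.\<sigma>_le by linarith
    qed (use \<delta> in auto)
    also have "\<dots> \<le> B"
    proof -
      have "(\<Sum>r\<in>R. K) \<le> ennreal C * K"
        using Z.card_zeros_le[OF xP] Z.C_pos unfolding R_def
        by (simp add: ennreal_of_nat_eq_real_of_nat) (intro mult_right_mono ennreal_leI; simp)
      thus ?thesis unfolding B_def by (intro add_left_mono mult_left_mono) auto
    qed
    finally show ?thesis .
  qed
  have "ennreal \<delta> * (\<integral>\<^sup>+x. h x * indicator (ball p (\<eta>/2)) x \<partial>lborel) \<le>
    (\<integral>\<^sup>+x. (\<integral>\<^sup>+s. h (x + s *\<^sub>R w) * indicator {0..\<delta>} s \<partial>lborel) * indicator (ball p \<eta>) x \<partial>lborel)"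
    by (rule line_average) (use \<delta> in auto)
  also have "\<dots> \<le> (\<integral>\<^sup>+x. B * indicator (ball p \<eta>) x \<partial>lborel)"
    by (intro nn_integral_mono) (use line in \<open>auto simp: indicator_def\<close>)
  also have "\<dots> = B * emeasure lborel (ball p \<eta>)" by (simp add: nn_integral_cmult_indicator)
  also have "\<dots> < \<infinity>" using B emeasure_lborel_ball_finite[of p \<eta>] by (simp add: ennreal_mult_less_top)
  finally have fin: "(\<integral>\<^sup>+x. h x * indicator (ball p (\<eta>/2)) x \<partial>lborel) < \<infinity>"
    using \<delta>(1) by (auto simp: ennreal_mult_less_top)
  show ?thesis
  proof (intro exI conjI)
    have "AE x in lborel. h x * indicator (ball p (\<eta>/2)) x \<noteq> \<infinity>"
      by (rule nn_integral_noteq_infinite) (use fin in \<open>auto intro!: borel_measurable_times_ennreal borel_measurable_indicator\<close>)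
    thus "AE x in lborel. x \<in> ball p (\<eta>/2) \<longrightarrow> G (cvec x) \<noteq> 0"
      by eventually_elim (use Z.\<eta>_pos in \<open>auto simp: h_def g_def split: if_splits\<close>)
    have "(\<integral>\<^sup>+x. ennreal (cmod (G (cvec x)) powr (-\<epsilon>)) * indicator (ball p (\<eta>/2)) x \<partial>lborel) \<le>
        (\<integral>\<^sup>+x. h x * indicator (ball p (\<eta>/2)) x \<partial>lborel)"
      by (intro nn_integral_mono) (use Z.\<eta>_pos in \<open>auto simp: h_def g_def indicator_def\<close>)
    thus "(\<integral>\<^sup>+x. ennreal (cmod (G (cvec x)) powr (-\<epsilon>)) * indicator (ball p (\<eta>/2)) x \<partial>lborel) < \<infinity>"
      using fin by (rule le_less_trans)
  qed (use \<epsilon> Z.\<eta>_pos in auto)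
qed

subsection \<open>Discriminants\<close>

text \<open>Summing over all \<open>k\<close>-tuples of zeros, rather than over \<open>k\<close>-element subsets, makes the discriminant a
polynomial in the power sums of the zeros weighted by their multiplicities \<open>\<mu>\<close>; it needs neither
squarefreeness nor a Weierstrass polynomial.\<close>

definition diff_product :: "nat \<Rightarrow> (nat \<Rightarrow> complex) \<Rightarrow> complex" where
  "diff_product k \<xi> = (\<Prod>(a, b)\<in>{(a, b). a < k \<and> b < k \<and> a \<noteq> b}. \<xi> a - \<xi> b)"

definition discriminant :: "nat \<Rightarrow> complex set \<Rightarrow> (complex \<Rightarrow> nat) \<Rightarrow> complex" where
  "discriminant k R \<mu> = (\<Sum>\<xi>\<in>PiE {..<k} (\<lambda>_. R). (\<Prod>a<k. of_nat (\<mu> (\<xi> a))) * diff_product k \<xi>)"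

lemma finite_off_diagonal: "finite {(a, b). a < (k::nat) \<and> b < k \<and> a \<noteq> b}"
  by (rule finite_subset[of _ "{..<k} \<times> {..<k}"]) auto

text \<open>The list encodes a polynomial by pairs of a coefficient and an exponent vector; it is
  one and the same for all \<open>\<xi>\<close>.\<close>

lemma diff_product_monomials:
  "\<exists>L :: (complex \<times> (nat \<Rightarrow> nat)) list. \<forall>\<xi>. diff_product k \<xi> = (\<Sum>(c, e)\<leftarrow>L. c * (\<Prod>a<k. \<xi> a ^ e a))"
proof -
  have "\<exists>L :: (complex \<times> (nat \<Rightarrow> nat)) list. \<forall>\<xi>. (\<Prod>(a, b)\<in>D. \<xi> a - \<xi> b) = (\<Sum>(c, e)\<leftarrow>L. c * (\<Prod>a<k. \<xi> a ^ e a))"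
    if "finite D" "D \<subseteq> {(a, b). a < k \<and> b < k \<and> a \<noteq> b}" for D
    using that
  proof induction
    case empty
    show ?case by (rule exI[of _ "[(1, \<lambda>_. 0)]"]) simp
  next
    case (insert ab D)
    obtain a b where ab: "ab = (a, b)" "a < k" "b < k" using insert.prems by (cases ab) auto
    obtain L :: "(complex \<times> (nat \<Rightarrow> nat)) list" where
      L: "\<And>\<xi>. (\<Prod>(a, b)\<in>D. \<xi> a - \<xi> b) = (\<Sum>(c, e)\<leftarrow>L. c * (\<Prod>a<k. \<xi> a ^ e a))"
      using insert by auto
    have upd: "(\<Prod>i<k. \<xi> i ^ (e(a := Suc (e a))) i) = \<xi> a * (\<Prod>i<k. \<xi> i ^ e i)" if "a < k" for \<xi> :: "nat \<Rightarrow> complex" and e a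
    proof -
      have "(\<Prod>i\<in>{..<k} - {a}. \<xi> i ^ (e(a := Suc (e a))) i) = (\<Prod>i\<in>{..<k} - {a}. \<xi> i ^ e i)"
        by (rule prod.cong) auto
      thus ?thesis using that
        by (simp add: prod.remove[of "{..<k}" a])
    qed
    define L' where "L' = map (\<lambda>(c, e). (c, e(a := Suc (e a)))) L @ map (\<lambda>(c, e). (-c, e(b := Suc (e b)))) L"
    have "(\<Prod>(a, b)\<in>insert ab D. \<xi> a - \<xi> b) = (\<Sum>(c, e)\<leftarrow>L'. c * (\<Prod>a<k. \<xi> a ^ e a))" for \<xi>
    proof -
      have 1: "(\<Sum>(c, e)\<leftarrow>map (\<lambda>(c, e). (c, e(a := Suc (e a)))) L. c * (\<Prod>a<k. \<xi> a ^ e a)) = \<xi> a * (\<Sum>(c, e)\<leftarrow>L. c * (\<Prod>a<k. \<xi> a ^ e a))"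
        by (induction L) (auto simp: upd[OF ab(2)] algebra_simps simp del: fun_upd_apply)
      have 2: "(\<Sum>(c, e)\<leftarrow>map (\<lambda>(c, e). (-c, e(b := Suc (e b)))) L. c * (\<Prod>a<k. \<xi> a ^ e a)) = - \<xi> b * (\<Sum>(c, e)\<leftarrow>L. c * (\<Prod>a<k. \<xi> a ^ e a))"
        by (induction L) (auto simp: upd[OF ab(3)] algebra_simps simp del: fun_upd_apply)
      have "(\<Prod>(a, b)\<in>insert ab D. \<xi> a - \<xi> b) = (\<xi> a - \<xi> b) * (\<Sum>(c, e)\<leftarrow>L. c * (\<Prod>a<k. \<xi> a ^ e a))"
        using insert.hyps by (simp add: ab L)
      also have "\<dots> = (\<Sum>(c, e)\<leftarrow>L'. c * (\<Prod>a<k. \<xi> a ^ e a))"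
        unfolding L'_def map_append sum_list_append 1 2 by (simp add: algebra_simps)
      finally show ?thesis .
    qed
    thus ?case by blast
  qed
  from this[OF finite_off_diagonal order.refl] show ?thesis unfolding diff_product_def .
qed

text \<open>A sum over all tuples of a product of functions of single entries factors into sums over
  \<open>R\<close>, so each monomial becomes a product of weighted power sums. Because one
  polynomial serves all \<open>R\<close> and \<open>\<mu>\<close>, analytic power sums give a
  discriminant that is analytic in the base point.\<close>

lemma discriminant_power_sums:
  "\<exists>L :: (complex \<times> (nat \<Rightarrow> nat)) list. \<forall>R \<mu>. finite R \<longrightarrow>
     discriminant k R \<mu> = (\<Sum>(c, e)\<leftarrow>L. c * (\<Prod>a<k. \<Sum>r\<in>R. of_nat (\<mu> r) * r ^ e a))"
proof -
  obtain L :: "(complex \<times> (nat \<Rightarrow> nat)) list" where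
    L: "\<And>\<xi>. diff_product k \<xi> = (\<Sum>(c, e)\<leftarrow>L. c * (\<Prod>a<k. \<xi> a ^ e a))"
    using diff_product_monomials by blast
  have "discriminant k R \<mu> = (\<Sum>(c, e)\<leftarrow>L. c * (\<Prod>a<k. \<Sum>r\<in>R. of_nat (\<mu> r) * r ^ e a))"
    if R: "finite R" for R and \<mu> :: "complex \<Rightarrow> nat"
  proof -
    have "(\<Prod>a<k. \<Sum>r\<in>R. of_nat (\<mu> r) * r ^ e a) =
      (\<Sum>\<xi>\<in>PiE {..<k} (\<lambda>_. R). \<Prod>a<k. of_nat (\<mu> (\<xi> a)) * \<xi> a ^ e a)" for e :: "nat \<Rightarrow> nat"
      using R by (intro prod_sum_PiE) auto
    hence eq: "(\<Prod>a<k. \<Sum>r\<in>R. of_nat (\<mu> r) * r ^ e a) =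
      (\<Sum>\<xi>\<in>PiE {..<k} (\<lambda>_. R). (\<Prod>a<k. of_nat (\<mu> (\<xi> a))) * (\<Prod>a<k. \<xi> a ^ e a))" for e :: "nat \<Rightarrow> nat"
      by (simp add: prod.distrib)
    have "(\<Sum>(c, e)\<leftarrow>L. c * (\<Prod>a<k. \<Sum>r\<in>R. of_nat (\<mu> r) * r ^ e a)) =
      (\<Sum>\<xi>\<in>PiE {..<k} (\<lambda>_. R). (\<Prod>a<k. of_nat (\<mu> (\<xi> a))) * (\<Sum>(c, e)\<leftarrow>L. c * (\<Prod>a<k. \<xi> a ^ e a)))"
      unfolding eq
    proof (induction L)
      case (Cons ce L)
      obtain c e where ce: "ce = (c, e)" by (cases ce)
      show ?case
        unfolding ce list.map sum_list.Cons prod.case Cons.IH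
        by (simp only: distrib_left sum.distrib sum_distrib_left mult.left_commute)
    qed simp
    thus ?thesis unfolding discriminant_def L by simp
  qed
  thus ?thesis by blast
qed

lemma diff_product_not_inj:
  assumes "\<not> inj_on \<xi> {..<k}"
  shows "diff_product k \<xi> = 0"
proof -
  obtain a b where "a < k" "b < k" "a \<noteq> b" "\<xi> a = \<xi> b" using assms by (auto simp: inj_on_def)
  thus ?thesis unfolding diff_product_def
    by (intro prod_zero[OF finite_off_diagonal] bexI[of _ "(a, b)"]) auto
qed

text \<open>Pigeonhole: every tuple repeats an entry, and a repetition kills the product of
  differences.\<close>

lemma discriminant_eq_0:
  assumes "finite R" "card R < k"
  shows "discriminant k R \<mu> = 0"
  unfolding discriminant_def
proof (rule sum.neutral, rule ballI)
  fix \<xi> assume \<xi>: "\<xi> \<in> PiE {..<k} (\<lambda>_. R)"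
  have "\<not> inj_on \<xi> {..<k}"
    using card_inj_on_le[of \<xi> "{..<k}" R] \<xi> assms by (auto simp: PiE_def Pi_def)
  thus "(\<Prod>a<k. of_nat (\<mu> (\<xi> a))) * diff_product k \<xi> = 0" by (simp add: diff_product_not_inj)
qed

lemma inj_PiE_bij:
  assumes "finite R" "card R = k" "\<xi> \<in> PiE {..<k} (\<lambda>_. R)" "inj_on \<xi> {..<k}"
  shows "bij_betw \<xi> {..<k} R"
proof -
  have "\<xi> ` {..<k} \<subseteq> R" using assms(3) by auto
  moreover have "card (\<xi> ` {..<k}) = card R" using assms by (simp add: card_image)
  ultimately have "\<xi> ` {..<k} = R" by (rule card_subset_eq[OF assms(1)])
  thus ?thesis using assms(4) by (simp add: bij_betw_def)
qed

text \<open>Only tuples that enumerate \<open>R\<close> survive. The product of differences runs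
  over ordered pairs, both \<open>(a, b)\<close> and \<open>(b, a)\<close>, and is therefore
  invariant under permutations; all surviving terms are equal and cannot cancel.\<close>

lemma discriminant_nonzero:
  assumes R: "finite R" "card R = k" and \<mu>: "\<And>r. r \<in> R \<Longrightarrow> \<mu> r \<ge> 1"
  shows "discriminant k R \<mu> \<noteq> 0"
proof -
  define V where "V = (\<Prod>r\<in>R. of_nat (\<mu> r)) * (\<Prod>(r, r')\<in>{(r, r'). r \<in> R \<and> r' \<in> R \<and> r \<noteq> r'}. r - r')"
  have finRR: "finite {(r, r'). r \<in> R \<and> r' \<in> R \<and> r \<noteq> r'}"
    by (rule finite_subset[of _ "R \<times> R"]) (use R in auto)
  have V: "V \<noteq> 0"
    unfolding V_def using R \<mu> finRR by (force simp: case_prod_unfold)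
  let ?B = "{\<xi> \<in> PiE {..<k} (\<lambda>_. R). inj_on \<xi> {..<k}}"
  have finP: "finite (PiE {..<k} (\<lambda>_. R))" using R by (intro finite_PiE) auto
  have bij: "(\<Prod>a<k. of_nat (\<mu> (\<xi> a))) * diff_product k \<xi> = V" if "\<xi> \<in> ?B" for \<xi>
  proof -
    have b: "bij_betw \<xi> {..<k} R" using inj_PiE_bij[OF R] that by auto
    have 1: "(\<Prod>a<k. of_nat (\<mu> (\<xi> a))) = (\<Prod>r\<in>R. of_nat (\<mu> r) :: complex)"
      by (rule prod.reindex_bij_betw[OF b])
    have "bij_betw (\<lambda>(a, b). (\<xi> a, \<xi> b)) {(a, b). a < k \<and> b < k \<and> a \<noteq> b} {(r, r'). r \<in> R \<and> r' \<in> R \<and> r \<noteq> r'}"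
    proof (rule bij_betwI[where g = "\<lambda>(r, r'). (the_inv_into {..<k} \<xi> r, the_inv_into {..<k} \<xi> r')"])
      have inj: "inj_on \<xi> {..<k}" and im: "\<xi> ` {..<k} = R" using b by (auto simp: bij_betw_def)
      show "(\<lambda>(a, b). (\<xi> a, \<xi> b)) \<in> {(a, b). a < k \<and> b < k \<and> a \<noteq> b} \<rightarrow> {(r, r'). r \<in> R \<and> r' \<in> R \<and> r \<noteq> r'}"
        using inj im by (auto simp: inj_on_def)
      have th: "the_inv_into {..<k} \<xi> r < k" "\<xi> (the_inv_into {..<k} \<xi> r) = r" if "r \<in> R" for r
        using the_inv_into_into[OF inj, of r "{..<k}"] f_the_inv_into_f[OF inj, of r] that im by auto
      show "(\<lambda>(r, r'). (the_inv_into {..<k} \<xi> r, the_inv_into {..<k} \<xi> r')) \<in>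
          {(r, r'). r \<in> R \<and> r' \<in> R \<and> r \<noteq> r'} \<rightarrow> {(a, b). a < k \<and> b < k \<and> a \<noteq> b}"
        by (auto simp: th) (metis th(2))
      show "(case case x of (a, b) \<Rightarrow> (\<xi> a, \<xi> b) of (r, r') \<Rightarrow> (the_inv_into {..<k} \<xi> r, the_inv_into {..<k} \<xi> r')) = x"
        if "x \<in> {(a, b). a < k \<and> b < k \<and> a \<noteq> b}" for x
        using that the_inv_into_f_f[OF inj] by auto
      show "(case case y of (r, r') \<Rightarrow> (the_inv_into {..<k} \<xi> r, the_inv_into {..<k} \<xi> r') of (a, b) \<Rightarrow> (\<xi> a, \<xi> b)) = y"
        if "y \<in> {(r, r'). r \<in> R \<and> r' \<in> R \<and> r \<noteq> r'}" for y
        using that th by auto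
    qed
    from prod.reindex_bij_betw[OF this, of "\<lambda>(r, r'). r - r'"]
    have 2: "diff_product k \<xi> = (\<Prod>(r, r')\<in>{(r, r'). r \<in> R \<and> r' \<in> R \<and> r \<noteq> r'}. r - r')"
      by (simp add: diff_product_def case_prod_unfold)
    show ?thesis by (simp add: V_def 1 2)
  qed
  have "discriminant k R \<mu> = (\<Sum>\<xi>\<in>?B. (\<Prod>a<k. of_nat (\<mu> (\<xi> a))) * diff_product k \<xi>)"
    unfolding discriminant_def
    by (rule sum.mono_neutral_right[OF finP]) (auto simp: diff_product_not_inj)
  also have "\<dots> = of_nat (card ?B) * V" using bij by simp
  finally have eq: "discriminant k R \<mu> = of_nat (card ?B) * V" .
  obtain h where h: "bij_betw h {..<k} R"
    using R by (metis card_lessThan finite_lessThan finite_same_card_bij)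
  have "restrict h {..<k} \<in> ?B"
    using h by (auto simp: bij_betw_def inj_on_def)
  moreover have "finite ?B" using finP by simp
  ultimately have "card ?B \<noteq> 0" using card_eq_0_iff by (metis (lifting) empty_iff)
  thus ?thesis using eq V by simp
qed

text \<open>In a nonzero term one factor is \<open>r1 - r2\<close> and the diameter bound makes the
  others at most 1; the weights of all tuples sum to the \<open>k\<close>-th power of the total
  multiplicity. For a conjugate pair this bounds the imaginary part from below.\<close>

lemma discriminant_le_gap:
  assumes R: "finite R" "card R = k" and diam: "\<And>r r'. r \<in> R \<Longrightarrow> r' \<in> R \<Longrightarrow> cmod (r - r') \<le> 1"
    and r: "r1 \<in> R" "r2 \<in> R" "r1 \<noteq> r2"
  shows "cmod (discriminant k R \<mu>) \<le> real (\<Sum>r\<in>R. \<mu> r) ^ k * cmod (r1 - r2)"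
proof -
  have "cmod (diff_product k \<xi>) \<le> cmod (r1 - r2)" if \<xi>: "\<xi> \<in> PiE {..<k} (\<lambda>_. R)" for \<xi>
  proof (cases "inj_on \<xi> {..<k}")
    case True
    hence im: "\<xi> ` {..<k} = R" using inj_PiE_bij[OF R \<xi>] by (auto simp: bij_betw_def)
    then obtain a b where ab: "a < k" "b < k" "\<xi> a = r1" "\<xi> b = r2" using r by (metis imageE lessThan_iff)
    let ?D = "{(a, b). a < k \<and> b < k \<and> a \<noteq> b}"
    have "(a, b) \<in> ?D" using ab r by auto
    hence "diff_product k \<xi> = (r1 - r2) * (\<Prod>(a, b)\<in>?D - {(a, b)}. \<xi> a - \<xi> b)"
      unfolding diff_product_def using prod.remove[OF finite_off_diagonal, of "(a, b)" k "\<lambda>(a, b). \<xi> a - \<xi> b"] ab by simp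
    moreover have "cmod (\<Prod>(a, b)\<in>?D - {(a, b)}. \<xi> a - \<xi> b) \<le> 1"
      unfolding prod_norm[symmetric] case_prod_unfold
      by (intro prod_le_1) (use im diam in auto)
    ultimately show ?thesis by (simp add: norm_mult mult_left_le)
  qed (simp add: diff_product_not_inj)
  hence "cmod (discriminant k R \<mu>) \<le> (\<Sum>\<xi>\<in>PiE {..<k} (\<lambda>_. R). (\<Prod>a<k. real (\<mu> (\<xi> a))) * cmod (r1 - r2))"
    unfolding discriminant_def
    by (intro order_trans[OF norm_sum] sum_mono)
       (simp add: norm_mult mult_left_mono prod_nonneg flip: prod_norm)
  also have "\<dots> = (\<Prod>a<k. \<Sum>r\<in>R. real (\<mu> r)) * cmod (r1 - r2)"
    using R by (subst prod_sum_PiE) (auto simp: sum_distrib_right)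
  finally show ?thesis by simp
qed

context controlled_zeros
begin

abbreviation "Zs z \<equiv> line_zeros G v (4 * \<sigma>) z"

lemma discriminant_holomorphic:
  "line_holomorphic_on (\<lambda>z. discriminant k (Zs z) (m z)) (ball P \<eta>)"
proof -
  obtain L :: "(complex \<times> (nat \<Rightarrow> nat)) list" where
    L: "\<And>R \<mu>. finite R \<Longrightarrow> discriminant k R \<mu> = (\<Sum>(c, e)\<leftarrow>L. c * (\<Prod>a<k. \<Sum>r\<in>R. of_nat (\<mu> r) * r ^ e a))"
    using discriminant_power_sums by blast
  have "line_holomorphic_on (\<lambda>z. \<Sum>(c, e)\<leftarrow>L. c * (\<Prod>a<k. S (e a) z)) (ball P \<eta>)"
  proof (induction L)
    case (Cons ce L)
    obtain c e where ce: "ce = (c, e)" by (cases ce)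
    have "line_holomorphic_on (\<lambda>z. c * (\<Prod>a<k. S (e a) z) + (\<Sum>(c, e)\<leftarrow>L. c * (\<Prod>a<k. S (e a) z))) (ball P \<eta>)"
      by (intro line_holomorphic_on_add line_holomorphic_on_mult line_holomorphic_on_prod
            line_holomorphic_on_const power_sum_holomorphic Cons) auto
    thus ?case by (simp add: ce)
  qed (simp add: line_holomorphic_on_const)
  thus ?thesis
    by (rule line_holomorphic_on_cong) (simp add: L[OF finite_zeros] power_sum_eq)
qed

end

subsection \<open>Smooth points\<close>

lemma smooth_point_dim_le:
  fixes X :: "(real^'n) set"
  assumes "smooth_point X d q"
  shows "d \<le> CARD('n)"
proof -
  obtain W where "q \<in> W \<inter> X" "analytic_submanifold (W \<inter> X) W d"
    using assms by (auto simp: smooth_point_def)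
  then obtain L :: "(real^'n) set" where "dim L = d"
    unfolding analytic_submanifold_def by blast
  thus ?thesis using dim_subset_UNIV[of L] by simp
qed

text \<open>Dimensions of smooth points are at most \<open>CARD('n)\<close>, so the
  \<open>GREATEST\<close> in the definition is a true maximum. The bound on \<open>d\<close> admits
  both \<open>CARD('n) - 1\<close> and \<open>CARD('n)\<close>: neither hypersurface points nor
  interior points accumulate at \<open>p\<close>.\<close>

lemma codim_ge_2_no_smooth_points:
  fixes X :: "(real^'n) set"
  assumes "analytic_codim_at X p \<ge> 2" "CARD('n) \<le> d + 1"
  shows "p \<notin> closure {q. smooth_point X d q}"
proof
  assume p: "p \<in> closure {q. smooth_point X d q}"
  have "d \<le> analytic_dim_at X p"
    unfolding analytic_dim_at_def
  proof (rule Greatest_le_nat[where b = "CARD('n)"])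
    fix d' assume "p \<in> closure {q. smooth_point X d' q}"
    hence "{q. smooth_point X d' q} \<noteq> {}" by (metis closure_empty empty_iff)
    thus "d' \<le> CARD('n)" using smooth_point_dim_le by blast
  qed (fact p)
  thus False using assms by (simp add: analytic_codim_at_def)
qed

lemma real_analytic_on_subset: "real_analytic_on g A \<Longrightarrow> B \<subseteq> A \<Longrightarrow> real_analytic_on g B"
  unfolding real_analytic_on_def by blast

text \<open>The identity is the chart and the whole space the model subspace. Together with the
  codimension hypothesis this prevents \<open>f\<close> from vanishing on a neighbourhood of
  \<open>p\<close>.\<close>

lemma interior_zero_smooth_point:
  fixes f :: "real^'n \<Rightarrow> real"
  assumes "open W" "p \<in> W" "W \<subseteq> V" "\<And>x. x \<in> W \<Longrightarrow> f x = 0"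
  shows "smooth_point {x\<in>V. f x = 0} CARD('n) p"
proof -
  have an: "real_analytic_map_on (\<lambda>x::real^'n. x) W"
    unfolding real_analytic_map_on_def
  proof
    fix i :: 'n
    show "real_analytic_on (\<lambda>x. x $ i) W"
      by (rule real_analytic_on_subset[OF line_holomorphic_imp_real_analytic[OF line_holomorphic_on_nth[OF open_UNIV, of i], simplified]]) simp
  qed
  have M: "W \<inter> {x\<in>V. f x = 0} = W" using assms by auto
  have "analytic_submanifold (W \<inter> {x\<in>V. f x = 0}) W CARD('n)"
    unfolding analytic_submanifold_def M
  proof (intro conjI ballI order.refl)
    fix q assume "q \<in> W"
    show "\<exists>Q (\<phi>::real^'n \<Rightarrow> real^'n) (\<psi>::real^'n \<Rightarrow> real^'n) L. open Q \<and> q \<in> Q \<and> Q \<subseteq> W \<and>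
        open (\<phi> ` Q) \<and> real_analytic_map_on \<phi> Q \<and> real_analytic_map_on \<psi> (\<phi> ` Q) \<and>
        (\<forall>x\<in>Q. \<psi> (\<phi> x) = x) \<and> subspace L \<and> dim L = CARD('n) \<and> \<phi> ` (Q \<inter> W) = \<phi> ` Q \<inter> L"
      by (rule exI[of _ W], rule exI[of _ "\<lambda>x. x"], rule exI[of _ "\<lambda>x. x"], rule exI[of _ UNIV])
         (use assms(1) an \<open>q \<in> W\<close> in auto)
  qed
  thus ?thesis unfolding smooth_point_def using assms by blast
qed

text \<open>A shear along \<open>v\<close> straightens the graph: subtracting its height, as a
  function on the hyperplane through \<open>q\<close> orthogonal to \<open>v\<close>, carries the
  zero set into the orthogonal complement of \<open>v\<close>. The inverse is the opposite shear,
  written down explicitly instead of coming from an inverse function theorem.\<close>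

lemma graph_smooth_point:
  fixes f :: "real^'n \<Rightarrow> real" and q v :: "real^'n"
  assumes v: "v \<noteq> 0" and \<theta>: "\<theta> > 0" and \<rho>: "\<rho> > 0"
    and T: "line_holomorphic_on T (ball (cvec q) \<theta>)"
    and inV: "\<And>y s. y \<in> ball q \<theta> \<Longrightarrow> \<bar>s\<bar> < \<rho> \<Longrightarrow> y + s *\<^sub>R v \<in> V"
    and zero: "\<And>y s. y \<in> ball q \<theta> \<Longrightarrow> \<bar>s\<bar> < \<rho> \<Longrightarrow> f (y + s *\<^sub>R v) = 0 \<longleftrightarrow> s = Re (T (cvec y))"
    and fq: "f q = 0"
  shows "smooth_point {x\<in>V. f x = 0} (CARD('n) - 1) q"
proof -
  \<comment> \<open>\<open>\<l>\<close> is the coordinate along \<open>v\<close>, normalized by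
    \<open>\<l> v = 1\<close>, and \<open>\<pi>\<close> is the projection along \<open>v\<close>
    onto the hyperplane through \<open>q\<close> orthogonal to \<open>v\<close>.\<close>
  define \<l> where "\<l> x = (x \<bullet> v) / (v \<bullet> v)" for x
  define \<pi> where "\<pi> x = x - \<l> (x - q) *\<^sub>R v" for x
  define g where "g y = Re (T (cvec y))" for y
  define \<phi> where "\<phi> x = x - q - g (\<pi> x) *\<^sub>R v" for x
  define \<psi> where "\<psi> y = q + y + g (\<pi> (q + y)) *\<^sub>R v" for y
  define Q where "Q = {x. \<pi> x \<in> ball q \<theta> \<and> \<bar>\<l> (x - q)\<bar> < \<rho>}"
  have vv: "v \<bullet> v \<noteq> 0" using v by simp
  have l_add: "\<l> (x + y) = \<l> x + \<l> y" and l_diff: "\<l> (x - y) = \<l> x - \<l> y"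
    and l_scale: "\<l> (s *\<^sub>R x) = s * \<l> x" and l_v: "\<l> v = 1" for x y s
    using vv by (auto simp: \<l>_def inner_add_left inner_diff_left add_divide_distrib diff_divide_distrib)
  note l_simps = l_add l_diff l_scale l_v
  have pi_shift: "\<pi> (x + s *\<^sub>R v) = \<pi> x" for x s
    by (simp add: \<pi>_def l_simps algebra_simps)
  have decomp: "x = \<pi> x + \<l> (x - q) *\<^sub>R v" for x by (simp add: \<pi>_def)
  have cont_l: "continuous_on A \<l>" for A unfolding \<l>_def by (intro continuous_intros) (use vv in auto)
  have cont_pi: "continuous_on A \<pi>" for A
    unfolding \<pi>_def by (intro continuous_intros continuous_on_compose2[OF cont_l[of UNIV]]) auto
  have cont_g: "continuous_on (ball q \<theta>) g"
    unfolding g_def by (intro continuous_intros continuous_on_compose2[OF line_holomorphic_on_continuous[OF T]]) auto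
  have "open (\<pi> -` ball q \<theta> \<inter> (\<lambda>x. \<bar>\<l> (x - q)\<bar>) -` {..<\<rho>})"
    by (intro open_Int open_vimage open_ball open_lessThan cont_pi continuous_intros continuous_on_compose2[OF cont_l[of UNIV]]) auto
  moreover have "\<pi> -` ball q \<theta> \<inter> (\<lambda>x. \<bar>\<l> (x - q)\<bar>) -` {..<\<rho>} = Q" by (auto simp: Q_def)
  ultimately have openQ: "open Q" by simp
  have \<psi>\<phi>: "\<psi> (\<phi> x) = x" for x
  proof -
    have "q + \<phi> x = x + (- g (\<pi> x)) *\<^sub>R v" by (simp add: \<phi>_def)
    hence "\<pi> (q + \<phi> x) = \<pi> x" by (simp only: pi_shift)
    thus ?thesis by (simp add: \<psi>_def \<phi>_def)
  qed
  have \<phi>\<psi>: "\<phi> (\<psi> y) = y" for y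
    by (simp add: \<psi>_def \<phi>_def pi_shift)
  define B where "B = {y. \<pi> (q + y) \<in> ball q \<theta>}"
  have img: "\<phi> ` Q = B \<inter> (\<lambda>y. \<bar>\<l> y + g (\<pi> (q + y))\<bar>) -` {..<\<rho>}"
  proof (intro equalityI subsetI)
    fix y assume "y \<in> \<phi> ` Q"
    then obtain x where x: "x \<in> Q" "y = \<phi> x" by blast
    have p: "\<pi> (q + y) = \<pi> x"
    proof -
      have "q + y = x + (- g (\<pi> x)) *\<^sub>R v" by (simp add: \<phi>_def x)
      thus ?thesis by (simp only: pi_shift)
    qed
    have "\<l> y + g (\<pi> x) = \<l> (x - q)" by (simp add: x(2) \<phi>_def l_simps)
    thus "y \<in> B \<inter> (\<lambda>y. \<bar>\<l> y + g (\<pi> (q + y))\<bar>) -` {..<\<rho>}" using x(1) p by (simp add: B_def Q_def)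
  next
    fix y assume y: "y \<in> B \<inter> (\<lambda>y. \<bar>\<l> y + g (\<pi> (q + y))\<bar>) -` {..<\<rho>}"
    have "\<pi> (\<psi> y) = \<pi> (q + y)" unfolding \<psi>_def by (rule pi_shift)
    moreover have "\<l> (\<psi> y - q) = \<l> y + g (\<pi> (q + y))" by (simp add: \<psi>_def l_simps)
    ultimately have "\<psi> y \<in> Q" using y by (simp add: B_def Q_def)
    thus "y \<in> \<phi> ` Q" using \<phi>\<psi> by (metis imageI)
  qed
  have "open ((\<lambda>y. \<pi> (q + y)) -` ball q \<theta>)"
    by (intro open_vimage open_ball continuous_on_compose2[OF cont_pi[of UNIV]] continuous_intros) auto
  hence openB: "open B" by (simp add: B_def vimage_def)
  have openimg: "open (\<phi> ` Q)"
    unfolding img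
  proof (rule continuous_open_preimage[OF _ openB open_lessThan])
    have "continuous_on B (\<lambda>y. \<pi> (q + y))"
      by (intro continuous_on_compose2[OF cont_pi[of UNIV]] continuous_intros) auto
    thus "continuous_on B (\<lambda>y. \<bar>\<l> y + g (\<pi> (q + y))\<bar>)"
      by (intro continuous_intros cont_l continuous_on_compose2[OF cont_g]) (auto simp: B_def)
  qed
  \<comment> \<open>The complexification of \<open>\<pi>\<close>, with the bilinear sum in place of
    the inner product, so that \<open>T (A z)\<close> is holomorphic in \<open>z\<close>; the real
    part of \<open>T (A (cvec x))\<close> is \<open>g (\<pi> x)\<close>.\<close>
  define A where "A z = z - ((\<Sum>j\<in>UNIV. (z $ j - cvec q $ j) * cvec v $ j) / of_real (v \<bullet> v)) *s cvec v" for z :: "complex^'n"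
  have A_real: "A (cvec x) = cvec (\<pi> x)" for x
    by (simp add: A_def \<pi>_def \<l>_def vec_eq_iff inner_vec_def)
  have A_line: "A (z + s *s w) = A z + s *s (w - ((\<Sum>j\<in>UNIV. w $ j * cvec v $ j) / of_real (v \<bullet> v)) *s cvec v)" for z s w
  proof -
    have "(\<Sum>j\<in>UNIV. ((z + s *s w) $ j - cvec q $ j) * cvec v $ j) =
       (\<Sum>j\<in>UNIV. (z $ j - cvec q $ j) * cvec v $ j) + s * (\<Sum>j\<in>UNIV. w $ j * cvec v $ j)"
      by (simp add: sum_distrib_left sum.distrib[symmetric] algebra_simps)
    thus ?thesis by (simp add: A_def vec_eq_iff add_divide_distrib algebra_simps)
  qed
  have A_cont: "continuous_on UNIV A"
    unfolding A_def by (intro continuous_intros) (use vv in auto)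
  have hT: "line_holomorphic_on (\<lambda>z. T (A z)) {z. A z \<in> ball (cvec q) \<theta>}"
    by (rule line_holomorphic_on_affine[OF T A_cont A_line])
  note open1 = line_holomorphic_on_open[OF hT]
  have an\<phi>: "real_analytic_map_on \<phi> Q"
    unfolding real_analytic_map_on_def
  proof
    fix i
    have "line_holomorphic_on (\<lambda>z. z $ i - of_real (q $ i) - T (A z) * of_real (v $ i)) {z. A z \<in> ball (cvec q) \<theta>}"
      by (intro line_holomorphic_on_diff line_holomorphic_on_mult hT line_holomorphic_on_const line_holomorphic_on_nth open1)
    from line_holomorphic_imp_real_analytic[OF this]
    have "real_analytic_on (\<lambda>x. \<phi> x $ i) {x. A (cvec x) \<in> ball (cvec q) \<theta>}"
      by (simp add: A_real \<phi>_def g_def)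
    thus "real_analytic_on (\<lambda>x. \<phi> x $ i) Q"
      by (rule real_analytic_on_subset) (auto simp: A_real Q_def)
  qed
  have hT2: "line_holomorphic_on (\<lambda>z. T (A (z + cvec q))) {z. z + cvec q \<in> {z. A z \<in> ball (cvec q) \<theta>}}"
    by (rule line_holomorphic_on_affine[OF hT, of "\<lambda>z. z + cvec q" "\<lambda>v. v"]) (auto intro!: continuous_intros simp: algebra_simps)
  note open2 = line_holomorphic_on_open[OF hT2]
  have an\<psi>: "real_analytic_map_on \<psi> (\<phi> ` Q)"
    unfolding real_analytic_map_on_def
  proof
    fix i
    have "line_holomorphic_on (\<lambda>z. of_real (q $ i) + z $ i + T (A (z + cvec q)) * of_real (v $ i)) {z. z + cvec q \<in> {z. A z \<in> ball (cvec q) \<theta>}}"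
      by (intro line_holomorphic_on_add line_holomorphic_on_mult hT2 line_holomorphic_on_const line_holomorphic_on_nth open2)
    from line_holomorphic_imp_real_analytic[OF this]
    have "real_analytic_on (\<lambda>x. \<psi> x $ i) {x. A (cvec x + cvec q) \<in> ball (cvec q) \<theta>}"
      by (simp add: A_real \<psi>_def g_def add.commute flip: cvec_add)
    thus "real_analytic_on (\<lambda>x. \<psi> x $ i) (\<phi> ` Q)"
      by (rule real_analytic_on_subset) (auto simp: A_real img B_def add.commute simp flip: cvec_add)
  qed
  define Z where "Z = {x\<in>V. f x = 0}"
  have Zg: "x \<in> Z \<longleftrightarrow> \<l> (x - q) = g (\<pi> x)" if "x \<in> Q" for x
    using zero[of "\<pi> x" "\<l> (x - q)"] inV[of "\<pi> x" "\<l> (x - q)"] that decomp[of x]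
    by (simp add: Q_def Z_def g_def)
  define L where "L = {x. v \<bullet> x = 0}"
  have "\<phi> x \<in> L \<longleftrightarrow> \<l> (x - q) = g (\<pi> x)" for x
  proof -
    have "\<phi> x \<in> L \<longleftrightarrow> \<l> (\<phi> x) = 0" using vv by (simp add: L_def \<l>_def inner_commute)
    also have "\<l> (\<phi> x) = \<l> (x - q) - g (\<pi> x)" by (simp add: \<phi>_def l_simps)
    finally show ?thesis by simp
  qed
  hence imgZ: "\<phi> ` (Q \<inter> (Q \<inter> Z)) = \<phi> ` Q \<inter> L" using Zg by auto
  have L: "subspace L" "dim L = CARD('n) - 1"
    using subspace_hyperplane[of v] dim_hyperplane[OF v] by (simp_all add: L_def)
  have "q \<in> Q" using \<theta> \<rho> by (simp add: Q_def \<pi>_def \<l>_def)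
  have QV: "q \<in> V" using inV[of q 0] \<theta> \<rho> by simp
  have "analytic_submanifold (Q \<inter> Z) Q (CARD('n) - 1)"
    unfolding analytic_submanifold_def
  proof (intro conjI ballI)
    fix q' assume "q' \<in> Q \<inter> Z"
    show "\<exists>Q' (\<phi>::real^'n \<Rightarrow> real^'n) (\<psi>::real^'n \<Rightarrow> real^'n) L. open Q' \<and> q' \<in> Q' \<and> Q' \<subseteq> Q \<and>
        open (\<phi> ` Q') \<and> real_analytic_map_on \<phi> Q' \<and> real_analytic_map_on \<psi> (\<phi> ` Q') \<and>
        (\<forall>x\<in>Q'. \<psi> (\<phi> x) = x) \<and> subspace L \<and> dim L = CARD('n) - 1 \<and> \<phi> ` (Q' \<inter> (Q \<inter> Z)) = \<phi> ` Q' \<inter> L"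
      by (rule exI[of _ Q], rule exI[of _ \<phi>], rule exI[of _ \<psi>], rule exI[of _ L])
         (use openQ openimg an\<phi> an\<psi> \<psi>\<phi> L imgZ \<open>q' \<in> Q \<inter> Z\<close> in blast)
  qed auto
  thus ?thesis unfolding smooth_point_def Z_def using openQ \<open>q \<in> Q\<close> QV fq by blast
qed

subsection \<open>Real zeros at points of nonzero discriminant\<close>

text \<open>The complex line through \<open>p\<close> in the direction \<open>x1 - p\<close> reaches
  \<open>x1\<close> at \<open>s = 1\<close>. Its part inside the ball is convex, so the identity
  theorem would carry a zero germ at \<open>p\<close> to \<open>x1\<close>.\<close>

lemma line_not_locally_zero:
  fixes G :: "complex^'n \<Rightarrow> complex"
  assumes G: "line_holomorphic_on G (ball (cvec p) \<eta>)" and x1: "x1 \<in> ball p \<eta>" "G (cvec x1) \<noteq> 0"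
  shows "\<not> (\<forall>\<^sub>F s in nhds 0. G (cvec p + s *s cvec (x1 - p)) = 0)"
proof
  assume ev: "\<forall>\<^sub>F s in nhds 0. G (cvec p + s *s cvec (x1 - p)) = 0"
  define w where "w = cvec (x1 - p)"
  define A where "A = {s. cvec p + s *s w \<in> ball (cvec p) \<eta>}"
  have A: "A = {s. cmod s * norm w < \<eta>}"
    by (auto simp: A_def dist_norm norm_vector_smult)
  have \<eta>: "\<eta> > 0" using x1(1) by (meson dist_le_zero_iff le_less_trans mem_ball not_less zero_le_dist)
  have "convex A"
  proof (cases "norm w = 0")
    case True
    thus ?thesis using \<eta> by (simp add: A)
  next
    case False
    hence "A = ball 0 (\<eta> / norm w)" by (auto simp: A field_simps)
    thus ?thesis by simp
  qed
  have hol: "(\<lambda>s. G (cvec p + s *s w)) holomorphic_on A"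
    unfolding A_def by (rule line_holomorphic_on_line[OF G])
  have opA: "open A" unfolding A_def by (rule open_line_preimage) simp
  have "0 \<in> A" using \<eta> by (simp add: A)
  have "1 \<in> A" using x1(1) by (simp add: A w_def dist_norm norm_minus_commute)
  obtain N where N: "open N" "0 \<in> N" "\<And>s. s \<in> N \<Longrightarrow> G (cvec p + s *s w) = 0"
    using ev unfolding eventually_nhds w_def by blast
  have "G (cvec p + 1 *s w) = 0"
    by (rule analytic_continuation_open[of "N \<inter> A" A "\<lambda>s. G (cvec p + s *s w)" "\<lambda>_. 0"])
       (use N opA \<open>convex A\<close> \<open>0 \<in> A\<close> \<open>1 \<in> A\<close> hol in \<open>auto simp: convex_connected\<close>)
  moreover have "cvec p + 1 *s w = cvec x1" by (simp add: w_def vec_eq_iff)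
  ultimately show False using x1(2) by simp
qed

text \<open>\<open>S 0\<close> counts zeros with multiplicity: it is at least 1 at \<open>P\<close>,
  and it is continuous.\<close>

lemma (in controlled_zeros) power_sum_0_nonzero:
  assumes "G P = 0"
  shows "\<exists>d>0. \<forall>z. dist P z < d \<longrightarrow> S 0 z \<noteq> 0"
proof -
  have PP: "P \<in> ball P \<eta>" using \<eta>_pos by simp
  have 0: "0 \<in> Zs P" using assms \<sigma>_pos by (simp add: line_zeros_def)
  have "m P 0 \<le> (\<Sum>r\<in>Zs P. m P r)"
    using finite_zeros[OF PP] 0 by (intro member_le_sum) auto
  hence "(\<Sum>r\<in>Zs P. m P r) \<noteq> 0" using mult_pos[OF PP 0] by linarith
  hence "S 0 P \<noteq> 0" using power_sum_eq[OF PP, of 0] by (simp flip: of_nat_sum)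
  moreover have "isCont (S 0) P"
    using line_holomorphic_on_continuous[OF power_sum_holomorphic] PP by (simp add: continuous_on_eq_continuous_at)
  ultimately show ?thesis using continuous_at_avoid by blast
qed

text \<open>A form of Hurwitz's theorem: the zero count at a small scale remains nonzero for base
  points near \<open>P\<close>.\<close>

lemma zeros_persist:
  fixes G :: "complex^'n \<Rightarrow> complex"
  assumes G: "line_holomorphic_on G \<Omega>" and P: "P \<in> \<Omega>" "G P = 0"
    and nz: "\<not> (\<forall>\<^sub>F s in nhds 0. G (P + s *s v) = 0)" and e: "e > 0"
  shows "\<exists>\<theta>>0. \<forall>z\<in>ball P \<theta>. \<exists>s. cmod s < e \<and> G (z + s *s v) = 0"
proof -
  obtain \<sigma> \<eta> C m S where *: "controlled_zeros G \<Omega> v P \<sigma> \<eta> C m S" "\<sigma> < e / 4"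
    using controlled_zeros_exist[OF G P(1) nz, of "e/4"] e by auto
  then interpret Z: controlled_zeros G \<Omega> v P \<sigma> \<eta> C m S by simp
  obtain d where d: "d > 0" "\<And>z. dist P z < d \<Longrightarrow> S 0 z \<noteq> 0"
    using Z.power_sum_0_nonzero[OF P(2)] by blast
  show ?thesis
  proof (intro exI[of _ "min d \<eta>"] conjI ballI)
    fix z assume z: "z \<in> ball P (min d \<eta>)"
    have "line_zeros G v (4 * \<sigma>) z \<noteq> {}"
    proof
      assume "line_zeros G v (4 * \<sigma>) z = {}"
      hence "S 0 z = 0" using Z.power_sum_eq[of z 0] z by simp
      thus False using d(2)[of z] z by simp
    qed
    thus "\<exists>s. cmod s < e \<and> G (z + s *s v) = 0" using *(2) by (force simp: line_zeros_def)
  qed (use d Z.\<eta>_pos in auto)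
qed

lemma finite_separated:
  assumes "finite (R :: complex set)"
  shows "\<exists>d>0. \<forall>r\<in>R. \<forall>r'\<in>R. r \<noteq> r' \<longrightarrow> d \<le> cmod (r - r')"
proof -
  \<comment> \<open>The 1 keeps \<open>E\<close> nonempty when \<open>R\<close> has at most one
    element.\<close>
  define E where "E = insert 1 ((\<lambda>(r, r'). cmod (r - r')) ` {(r, r'). r \<in> R \<and> r' \<in> R \<and> r \<noteq> r'})"
  have "finite {(r, r'). r \<in> R \<and> r' \<in> R \<and> r \<noteq> r'}"
    by (rule finite_subset[of _ "R \<times> R"]) (use assms in auto)
  hence E: "finite E" "E \<noteq> {}" by (auto simp: E_def)
  have "Min E > 0" using Min_in[OF E] by (auto simp: E_def)
  moreover have "Min E \<le> cmod (r - r')" if "r \<in> R" "r' \<in> R" "r \<noteq> r'" for r r'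
    using E(1) by (rule Min_le) (use that in \<open>force simp: E_def\<close>)
  ultimately show ?thesis by blast
qed

text \<open>Vanishing near one zero would put a whole disc into the finite set \<open>Zs z\<close>.
  Hence every zero may serve as a new centre for the local theory.\<close>

lemma (in controlled_zeros) not_locally_zero_at_zero:
  assumes z: "z \<in> ball P \<eta>" and r: "r \<in> Zs z"
  shows "\<not> (\<forall>\<^sub>F s in nhds 0. G (z + r *s v + s *s v) = 0)"
proof
  assume "\<forall>\<^sub>F s in nhds 0. G (z + r *s v + s *s v) = 0"
  then obtain d where d: "d > 0" "\<And>s. dist s 0 < d \<Longrightarrow> G (z + r *s v + s *s v) = 0"
    unfolding eventually_nhds_metric by blast
  have "ball r (min d (2 * \<sigma>)) \<subseteq> Zs z"
  proof
    fix u assume u: "u \<in> ball r (min d (2 * \<sigma>))"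
    have "z + r *s v + (u - r) *s v = z + u *s v" by (simp add: vec_eq_iff algebra_simps)
    hence "G (z + u *s v) = 0" using d(2)[of "u - r"] u by (simp add: dist_norm norm_minus_commute)
    moreover have "cmod u < 4 * \<sigma>"
      using norm_triangle_ineq[of r "u - r"] zeros_small[OF z r] u by (simp add: dist_norm norm_minus_commute)
    ultimately show "u \<in> Zs z" by (simp add: line_zeros_def)
  qed
  hence "finite (ball r (min d (2 * \<sigma>)))" using finite_zeros[OF z] finite_subset by blast
  thus False using uncountable_ball[of "min d (2 * \<sigma>)" r] d(1) \<sigma>_pos countable_finite by auto
qed

text \<open>Near a base point with the maximal number of distinct zeros every small disc around a zero
contains exactly one zero, which is therefore the quotient of the local power sums of order one and zero.\<close>

lemma real_zero_is_graph:
  fixes F :: "complex^'n \<Rightarrow> complex" and p v x0 :: "real^'n"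
  assumes F: "line_holomorphic_on F \<Omega>"
    and cz: "controlled_zeros F \<Omega> (cvec v) (cvec p) \<sigma> \<eta> C m S"
    and conj: "\<And>z. z \<in> \<Omega> \<Longrightarrow> F (\<chi> i. cnj (z $ i)) = cnj (F z)"
    and max: "\<And>x. x \<in> ball p \<eta> \<Longrightarrow> card (line_zeros F (cvec v) (4 * \<sigma>) (cvec x)) \<le> k"
    and x0: "x0 \<in> ball p \<eta>" "card (line_zeros F (cvec v) (4 * \<sigma>) (cvec x0)) = k"
    and t: "complex_of_real t \<in> line_zeros F (cvec v) (4 * \<sigma>) (cvec x0)"
  shows "\<exists>\<theta>>0. \<exists>\<rho>>0. \<exists>T. line_holomorphic_on T (ball (cvec (x0 + t *\<^sub>R v)) \<theta>) \<and>
    (\<forall>y\<in>ball (x0 + t *\<^sub>R v) \<theta>. \<forall>s. \<bar>s\<bar> < \<rho> \<longrightarrow> cvec (y + s *\<^sub>R v) \<in> \<Omega> \<and>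
       (F (cvec (y + s *\<^sub>R v)) = 0 \<longleftrightarrow> s = Re (T (cvec y))))"
proof -
  interpret Z: controlled_zeros F \<Omega> "cvec v" "cvec p" \<sigma> \<eta> C m S by (fact cz)
  define R0 where "R0 = line_zeros F (cvec v) (4 * \<sigma>) (cvec x0)"
  define q where "q = x0 + t *\<^sub>R v"
  have xP: "cvec x0 \<in> ball (cvec p) \<eta>" using x0 by simp
  have fin: "finite R0" unfolding R0_def by (rule Z.finite_zeros[OF xP])
  obtain d where d: "d > 0" "\<And>r r'. r \<in> R0 \<Longrightarrow> r' \<in> R0 \<Longrightarrow> r \<noteq> r' \<Longrightarrow> d \<le> cmod (r - r')"
    using finite_separated[OF fin] by blast
  \<comment> \<open>Zeros inside \<open>2 * \<sigma>\<close> that move by less than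
    \<open>4 * e\<close> stay inside \<open>4 * \<sigma>\<close>, and zeros at mutual distance at
    least \<open>d \<ge> 8 * e\<close> stay distinct.\<close>
  define e where "e = min (\<sigma>/2) (d/8)"
  have e: "e > 0" "4 * e \<le> 2 * \<sigma>" "8 * e \<le> d" using d Z.\<sigma>_pos by (auto simp: e_def)
  have small: "cmod r < 2 * \<sigma>" if "r \<in> R0" for r using Z.zeros_small[OF xP] that by (simp add: R0_def)
  have "\<exists>\<theta>>0. \<forall>z\<in>ball (cvec x0 + r *s cvec v) \<theta>. \<exists>s. cmod s < 4 * e \<and> F (z + s *s cvec v) = 0" if r: "r \<in> R0" for r
  proof (rule zeros_persist[OF F])
    show "cvec x0 + r *s cvec v \<in> \<Omega>" using Z.in_domain[OF xP, of r] small[OF r] Z.\<sigma>_pos by simp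
    show "F (cvec x0 + r *s cvec v) = 0" using r by (simp add: R0_def line_zeros_def)
    show "\<not> (\<forall>\<^sub>F s in nhds 0. F (cvec x0 + r *s cvec v + s *s cvec v) = 0)"
      using Z.not_locally_zero_at_zero[OF xP] r by (simp add: R0_def)
  qed (use e in simp)
  then obtain \<Theta> where \<Theta>: "\<And>r. r \<in> R0 \<Longrightarrow> \<Theta> r > 0"
    "\<And>r z. r \<in> R0 \<Longrightarrow> z \<in> ball (cvec x0 + r *s cvec v) (\<Theta> r) \<Longrightarrow> \<exists>s. cmod s < 4 * e \<and> F (z + s *s cvec v) = 0"
    by metis
  have tR: "of_real t \<in> R0" using t by (simp add: R0_def)
  have qeq: "cvec q = cvec x0 + of_real t *s cvec v" by (simp add: q_def cvec_add cvec_scaleR)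
  have q\<Omega>: "cvec q \<in> \<Omega>" unfolding qeq using Z.in_domain[OF xP, of "of_real t"] small[OF tR] Z.\<sigma>_pos by simp
  have nzq: "\<not> (\<forall>\<^sub>F s in nhds 0. F (cvec q + s *s cvec v) = 0)"
    unfolding qeq using Z.not_locally_zero_at_zero[OF xP] t by simp
  \<comment> \<open>A second control, centred at the zero \<open>q\<close> itself. Its disc of
    radius \<open>4 * \<sigma>1 < 4 * e\<close> is so small that only the displaced copy of the zero
    \<open>t\<close> can lie in it.\<close>
  obtain \<sigma>1 \<eta>1 C1 m1 S1 where *: "controlled_zeros F \<Omega> (cvec v) (cvec q) \<sigma>1 \<eta>1 C1 m1 S1" "\<sigma>1 < e"
    using controlled_zeros_exist[OF F q\<Omega> nzq e(1)] by blast
  then interpret Q: controlled_zeros F \<Omega> "cvec v" "cvec q" \<sigma>1 \<eta>1 C1 m1 S1 by simp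
  have "F (cvec q) = 0" using tR by (simp add: line_zeros_def R0_def qeq)
  then obtain d1 where d1: "d1 > 0" "\<And>z. dist (cvec q) z < d1 \<Longrightarrow> S1 0 z \<noteq> 0"
    using Q.power_sum_0_nonzero by blast
  \<comment> \<open>Close enough that \<open>S1 0\<close> is nonzero (\<open>d1\<close>), the
    control at \<open>q\<close> applies (\<open>\<eta>1\<close>), the base point stays in
    \<open>ball p \<eta>\<close>, where \<open>k\<close> is maximal, and every zero over
    \<open>x0\<close> persists (\<open>\<Theta>\<close>).\<close>
  define \<theta> where "\<theta> = Min ({d1, \<eta>1, \<eta> - dist p x0} \<union> \<Theta> ` R0)"
  have fin\<theta>: "finite ({d1, \<eta>1, \<eta> - dist p x0} \<union> \<Theta> ` R0)" using fin by simp
  have \<theta>: "\<theta> > 0"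
    unfolding \<theta>_def using fin\<theta> d1 Q.\<eta>_pos x0 \<Theta>(1) by (subst Min_gr_iff) auto
  have \<theta>_le: "\<theta> \<le> d1" "\<theta> \<le> \<eta>1" "\<theta> \<le> \<eta> - dist p x0" "\<And>r. r \<in> R0 \<Longrightarrow> \<theta> \<le> \<Theta> r"
    unfolding \<theta>_def by (rule Min_le[OF fin\<theta>]; simp)+
  define T where "T z = S1 1 z / S1 0 z" for z
  have Thol: "line_holomorphic_on T (ball (cvec q) \<theta>)"
    unfolding T_def
    by (intro line_holomorphic_on_divide line_holomorphic_on_subset[OF Q.power_sum_holomorphic])
       (use \<theta>_le d1 in auto)
  have uniq: "line_zeros F (cvec v) (4 * \<sigma>1) (cvec y) = {T (cvec y)} \<and> Im (T (cvec y)) = 0" if y: "y \<in> ball q \<theta>" for y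
  proof -
    define x where "x = y - t *\<^sub>R v"
    have xd: "dist x0 x < \<theta>" using y by (simp add: x_def q_def dist_norm algebra_simps)
    have xball: "x \<in> ball p \<eta>" using dist_triangle[of p x x0] xd \<theta>_le(3) by simp
    have yeq: "cvec y = cvec x + of_real t *s cvec v" by (simp add: x_def cvec_diff cvec_scaleR)
    have yP: "cvec y \<in> ball (cvec q) \<eta>1" using y \<theta>_le by simp
    define Rx where "Rx = line_zeros F (cvec v) (4 * \<sigma>) (cvec x)"
    have "\<exists>u. cmod (u - r) < 4 * e \<and> u \<in> Rx" if r: "r \<in> R0" for r
    proof -
      have "cvec x + r *s cvec v \<in> ball (cvec x0 + r *s cvec v) (\<Theta> r)"
        using xd \<theta>_le(4)[OF r] by simp
      from \<Theta>(2)[OF r this] obtain s where s: "cmod s < 4 * e" "F (cvec x + r *s cvec v + s *s cvec v) = 0" by blast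
      have "cvec x + r *s cvec v + s *s cvec v = cvec x + (r + s) *s cvec v" by (simp add: vec_eq_iff algebra_simps)
      moreover have "cmod (r + s) < 4 * \<sigma>" using norm_triangle_ineq[of r s] small[OF r] s(1) e(2) by simp
      ultimately have "r + s \<in> Rx" using s(2) by (simp only: Rx_def line_zeros_def mem_Collect_eq)
      thus ?thesis using s(1) by (intro exI[of _ "r + s"]) simp
    qed
    then obtain h where h: "\<And>r. r \<in> R0 \<Longrightarrow> cmod (h r - r) < 4 * e" "\<And>r. r \<in> R0 \<Longrightarrow> h r \<in> Rx" by metis
    have "inj_on h R0"
    proof (rule inj_onI, rule ccontr)
      fix r r' assume rr: "r \<in> R0" "r' \<in> R0" "h r = h r'" "r \<noteq> r'"
      have "cmod (r - r') \<le> cmod (h r' - r') + cmod (h r - r)"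
        using norm_triangle_ineq4[of "h r' - r'" "h r - r"] rr(3) by simp
      thus False using d(2)[OF rr(1,2,4)] h(1)[OF rr(1)] h(1)[OF rr(2)] e(3) by linarith
    qed
    have finRx: "finite Rx" unfolding Rx_def by (rule Z.finite_zeros) (use xball in simp)
    \<comment> \<open>Here maximality enters: the displaced zeros already number \<open>k\<close>,
      so there are no others over \<open>x\<close>.\<close>
    have "card Rx \<le> card (h ` R0)"
      using max[OF xball] x0(2) card_image[OF \<open>inj_on h R0\<close>] by (simp add: Rx_def R0_def)
    hence Rx: "h ` R0 = Rx" using h(2) finRx by (intro card_seteq) auto
    let ?Y = "line_zeros F (cvec v) (4 * \<sigma>1) (cvec y)"
    have only: "s = h (of_real t) - of_real t" if s: "s \<in> ?Y" for s
    proof -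
      have s': "cmod s < 4 * \<sigma>1" "F (cvec y + s *s cvec v) = 0" using s by (auto simp: line_zeros_def)
      have "cvec y + s *s cvec v = cvec x + (of_real t + s) *s cvec v" by (simp add: yeq vec_eq_iff algebra_simps)
      moreover have "cmod (of_real t + s) < 4 * \<sigma>"
        using norm_triangle_ineq[of "of_real t" s] small[OF tR] s'(1) *(2) e(2) by simp
      ultimately have "of_real t + s \<in> Rx" using s'(2) by (simp only: Rx_def line_zeros_def mem_Collect_eq)
      then obtain r where r: "r \<in> R0" "of_real t + s = h r" using Rx by auto
      have "r = of_real t"
      proof (rule ccontr)
        assume "r \<noteq> of_real t"
        from d(2)[OF r(1) tR this] have "d \<le> cmod (r - of_real t)" .
        also have "r - of_real t = s - (h r - r)" using r(2) by (simp add: algebra_simps)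
        also have "cmod \<dots> \<le> cmod s + cmod (h r - r)" by (rule norm_triangle_ineq4)
        finally show False using s'(1) h(1)[OF r(1)] *(2) e(3) by simp
      qed
      thus ?thesis using r(2) by (metis add_diff_cancel_left')
    qed
    have S0: "S1 0 (cvec y) \<noteq> 0" using d1(2)[of "cvec y"] y \<theta>_le(1) by simp
    have "?Y \<noteq> {}" using S0 Q.power_sum_eq[OF yP, of 0] by auto
    then obtain s where s: "s \<in> ?Y" by blast
    have Y: "?Y = {s}" using only s by auto
    have "S1 0 (cvec y) = of_nat (m1 (cvec y) s)" "S1 1 (cvec y) = of_nat (m1 (cvec y) s) * s"
      using Q.power_sum_eq[OF yP, of 0] Q.power_sum_eq[OF yP, of 1] Y by auto
    hence Ts: "T (cvec y) = s" using S0 by (simp add: T_def)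
    \<comment> \<open>Conjugation permutes the zeros over a real base point; the only zero in the
      disc must be its own conjugate.\<close>
    have "cvec y + s *s cvec v \<in> \<Omega>" using Q.in_domain[OF yP, of s] s by (simp add: line_zeros_def)
    from conj[OF this] have "F (\<chi> i. cnj ((cvec y + s *s cvec v) $ i)) = 0" using s by (simp add: line_zeros_def)
    moreover have "(\<chi> i. cnj ((cvec y + s *s cvec v) $ i)) = cvec y + cnj s *s cvec v" by (simp add: vec_eq_iff)
    ultimately have "cnj s \<in> ?Y" using s by (simp add: line_zeros_def)
    hence "cnj s = s" using Y by auto
    hence "Im s = 0" by (simp add: complex_eq_iff)
    thus ?thesis using Y Ts by simp
  qed
  have "cvec (y + s *\<^sub>R v) \<in> \<Omega> \<and> (F (cvec (y + s *\<^sub>R v)) = 0 \<longleftrightarrow> s = Re (T (cvec y)))"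
    if y: "y \<in> ball q \<theta>" and s: "\<bar>s\<bar> < 4 * \<sigma>1" for y s
  proof -
    have eq: "cvec (y + s *\<^sub>R v) = cvec y + of_real s *s cvec v" by (simp add: cvec_add cvec_scaleR)
    have yP: "cvec y \<in> ball (cvec q) \<eta>1" using y \<theta>_le by simp
    have "F (cvec (y + s *\<^sub>R v)) = 0 \<longleftrightarrow> of_real s \<in> line_zeros F (cvec v) (4 * \<sigma>1) (cvec y)"
      using s by (simp add: line_zeros_def eq)
    also have "\<dots> \<longleftrightarrow> of_real s = T (cvec y)" using uniq[OF y] by auto
    also have "\<dots> \<longleftrightarrow> s = Re (T (cvec y))" using uniq[OF y] by (auto simp: complex_eq_iff)
    finally show ?thesis using Q.in_domain[OF yP, of "of_real s"] s by (simp add: eq)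
  qed
  thus ?thesis unfolding q_def[symmetric] using Thol \<theta> Q.\<sigma>_pos
    by (intro exI[of _ \<theta>] exI[of _ "4 * \<sigma>1"] exI[of _ T] conjI) auto
qed

subsection \<open>Integrability of the logarithmic derivative\<close>

text \<open>The hypothesis \<open>ns\<close> rules out real zeros over base points of nonzero
  discriminant. The loss in the resulting estimate is a power of the discriminant at the base point
  \<open>x\<close>, not at the moving point \<open>x + s *\<^sub>R v\<close>, so it comes out of the
  line integral as a constant.\<close>

lemma log_derivative_integrable:
  fixes f :: "real^'n \<Rightarrow> real" and F :: "complex^'n \<Rightarrow> complex" and p v :: "real^'n"
  assumes \<epsilon>: "\<epsilon> > 0" "ball p \<epsilon> \<subseteq> V" and v: "v \<noteq> 0"
    and F: "line_holomorphic_on F (ball (cvec p) \<epsilon>)"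
    and Fr: "\<And>x. x \<in> ball p \<epsilon> \<Longrightarrow> F (cvec x) = of_real (f x)"
    and Fc: "\<And>z. z \<in> ball (cvec p) \<epsilon> \<Longrightarrow> F (\<chi> i. cnj (z $ i)) = cnj (F z)"
    and nz: "\<not> (\<forall>\<^sub>F s in nhds 0. F (cvec p + s *s cvec v) = 0)"
    and ns: "\<And>q. q \<in> ball p \<epsilon> \<Longrightarrow> \<not> smooth_point {x\<in>V. f x = 0} (CARD('n) - 1) q"
  shows "\<exists>\<eta>>0. (\<integral>\<^sup>+x. ennreal (cmod (line_deriv (cvec v) F (cvec x) / F (cvec x))) * indicator (ball p \<eta>) x \<partial>lborel) < \<infinity>"
proof -
  obtain \<sigma> \<eta> C m S where cz: "controlled_zeros F (ball (cvec p) \<epsilon>) (cvec v) (cvec p) \<sigma> \<eta> C m S"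
    using controlled_zeros_exist[OF F _ nz, of 1] \<epsilon>(1) by auto
  then interpret Z: controlled_zeros F "ball (cvec p) \<epsilon>" "cvec v" "cvec p" \<sigma> \<eta> C m S .
  define R where "R x = line_zeros F (cvec v) (4 * \<sigma>) (cvec x)" for x
  have cin: "cvec x \<in> ball (cvec p) \<eta>" if "x \<in> ball p \<eta>" for x using that by simp
  have p\<eta>: "p \<in> ball p \<eta>" using Z.\<eta>_pos by simp
  let ?N = "(\<lambda>x. card (R x)) ` ball p \<eta>"
  have finN: "finite ?N"
  proof (rule finite_subset)
    have "card (R x) \<le> nat \<lfloor>C\<rfloor>" if "x \<in> ball p \<eta>" for x
      using Z.card_zeros_le[OF cin[OF that]] unfolding R_def by linarith
    thus "?N \<subseteq> {..nat \<lfloor>C\<rfloor>}" by auto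
  qed simp
  \<comment> \<open>A maximum over real base points suffices: the graph argument is applied only
    there, and \<open>D\<close> has to be nonzero at just one of them, \<open>x1\<close>.\<close>
  define k where "k = Max ?N"
  have max: "card (R x) \<le> k" if "x \<in> ball p \<eta>" for x
    unfolding k_def using finN that by (intro Max_ge) auto
  have "k \<in> ?N" unfolding k_def using finN p\<eta> by (intro Max_in) auto
  then obtain x1 where x1: "x1 \<in> ball p \<eta>" "card (R x1) = k" by auto
  define D where "D z = discriminant k (line_zeros F (cvec v) (4 * \<sigma>) z) (m z)" for z
  have Dhol: "line_holomorphic_on D (ball (cvec p) \<eta>)"
    unfolding D_def by (rule Z.discriminant_holomorphic)
  have "D (cvec x1) \<noteq> 0"
    unfolding D_def using x1 Z.finite_zeros[OF cin[OF x1(1)]] Z.mult_pos[OF cin[OF x1(1)]]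
    by (intro discriminant_nonzero) (auto simp: R_def)
  hence "\<not> (\<forall>\<^sub>F s in nhds 0. D (cvec p + s *s cvec (x1 - p)) = 0)"
    by (rule line_not_locally_zero[OF Dhol x1(1)])
  from negative_power_integrable[OF Dhol _ this] p\<eta> obtain \<eta>2 \<tau> where \<eta>2: "\<eta>2 > 0" and \<tau>: "\<tau> > 0" "\<tau> \<le> 1/2"
    and D_AE: "AE x in lborel. x \<in> ball p \<eta>2 \<longrightarrow> D (cvec x) \<noteq> 0"
    and D_int: "(\<integral>\<^sup>+x. ennreal (cmod (D (cvec x)) powr (-\<tau>)) * indicator (ball p \<eta>2) x \<partial>lborel) < \<infinity>"
    by auto
  define \<eta>3 where "\<eta>3 = min \<eta> \<eta>2"
  have \<eta>3: "\<eta>3 > 0" "\<eta>3 \<le> \<eta>" "\<eta>3 \<le> \<eta>2" using \<eta>2 Z.\<eta>_pos by (auto simp: \<eta>3_def)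
  \<comment> \<open>\<open>C ^ k\<close> bounds the weights in the gap estimate for the
    discriminant, and the 2 comes from
    \<open>cmod (r - cnj r) = 2 * \<bar>Im r\<bar>\<close>.\<close>
  define A where "A = 2 * C ^ k"
  have A: "A > 0" using Z.C_pos by (simp add: A_def)
  have nonreal: "Im r \<noteq> 0 \<and> cmod (D (cvec x)) \<le> A * \<bar>Im r\<bar>"
    if x: "x \<in> ball p \<eta>" and Dx: "D (cvec x) \<noteq> 0" and r: "r \<in> R x" for x r
  proof -
    have fin: "finite (R x)" unfolding R_def by (rule Z.finite_zeros[OF cin[OF x]])
    have "\<not> card (R x) < k"
      using discriminant_eq_0[OF fin] Dx unfolding D_def R_def by blast
    \<comment> \<open>Nonzero discriminant and maximality together give exactly \<open>k\<close>
      zeros over \<open>x\<close>, as the graph lemma requires.\<close>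
    hence card: "card (R x) = k" using max[OF x] by simp
    have Im: "Im r \<noteq> 0"
    proof
      assume "Im r = 0"
      hence "r = of_real (Re r)" by (simp add: complex_eq_iff)
      define t where "t = Re r"
      have t: "of_real t \<in> line_zeros F (cvec v) (4 * \<sigma>) (cvec x)"
        using r \<open>r = of_real (Re r)\<close> by (simp add: t_def R_def)
      define q where "q = x + t *\<^sub>R v"
      obtain \<theta> \<rho> T where T: "\<theta> > 0" "\<rho> > 0" "line_holomorphic_on T (ball (cvec q) \<theta>)"
        "\<And>y s. y \<in> ball q \<theta> \<Longrightarrow> \<bar>s\<bar> < \<rho> \<Longrightarrow> cvec (y + s *\<^sub>R v) \<in> ball (cvec p) \<epsilon>"
        "\<And>y s. y \<in> ball q \<theta> \<Longrightarrow> \<bar>s\<bar> < \<rho> \<Longrightarrow> F (cvec (y + s *\<^sub>R v)) = 0 \<longleftrightarrow> s = Re (T (cvec y))"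
        using real_zero_is_graph[OF F cz Fc max[unfolded R_def] x card[unfolded R_def] t] unfolding q_def by blast
      have qe: "cvec q = cvec x + of_real t *s cvec v" by (simp add: q_def cvec_add cvec_scaleR)
      have "cvec q \<in> ball (cvec p) \<epsilon>"
        unfolding qe using Z.in_domain[OF cin[OF x], of "of_real t"] t by (simp only: line_zeros_def mem_Collect_eq)
      hence qb: "q \<in> ball p \<epsilon>" by simp
      have "F (cvec q) = 0" using t by (simp add: line_zeros_def qe)
      hence fq: "f q = 0" using Fr[OF qb] by simp
      have "smooth_point {x\<in>V. f x = 0} (CARD('n) - 1) q"
      proof (rule graph_smooth_point[OF v T(1-3)])
        fix y s assume ys: "y \<in> ball q \<theta>" "\<bar>s\<bar> < \<rho>"
        have b: "y + s *\<^sub>R v \<in> ball p \<epsilon>" using T(4)[OF ys] by simp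
        thus "y + s *\<^sub>R v \<in> V" using \<epsilon>(2) by blast
        show "f (y + s *\<^sub>R v) = 0 \<longleftrightarrow> s = Re (T (cvec y))"
          using T(5)[OF ys] Fr[OF b] by simp
      qed (fact fq)
      thus False using ns[OF qb] by blast
    qed
    have r': "cmod r < 4 * \<sigma>" "F (cvec x + r *s cvec v) = 0" using r by (auto simp: R_def line_zeros_def)
    have "(\<chi> i. cnj ((cvec x + r *s cvec v) $ i)) = cvec x + cnj r *s cvec v" by (simp add: vec_eq_iff)
    hence "F (cvec x + cnj r *s cvec v) = 0"
      using Fc[OF Z.in_domain[OF cin[OF x] r'(1)]] r'(2) by simp
    hence cr: "cnj r \<in> R x" using r'(1) by (simp add: R_def line_zeros_def)
    have diam: "cmod (u - u') \<le> 1" if "u \<in> R x" "u' \<in> R x" for u u'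
      using norm_triangle_ineq4[of u u'] Z.zeros_small[OF cin[OF x], of u] Z.zeros_small[OF cin[OF x], of u'] that Z.\<sigma>_le
      by (auto simp: R_def)
    have "cmod (D (cvec x)) \<le> real (\<Sum>r\<in>R x. m (cvec x) r) ^ k * cmod (r - cnj r)"
      unfolding D_def R_def[symmetric] using Im
      by (intro discriminant_le_gap fin card diam r cr) (auto simp: complex_eq_iff)
    also have "\<dots> \<le> C ^ k * cmod (r - cnj r)"
      using Z.mult_sum_le[OF cin[OF x]] unfolding R_def[symmetric] by (intro mult_right_mono power_mono) (auto simp: sum_nonneg)
    also have "cmod (r - cnj r) = 2 * \<bar>Im r\<bar>" by (simp add: complex_diff_cnj norm_mult)
    finally show ?thesis using Im by (simp add: A_def)
  qed
  obtain K where K: "K < \<infinity>" "\<And>a \<delta>. \<bar>a\<bar> \<le> 1 \<Longrightarrow> \<delta> \<le> 1 \<Longrightarrow>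
    (\<integral>\<^sup>+s. ennreal (\<bar>s - a\<bar> powr (\<tau> - 1)) * indicator {0..\<delta>} s \<partial>lborel) \<le> K"
    using powr_line_integral[OF \<tau>(1)] by auto
  define N where "N = norm v + 1"
  define \<delta> where "\<delta> = min (2 * \<sigma>) (\<eta>3 / (2 * N))"
  have nN: "N > 0" by (simp add: N_def add_nonneg_pos)
  have \<delta>: "\<delta> > 0" "\<delta> \<le> 2 * \<sigma>" "\<delta> \<le> 1" "\<delta> * norm v \<le> \<eta>3 / 2"
  proof -
    show "\<delta> > 0" "\<delta> \<le> 2 * \<sigma>" using Z.\<sigma>_pos \<eta>3 nN by (auto simp: \<delta>_def)
    thus "\<delta> \<le> 1" using Z.\<sigma>_le by simp
    have "\<delta> * norm v \<le> \<delta> * N" using \<open>\<delta> > 0\<close> by (simp add: N_def)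
    also have "\<dots> \<le> \<eta>3 / (2 * N) * N" using nN by (intro mult_right_mono) (auto simp: \<delta>_def)
    also have "\<dots> = \<eta>3 / 2" using nN by simp
    finally show "\<delta> * norm v \<le> \<eta>3 / 2" .
  qed
  define B where "B = ball p \<epsilon>"
  \<comment> \<open>Cut off to 0 outside the ball where \<open>F\<close> is holomorphic, to obtain a
    Borel function on the whole space for the averaging.\<close>
  define h where "h x = ennreal (if x \<in> B then cmod (line_deriv (cvec v) F (cvec x)) / cmod (F (cvec x)) else 0)" for x
  have [measurable]: "B \<in> sets borel" by (simp add: B_def)
  have [measurable]: "(\<lambda>x. if x \<in> B then cmod (line_deriv (cvec v) F (cvec x)) else 0) \<in> borel_measurable borel"
  proof (rule borel_measurable_continuous_on_if)
    show "continuous_on B (\<lambda>x. cmod (line_deriv (cvec v) F (cvec x)))"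
      by (intro continuous_intros continuous_on_compose2[OF line_holomorphic_on_continuous[OF line_holomorphic_on_line_deriv[OF F]]])
         (auto simp: B_def)
  qed auto
  have [measurable]: "(\<lambda>x. if x \<in> B then cmod (F (cvec x)) else 1) \<in> borel_measurable borel"
  proof (rule borel_measurable_continuous_on_if)
    show "continuous_on B (\<lambda>x. cmod (F (cvec x)))"
      by (intro continuous_intros continuous_on_compose2[OF line_holomorphic_on_continuous[OF F]]) (auto simp: B_def)
  qed auto
  have h_alt: "h = (\<lambda>x. ennreal ((if x \<in> B then cmod (line_deriv (cvec v) F (cvec x)) else 0) / (if x \<in> B then cmod (F (cvec x)) else 1)))"
    by (auto simp: h_def fun_eq_iff)
  have hm [measurable]: "h \<in> borel_measurable borel" unfolding h_alt by measurable
  define E where "E = ennreal (C * A powr \<tau>) * (ennreal C * K)"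
  have E: "E < \<infinity>" using K(1) unfolding E_def by (auto simp: ennreal_mult_less_top)
  have line: "(\<integral>\<^sup>+s. h (x + s *\<^sub>R v) * indicator {0..\<delta>} s \<partial>lborel) \<le>
      ennreal C * ennreal \<delta> + E * ennreal (cmod (D (cvec x)) powr (-\<tau>))"
    if x: "x \<in> ball p \<eta>" and Dx: "D (cvec x) \<noteq> 0" for x
  proof -
    have xP: "cvec x \<in> ball (cvec p) \<eta>" using x by simp
    have fin: "finite (R x)" unfolding R_def by (rule Z.finite_zeros[OF xP])
    define d where "d = cmod (D (cvec x)) powr (-\<tau>)"
    have pt: "h (x + s *\<^sub>R v) \<le> ennreal C + ennreal (C * A powr \<tau> * d) * (\<Sum>r\<in>R x. ennreal (\<bar>s - Re r\<bar> powr (\<tau> - 1)))"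
      if s: "s \<in> {0..\<delta>}" "s \<notin> Re ` R x" for s
    proof -
      have smod: "cmod (of_real s) < 3 * \<sigma>" using s \<delta> Z.\<sigma>_pos by simp
      have eq: "cvec (x + s *\<^sub>R v) = cvec x + of_real s *s cvec v" by (simp add: cvec_add cvec_scaleR)
      have "of_real s \<notin> R x" using s(2) by (metis Re_complex_of_real imageI)
      hence ne: "F (cvec x + of_real s *s cvec v) \<noteq> 0" using smod Z.\<sigma>_pos by (simp add: R_def line_zeros_def)
      have tm_le: "real (m (cvec x) r) / cmod (of_real s - r) \<le> C * (A powr \<tau> * d * \<bar>s - Re r\<bar> powr (\<tau> - 1))"
        if r: "r \<in> R x" for r
      proof -
        have Im: "\<bar>Im r\<bar> > 0" "cmod (D (cvec x)) / A \<le> \<bar>Im r\<bar>"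
          using nonreal[OF x Dx r] A by (auto simp: field_simps)
        have pos: "0 < \<bar>s - Re r\<bar>" using s(2) r by auto
        have le1: "\<bar>s - Re r\<bar> \<le> cmod (of_real s - r)" using abs_Re_le_cmod[of "of_real s - r"] by simp
        have le2: "\<bar>Im r\<bar> \<le> cmod (of_real s - r)" using abs_Im_le_cmod[of "of_real s - r"] by simp
        have cpos: "cmod (of_real s - r) > 0" using pos le1 by linarith
        \<comment> \<open>Both exponents are negative, so replacing the distance by the smaller
          \<open>\<bar>s - Re r\<bar>\<close> in one factor and \<open>\<bar>Im r\<bar>\<close> in
          the other enlarges them; the second factor is free of \<open>s\<close>.\<close>
        have "1 / cmod (of_real s - r) = cmod (of_real s - r) powr ((\<tau> - 1) + (-\<tau>))"
          using cpos by (simp add: powr_minus_divide)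
        also have "\<dots> = cmod (of_real s - r) powr (\<tau> - 1) * cmod (of_real s - r) powr (-\<tau>)" by (rule powr_add)
        also have "\<dots> \<le> \<bar>s - Re r\<bar> powr (\<tau> - 1) * \<bar>Im r\<bar> powr (-\<tau>)"
          using pos le1 le2 Im \<tau> by (intro mult_mono powr_mono2') auto
        also have "\<dots> \<le> \<bar>s - Re r\<bar> powr (\<tau> - 1) * (A powr \<tau> * d)"
        proof (rule mult_left_mono)
          have "\<bar>Im r\<bar> powr (-\<tau>) \<le> (cmod (D (cvec x)) / A) powr (-\<tau>)"
            using Im Dx A \<tau> by (intro powr_mono2') auto
          also have "\<dots> = A powr \<tau> * d"
            using Dx A by (simp add: d_def powr_divide powr_minus field_simps)
          finally show "\<bar>Im r\<bar> powr (-\<tau>) \<le> A powr \<tau> * d" .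
        qed simp
        finally have 1: "1 / cmod (of_real s - r) \<le> A powr \<tau> * d * \<bar>s - Re r\<bar> powr (\<tau> - 1)"
          by (simp add: mult_ac)
        have "m (cvec x) r \<le> (\<Sum>r\<in>R x. m (cvec x) r)" using r fin by (intro member_le_sum) auto
        hence "real (m (cvec x) r) \<le> C" using Z.mult_sum_le[OF xP] unfolding R_def by linarith
        from mult_mono[OF this 1] Z.C_pos show ?thesis by simp
      qed
      have "cmod (line_deriv (cvec v) F (cvec x + of_real s *s cvec v)) / cmod (F (cvec x + of_real s *s cvec v))
          \<le> C + (\<Sum>r\<in>R x. real (m (cvec x) r) / cmod (of_real s - r))"
        using Z.line_deriv_le[OF xP smod ne] ne by (simp add: R_def field_simps)
      also have "\<dots> \<le> C + (\<Sum>r\<in>R x. C * (A powr \<tau> * d * \<bar>s - Re r\<bar> powr (\<tau> - 1)))"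
        by (intro add_left_mono sum_mono tm_le)
      also have "\<dots> = C + C * A powr \<tau> * d * (\<Sum>r\<in>R x. \<bar>s - Re r\<bar> powr (\<tau> - 1))"
        by (simp add: sum_distrib_left mult_ac)
      finally have "h (x + s *\<^sub>R v) \<le> ennreal (C + C * A powr \<tau> * d * (\<Sum>r\<in>R x. \<bar>s - Re r\<bar> powr (\<tau> - 1)))"
        unfolding h_def eq using Z.C_pos
        by (auto intro!: ennreal_leI add_nonneg_nonneg mult_nonneg_nonneg sum_nonneg simp: d_def)
      also have "\<dots> = ennreal C + ennreal (C * A powr \<tau> * d) * (\<Sum>r\<in>R x. ennreal (\<bar>s - Re r\<bar> powr (\<tau> - 1)))"
        using Z.C_pos by (subst ennreal_plus) (auto simp: ennreal_mult sum_ennreal sum_nonneg d_def)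
      finally show ?thesis .
    qed
    have "(\<integral>\<^sup>+s. h (x + s *\<^sub>R v) * indicator {0..\<delta>} s \<partial>lborel) \<le>
      (\<integral>\<^sup>+s. (ennreal C * indicator {0..\<delta>} s + ennreal (C * A powr \<tau> * d) * (\<Sum>r\<in>R x. ennreal (\<bar>s - Re r\<bar> powr (\<tau> - 1)) * indicator {0..\<delta>} s)) \<partial>lborel)"
    proof (rule nn_integral_mono_AE)
      have "AE s in lborel. \<forall>a\<in>Re ` R x. s \<noteq> a"
        using fin by (intro AE_finite_allI AE_lborel_singleton) auto
      thus "AE s in lborel. h (x + s *\<^sub>R v) * indicator {0..\<delta>} s \<le> ennreal C * indicator {0..\<delta>} s +
          ennreal (C * A powr \<tau> * d) * (\<Sum>r\<in>R x. ennreal (\<bar>s - Re r\<bar> powr (\<tau> - 1)) * indicator {0..\<delta>} s)"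
      proof eventually_elim
        case (elim s)
        show ?case using pt[of s] elim by (cases "s \<in> {0..\<delta>}") auto
      qed
    qed
    also have "\<dots> = ennreal C * ennreal \<delta> + ennreal (C * A powr \<tau> * d) * (\<Sum>r\<in>R x. \<integral>\<^sup>+s. ennreal (\<bar>s - Re r\<bar> powr (\<tau> - 1)) * indicator {0..\<delta>} s \<partial>lborel)"
      using \<delta>(1) by (simp add: nn_integral_add nn_integral_cmult nn_integral_sum nn_integral_cmult_indicator)
    also have "\<dots> \<le> ennreal C * ennreal \<delta> + ennreal (C * A powr \<tau> * d) * (\<Sum>r\<in>R x. K)"
    proof (intro add_left_mono mult_left_mono sum_mono K(2))
      fix r assume "r \<in> R x"
      hence "cmod r < 2 * \<sigma>" using Z.zeros_small[OF xP] by (simp add: R_def)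
      thus "\<bar>Re r\<bar> \<le> 1" using abs_Re_le_cmod[of r] Z.\<sigma>_le by linarith
    qed (use \<delta> in auto)
    also have "\<dots> \<le> ennreal C * ennreal \<delta> + ennreal (C * A powr \<tau> * d) * (ennreal C * K)"
    proof -
      have "(\<Sum>r\<in>R x. K) \<le> ennreal C * K"
        using Z.card_zeros_le[OF xP] Z.C_pos unfolding R_def
        by (simp add: ennreal_of_nat_eq_real_of_nat) (intro mult_right_mono ennreal_leI; simp)
      thus ?thesis by (intro add_left_mono mult_left_mono) auto
    qed
    also have "\<dots> = ennreal C * ennreal \<delta> + E * ennreal d"
      using Z.C_pos by (simp add: E_def ennreal_mult d_def mult_ac)
    finally show ?thesis unfolding d_def .
  qed
  have "ennreal \<delta> * (\<integral>\<^sup>+x. h x * indicator (ball p (\<eta>3/2)) x \<partial>lborel) \<le>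
    (\<integral>\<^sup>+x. (\<integral>\<^sup>+s. h (x + s *\<^sub>R v) * indicator {0..\<delta>} s \<partial>lborel) * indicator (ball p \<eta>3) x \<partial>lborel)"
    by (rule line_average) (use \<delta> hm in auto)
  \<comment> \<open>The zeros of the discriminant are a null set, so the line bound holds for almost
    every base point.\<close>
  also have "\<dots> \<le> (\<integral>\<^sup>+x. (ennreal C * ennreal \<delta> * indicator (ball p \<eta>3) x +
       E * (ennreal (cmod (D (cvec x)) powr (-\<tau>)) * indicator (ball p \<eta>3) x)) \<partial>lborel)"
  proof (rule nn_integral_mono_AE)
    show "AE x in lborel. (\<integral>\<^sup>+s. h (x + s *\<^sub>R v) * indicator {0..\<delta>} s \<partial>lborel) * indicator (ball p \<eta>3) x \<le>
       ennreal C * ennreal \<delta> * indicator (ball p \<eta>3) x + E * (ennreal (cmod (D (cvec x)) powr (-\<tau>)) * indicator (ball p \<eta>3) x)"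
      using D_AE
    proof eventually_elim
      case (elim x)
      show ?case
        using line[of x] elim \<eta>3 by (cases "x \<in> ball p \<eta>3") auto
    qed
  qed
  also have "\<dots> = ennreal C * ennreal \<delta> * emeasure lborel (ball p \<eta>3) +
       E * (\<integral>\<^sup>+x. ennreal (cmod (D (cvec x)) powr (-\<tau>)) * indicator (ball p \<eta>3) x \<partial>lborel)"
  proof -
    have "(\<lambda>x. if x \<in> ball p \<eta>3 then cmod (D (cvec x)) else 0) \<in> borel_measurable borel"
    proof (rule borel_measurable_continuous_on_if)
      show "continuous_on (ball p \<eta>3) (\<lambda>x. cmod (D (cvec x)))"
        by (intro continuous_intros continuous_on_compose2[OF line_holomorphic_on_continuous[OF Dhol]]) (use \<eta>3 in auto)
    qed auto
    hence "(\<lambda>x. ennreal ((if x \<in> ball p \<eta>3 then cmod (D (cvec x)) else 0) powr (-\<tau>))) \<in> borel_measurable borel"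
      by measurable
    also have "(\<lambda>x. ennreal ((if x \<in> ball p \<eta>3 then cmod (D (cvec x)) else 0) powr (-\<tau>))) =
        (\<lambda>x. ennreal (cmod (D (cvec x)) powr (-\<tau>)) * indicator (ball p \<eta>3) x)"
      by (auto simp: fun_eq_iff)
    finally have [measurable]: "(\<lambda>x. ennreal (cmod (D (cvec x)) powr (-\<tau>)) * indicator (ball p \<eta>3) x) \<in> borel_measurable lborel"
      by simp
    show ?thesis
      by (subst nn_integral_add)
         (auto simp: nn_integral_cmult nn_integral_cmult_indicator intro!: borel_measurable_times_ennreal borel_measurable_indicator)
  qed
  also have "\<dots> < \<infinity>"
  proof -
    have "(\<integral>\<^sup>+x. ennreal (cmod (D (cvec x)) powr (-\<tau>)) * indicator (ball p \<eta>3) x \<partial>lborel) \<le>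
       (\<integral>\<^sup>+x. ennreal (cmod (D (cvec x)) powr (-\<tau>)) * indicator (ball p \<eta>2) x \<partial>lborel)"
      by (intro nn_integral_mono mult_left_mono) (use \<eta>3 in \<open>auto simp: indicator_def\<close>)
    hence "(\<integral>\<^sup>+x. ennreal (cmod (D (cvec x)) powr (-\<tau>)) * indicator (ball p \<eta>3) x \<partial>lborel) < \<infinity>"
      using D_int by (rule le_less_trans)
    thus ?thesis using E emeasure_lborel_ball_finite[of p \<eta>3] by (auto simp: ennreal_mult_less_top)
  qed
  finally have fin: "(\<integral>\<^sup>+x. h x * indicator (ball p (\<eta>3/2)) x \<partial>lborel) < \<infinity>"
    using \<delta>(1) by (auto simp: ennreal_mult_less_top)
  have sub: "x \<in> B" if "x \<in> ball p \<eta>3" for x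
    using Z.in_domain[of "cvec x" 0] that \<eta>3 Z.\<sigma>_pos by (simp add: B_def)
  have "(\<integral>\<^sup>+x. ennreal (cmod (line_deriv (cvec v) F (cvec x) / F (cvec x))) * indicator (ball p (\<eta>3/2)) x \<partial>lborel) =
      (\<integral>\<^sup>+x. h x * indicator (ball p (\<eta>3/2)) x \<partial>lborel)"
    by (intro nn_integral_cong) (use sub \<eta>3 in \<open>auto simp: h_def indicator_def norm_divide\<close>)
  thus ?thesis using fin \<eta>3 by (intro exI[of _ "\<eta>3/2"]) simp
qed

section \<open>Directional derivatives of real analytic functions\<close>

lemma complexification_line_derivative:
  fixes f :: "real^'n \<Rightarrow> real" and v :: "real^'n"
  assumes F: "line_holomorphic_on F (ball (cvec p) \<epsilon>)"
    and Fr: "\<And>x. x \<in> ball p \<epsilon> \<Longrightarrow> F (cvec x) = of_real (f x)" and x: "x \<in> ball p \<epsilon>"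
  shows "((\<lambda>s. f (x + s *\<^sub>R v)) has_real_derivative Re (line_deriv (cvec v) F (cvec x))) (at 0)"
proof -
  have "((\<lambda>s. F (cvec x + s *s cvec v)) has_field_derivative line_deriv (cvec v) F (cvec x)) (at (of_real 0))"
    using line_holomorphic_on_line_at[OF F, of "cvec x" 0 "cvec v"] x by simp
  hence "((\<lambda>s. F (cvec x + of_real s *s cvec v)) has_vector_derivative line_deriv (cvec v) F (cvec x)) (at (0::real))"
    by (rule has_vector_derivative_real_field)
  hence "((\<lambda>s. Re (F (cvec x + of_real s *s cvec v))) has_vector_derivative Re (line_deriv (cvec v) F (cvec x))) (at (0::real))"
    by (rule bounded_linear.has_vector_derivative[OF bounded_linear_Re])
  hence 1: "((\<lambda>s. Re (F (cvec x + of_real s *s cvec v))) has_real_derivative Re (line_deriv (cvec v) F (cvec x))) (at 0)"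
    by (simp add: has_real_derivative_iff_has_vector_derivative)
  have "open ((\<lambda>s::real. x + s *\<^sub>R v) -` ball p \<epsilon>)"
    by (intro open_vimage continuous_intros) auto
  thus ?thesis
    by (rule has_field_derivative_transform_within_open[OF 1])
       (use x Fr in \<open>auto simp: cvec_add cvec_scaleR simp flip: cvec_scaleR cvec_add\<close>)
qed

lemma line_derivative_at:
  fixes f :: "'a::real_normed_vector \<Rightarrow> real"
  assumes "((\<lambda>s. f ((x + a *\<^sub>R w) + s *\<^sub>R w)) has_real_derivative D) (at 0)"
  shows "((\<lambda>s. f (x + s *\<^sub>R w)) has_real_derivative D) (at a)"
proof -
  have "((\<lambda>s. f (x + (s + a) *\<^sub>R w)) has_real_derivative D) (at 0)"
    using assms by (simp add: scaleR_add_left add_ac)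
  thus ?thesis using DERIV_shift[of "\<lambda>s. f (x + s *\<^sub>R w)" D 0 a] by simp
qed

text \<open>Continuity of the derivative along \<open>w\<close> stands in for total
  differentiability: the increment along \<open>w\<close> from \<open>x + s *\<^sub>R v\<close> is
  handled by the mean value theorem, and along \<open>v\<close> only the derivative at
  \<open>x\<close> itself is used.\<close>

lemma line_derivative_add:
  fixes f :: "'a::real_normed_vector \<Rightarrow> real"
  assumes B: "open B" "x \<in> B"
    and w: "\<And>y. y \<in> B \<Longrightarrow> ((\<lambda>s. f (y + s *\<^sub>R w)) has_real_derivative g y) (at 0)" and g: "isCont g x"
    and v: "((\<lambda>s. f (x + s *\<^sub>R v)) has_real_derivative a) (at 0)"
  shows "((\<lambda>s. f (x + s *\<^sub>R (v + w))) has_real_derivative a + g x) (at 0)"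
proof -
  have lim: "((\<lambda>s. (f (x + s *\<^sub>R v + s *\<^sub>R w) - f (x + s *\<^sub>R v)) / s) \<longlongrightarrow> g x) (at 0)"
    unfolding tendsto_iff
  proof (intro allI impI)
    fix e :: real assume e: "e > 0"
    obtain d0 where d0: "d0 > 0" "\<And>y. dist y x < d0 \<Longrightarrow> dist (g y) (g x) < e"
      using g e unfolding continuous_at_eps_delta by blast
    obtain d1 where d1: "d1 > 0" "ball x d1 \<subseteq> B" using B openE by blast
    define N where "N = norm v + norm w + 1"
    have N: "N > 0" by (simp add: N_def add_nonneg_pos)
    define d where "d = min d0 d1 / N"
    have d: "d > 0" using d0 d1 N by (simp add: d_def)
    have close: "dist (x + s *\<^sub>R v + (u * s) *\<^sub>R w) x < min d0 d1" if s: "\<bar>s\<bar> < d" and u: "0 \<le> u" "u \<le> 1" for s u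
    proof -
      have "dist (x + s *\<^sub>R v + (u * s) *\<^sub>R w) x = norm (s *\<^sub>R v + (u * s) *\<^sub>R w)"
        by (simp add: dist_norm add.assoc)
      also have "\<dots> \<le> \<bar>s\<bar> * norm v + \<bar>u\<bar> * \<bar>s\<bar> * norm w"
        by (rule order_trans[OF norm_triangle_ineq]) (simp add: abs_mult)
      also have "\<bar>u\<bar> * \<bar>s\<bar> * norm w \<le> 1 * \<bar>s\<bar> * norm w" using u by (intro mult_right_mono) auto
      finally have "dist (x + s *\<^sub>R v + (u * s) *\<^sub>R w) x \<le> \<bar>s\<bar> * N" by (simp add: N_def algebra_simps)
      also have "\<dots> < d * N" using s N by simp
      also have "\<dots> = min d0 d1" using N by (simp add: d_def)
      finally show ?thesis .
    qed
    have "dist ((f (x + s *\<^sub>R v + s *\<^sub>R w) - f (x + s *\<^sub>R v)) / s) (g x) < e" if s: "s \<noteq> 0" "\<bar>s\<bar> < d" for s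
    proof -
      define k where "k = (\<lambda>u. f (x + s *\<^sub>R v + (u * s) *\<^sub>R w))"
      have der: "(k has_real_derivative s * g (x + s *\<^sub>R v + (u * s) *\<^sub>R w)) (at u)" if u: "0 \<le> u" "u \<le> 1" for u
      proof -
        have "x + s *\<^sub>R v + (u * s) *\<^sub>R w \<in> B" using close[OF s(2) u] d1 by (auto simp: dist_commute)
        from line_derivative_at[of f "x + s *\<^sub>R v" "u * s" w, OF w[OF this]]
        have 1: "((\<lambda>r. f (x + s *\<^sub>R v + r *\<^sub>R w)) has_real_derivative g (x + s *\<^sub>R v + (u * s) *\<^sub>R w)) (at (u * s))" .
        have 2: "((\<lambda>u. u * s) has_real_derivative s) (at u)" by (auto intro!: derivative_eq_intros)
        from DERIV_chain2[OF 1 2] show ?thesis by (simp add: k_def mult.commute)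
      qed
      from MVT2[of 0 1 k "\<lambda>u. s * g (x + s *\<^sub>R v + (u * s) *\<^sub>R w)"] der
      obtain u where u: "0 < u" "u < 1" "k 1 - k 0 = s * g (x + s *\<^sub>R v + (u * s) *\<^sub>R w)" by auto
      hence "(f (x + s *\<^sub>R v + s *\<^sub>R w) - f (x + s *\<^sub>R v)) / s = g (x + s *\<^sub>R v + (u * s) *\<^sub>R w)"
        using s by (simp add: k_def)
      thus ?thesis using d0(2) close[OF s(2), of u] u by simp
    qed
    thus "\<forall>\<^sub>F s in at 0. dist ((f (x + s *\<^sub>R v + s *\<^sub>R w) - f (x + s *\<^sub>R v)) / s) (g x) < e"
      unfolding eventually_at using d by (auto intro!: exI[of _ d])
  qed
  have "((\<lambda>s. (f (x + s *\<^sub>R v) - f x) / s) \<longlongrightarrow> a) (at 0)"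
    using v by (simp add: DERIV_def)
  from tendsto_add[OF this lim]
  have "((\<lambda>s. (f (x + s *\<^sub>R (v + w)) - f x) / s) \<longlongrightarrow> a + g x) (at 0)"
    by (simp add: add_divide_distrib[symmetric] scaleR_add_right add.assoc)
  thus ?thesis by (simp add: DERIV_def)
qed

text \<open>Defined along the axis, since the complexification yields derivatives along lines;
  integration by parts uses nothing more.\<close>

definition partial :: "'n \<Rightarrow> (real^'n \<Rightarrow> real) \<Rightarrow> real^'n \<Rightarrow> real" where
  "partial i f x = deriv (\<lambda>s. f (x + s *\<^sub>R axis i 1)) 0"

lemma real_analytic_partial:
  fixes f :: "real^'n \<Rightarrow> real"
  assumes f: "real_analytic_on f V" and V: "open V"
  shows "continuous_on V f" "continuous_on V (partial i f)"
    "\<And>x. x \<in> V \<Longrightarrow> ((\<lambda>s. f (x + s *\<^sub>R axis i 1)) has_real_derivative partial i f x) (at 0)"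
proof -
  have *: "isCont f x \<and> isCont (partial i f) x \<and>
     ((\<lambda>s. f (x + s *\<^sub>R axis i 1)) has_real_derivative partial i f x) (at 0)" if x: "x \<in> V" for x
  proof -
    obtain \<epsilon> F where F: "\<epsilon> > 0" "line_holomorphic_on F (ball (cvec x) \<epsilon>)"
      "\<And>y. y \<in> ball x \<epsilon> \<Longrightarrow> F (cvec y) = of_real (f y)"
      using real_analytic_complexification[OF f x] by metis
    have der: "((\<lambda>s. f (y + s *\<^sub>R axis i 1)) has_real_derivative Re (line_deriv (cvec (axis i 1)) F (cvec y))) (at 0)"
      if "y \<in> ball x \<epsilon>" for y
      by (rule complexification_line_derivative[OF F(2,3) that])
    have peq: "Re (line_deriv (cvec (axis i 1)) F (cvec y)) = partial i f y" if "y \<in> ball x \<epsilon>" for y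
      unfolding partial_def using DERIV_imp_deriv[OF der[OF that]] by simp
    have "continuous_on (ball x \<epsilon>) (\<lambda>y. Re (F (cvec y)))"
      by (intro continuous_intros continuous_on_compose2[OF line_holomorphic_on_continuous[OF F(2)]]) auto
    moreover have "continuous_on (ball x \<epsilon>) (\<lambda>y. Re (F (cvec y))) \<longleftrightarrow> continuous_on (ball x \<epsilon>) f"
      by (rule continuous_on_cong) (auto simp: F(3))
    moreover have "continuous_on (ball x \<epsilon>) (\<lambda>y. Re (line_deriv (cvec (axis i 1)) F (cvec y)))"
      by (intro continuous_intros continuous_on_compose2[OF line_holomorphic_on_continuous[OF line_holomorphic_on_line_deriv[OF F(2)]]]) auto
    moreover have "continuous_on (ball x \<epsilon>) (\<lambda>y. Re (line_deriv (cvec (axis i 1)) F (cvec y))) \<longleftrightarrow> continuous_on (ball x \<epsilon>) (partial i f)"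
      by (rule continuous_on_cong) (auto simp: peq)
    ultimately show ?thesis
      using der[of x] peq[of x] F(1) by (simp add: continuous_on_eq_continuous_at)
  qed
  show "continuous_on V f" "continuous_on V (partial i f)"
    "\<And>x. x \<in> V \<Longrightarrow> ((\<lambda>s. f (x + s *\<^sub>R axis i 1)) has_real_derivative partial i f x) (at 0)"
    using * V by (auto simp: continuous_on_eq_continuous_at)
qed

section \<open>Local integrability of the logarithm and of the gradient quotient\<close>

lemma nn_integral_bounded_on_ball:
  fixes h :: "'a::euclidean_space \<Rightarrow> real"
  assumes "\<And>x. x \<in> ball p r \<Longrightarrow> h x \<le> M"
  shows "(\<integral>\<^sup>+x. ennreal (h x) * indicator (ball p r) x \<partial>lborel) < \<infinity>"
proof -
  have "(\<integral>\<^sup>+x. ennreal (h x) * indicator (ball p r) x \<partial>lborel) \<le> (\<integral>\<^sup>+x. ennreal M * indicator (ball p r) x \<partial>lborel)"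
    by (intro nn_integral_mono) (use assms in \<open>auto simp: indicator_def intro!: ennreal_leI\<close>)
  also have "\<dots> = ennreal M * emeasure lborel (ball p r)" by (simp add: nn_integral_cmult_indicator)
  also have "\<dots> < \<infinity>" using emeasure_lborel_ball_finite[of p r] by (simp add: ennreal_mult_less_top)
  finally show ?thesis .
qed

lemma continuous_bounded_on_small_ball:
  fixes h :: "'a::euclidean_space \<Rightarrow> real"
  assumes "continuous_on V h" "open V" "p \<in> V"
  shows "\<exists>r>0. \<exists>M. ball p r \<subseteq> V \<and> (\<forall>x\<in>ball p r. \<bar>h x\<bar> \<le> M)"
proof -
  obtain r where r: "r > 0" "cball p r \<subseteq> V" using assms open_contains_cball by blast
  have "bounded (h ` cball p r)"
    by (intro compact_imp_bounded compact_continuous_image continuous_on_subset[OF assms(1) r(2)]) auto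
  then obtain M where "\<And>x. x \<in> cball p r \<Longrightarrow> \<bar>h x\<bar> \<le> M"
    unfolding bounded_iff real_norm_def by blast
  thus ?thesis using r ball_subset_cball by (intro exI[of _ r] conjI exI[of _ M]) force+
qed

text \<open>\<open>ln t \<le> t\<close> at \<open>t = y powr (-\<epsilon>)\<close> controls the
  negative part of the logarithm, and at \<open>t = y\<close> the positive part. This converts an
  integrable negative power into an integrable logarithm.\<close>

lemma abs_ln_le:
  assumes "y > (0::real)" "\<epsilon> > 0"
  shows "\<bar>ln y\<bar> \<le> y powr (-\<epsilon>) / \<epsilon> + y"
proof -
  have "- \<epsilon> * ln y \<le> y powr (-\<epsilon>)"
    using ln_bound[of "y powr (-\<epsilon>)"] assms by (simp add: ln_powr)
  hence "- ln y \<le> y powr (-\<epsilon>) / \<epsilon>" using assms by (simp add: field_simps)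
  moreover have "ln y \<le> y" using ln_bound assms by simp
  moreover have "0 \<le> y powr (-\<epsilon>) / \<epsilon>" using assms by simp
  ultimately show ?thesis using assms by linarith
qed

lemma nonvanishing_local_integrability:
  fixes f :: "real^'n \<Rightarrow> real"
  assumes f: "real_analytic_on f V" and V: "open V" "p \<in> V" and p0: "f p \<noteq> 0"
  shows "\<exists>r>0. (AE x in lborel. x \<in> ball p r \<longrightarrow> f x \<noteq> 0) \<and>
     (\<integral>\<^sup>+x. ennreal \<bar>ln \<bar>f x\<bar>\<bar> * indicator (ball p r) x \<partial>lborel) < \<infinity>"
    and "\<exists>r>0. (\<integral>\<^sup>+x. ennreal \<bar>partial i f x / f x\<bar> * indicator (ball p r) x \<partial>lborel) < \<infinity>"
proof -
  note fc = real_analytic_partial(1)[OF f V(1)] real_analytic_partial(2,3)[OF f V(1), where i = i]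
  define W where "W = V \<inter> f -` (- {0})"
  have W: "open W" "p \<in> W" "W \<subseteq> V"
    using continuous_open_preimage[OF fc(1) V(1), of "- {0}"] V(2) p0 by (auto simp: W_def)
  have "continuous_on W (\<lambda>x. ln \<bar>f x\<bar>)"
    by (intro continuous_intros continuous_on_subset[OF fc(1)]) (use W in \<open>auto simp: W_def\<close>)
  from continuous_bounded_on_small_ball[OF this W(1,2)]
  obtain r M where r: "r > 0" "ball p r \<subseteq> W" "\<And>x. x \<in> ball p r \<Longrightarrow> \<bar>ln \<bar>f x\<bar>\<bar> \<le> M" by blast
  have "AE x in lborel. x \<in> ball p r \<longrightarrow> f x \<noteq> 0" using r(2) by (intro AE_I2) (auto simp: W_def)
  with r nn_integral_bounded_on_ball[of p r "\<lambda>x. \<bar>ln \<bar>f x\<bar>\<bar>" M]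
  show "\<exists>r>0. (AE x in lborel. x \<in> ball p r \<longrightarrow> f x \<noteq> 0) \<and>
     (\<integral>\<^sup>+x. ennreal \<bar>ln \<bar>f x\<bar>\<bar> * indicator (ball p r) x \<partial>lborel) < \<infinity>" by blast
  have "continuous_on W (\<lambda>x. partial i f x / f x)"
    by (intro continuous_intros continuous_on_subset[OF fc(1)] continuous_on_subset[OF fc(2)]) (use W in \<open>auto simp: W_def\<close>)
  from continuous_bounded_on_small_ball[OF this W(1,2)]
  obtain r M where r: "r > 0" "ball p r \<subseteq> W" "\<And>x. x \<in> ball p r \<Longrightarrow> \<bar>partial i f x / f x\<bar> \<le> M" by blast
  with nn_integral_bounded_on_ball[of p r "\<lambda>x. \<bar>partial i f x / f x\<bar>" M]
  show "\<exists>r>0. (\<integral>\<^sup>+x. ennreal \<bar>partial i f x / f x\<bar> * indicator (ball p r) x \<partial>lborel) < \<infinity>" by blast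
qed

text \<open>The logarithm is dominated by an integrable negative power of \<open>cmod F\<close>. For
  the gradient, \<open>x2 = x1 + \<delta> *\<^sub>R e\<close> is a second point with
  \<open>f x2 \<noteq> 0\<close>, so both \<open>x1 - p\<close> and \<open>x2 - p\<close> are
  admissible directions, and their difference is a multiple of the axis.\<close>

lemma vanishing_local_integrability:
  fixes f :: "real^'n \<Rightarrow> real"
  assumes f: "real_analytic_on f V" and V: "open V" "p \<in> V" and p0: "f p = 0"
    and codim: "analytic_codim_at {x\<in>V. f x = 0} p \<ge> 2"
  shows "\<exists>r>0. (AE x in lborel. x \<in> ball p r \<longrightarrow> f x \<noteq> 0) \<and>
     (\<integral>\<^sup>+x. ennreal \<bar>ln \<bar>f x\<bar>\<bar> * indicator (ball p r) x \<partial>lborel) < \<infinity>"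
    and "\<exists>r>0. (\<integral>\<^sup>+x. ennreal \<bar>partial i f x / f x\<bar> * indicator (ball p r) x \<partial>lborel) < \<infinity>"
proof -
  note fc = real_analytic_partial(1)[OF f V(1)] real_analytic_partial(2,3)[OF f V(1), where i = i]
  let ?Z = "{x\<in>V. f x = 0}"
  have "p \<notin> closure {q. smooth_point ?Z (CARD('n) - 1) q}"
    using codim_ge_2_no_smooth_points[OF codim] by simp
  then obtain \<epsilon>0 where \<epsilon>0: "\<epsilon>0 > 0" "\<And>q. q \<in> ball p \<epsilon>0 \<Longrightarrow> \<not> smooth_point ?Z (CARD('n) - 1) q"
    unfolding closure_approachable by (auto simp: dist_commute)
  have "p \<notin> closure {q. smooth_point ?Z CARD('n) q}"
    using codim_ge_2_no_smooth_points[OF codim] by simp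
  hence not_n: "\<not> smooth_point ?Z CARD('n) p" using closure_subset by blast
  obtain \<epsilon>1 F where F1: "\<epsilon>1 > 0" "line_holomorphic_on F (ball (cvec p) \<epsilon>1)"
    "\<And>y. y \<in> ball p \<epsilon>1 \<Longrightarrow> F (cvec y) = of_real (f y)"
    "\<And>z. z \<in> ball (cvec p) \<epsilon>1 \<Longrightarrow> F (\<chi> i. cnj (z $ i)) = cnj (F z)"
    using real_analytic_complexification[OF f V(2)] by metis
  obtain \<epsilon>2 where \<epsilon>2: "\<epsilon>2 > 0" "ball p \<epsilon>2 \<subseteq> V" using V openE by blast
  define \<epsilon> where "\<epsilon> = min \<epsilon>0 (min \<epsilon>1 \<epsilon>2)"
  have \<epsilon>: "\<epsilon> > 0" "ball p \<epsilon> \<subseteq> V" using \<epsilon>0 F1 \<epsilon>2 by (auto simp: \<epsilon>_def)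
  have F: "line_holomorphic_on F (ball (cvec p) \<epsilon>)"
    by (rule line_holomorphic_on_subset[OF F1(2)]) (auto simp: \<epsilon>_def)
  have Fr: "F (cvec y) = of_real (f y)" if "y \<in> ball p \<epsilon>" for y using F1(3) that by (simp add: \<epsilon>_def)
  have Fc: "F (\<chi> i. cnj (z $ i)) = cnj (F z)" if "z \<in> ball (cvec p) \<epsilon>" for z using F1(4) that by (simp add: \<epsilon>_def)
  have ns: "\<not> smooth_point ?Z (CARD('n) - 1) q" if "q \<in> ball p \<epsilon>" for q using \<epsilon>0(2) that by (simp add: \<epsilon>_def)
  \<comment> \<open>Otherwise \<open>p\<close> would be a smooth point of full dimension.\<close>
  have "\<exists>x1\<in>ball p \<epsilon>. f x1 \<noteq> 0"
    using interior_zero_smooth_point[OF open_ball _ \<epsilon>(2), of p f] not_n \<epsilon>(1) centre_in_ball by blast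
  then obtain x1 where x1: "x1 \<in> ball p \<epsilon>" "f x1 \<noteq> 0" by blast
  have good: "\<not> (\<forall>\<^sub>F s in nhds 0. F (cvec p + s *s cvec (x - p)) = 0)" if "x \<in> ball p \<epsilon>" "f x \<noteq> 0" for x
    by (rule line_not_locally_zero[OF F that(1)]) (use that Fr in simp)
  have logd: "\<exists>\<eta>>0. (\<integral>\<^sup>+x. ennreal (cmod (line_deriv (cvec (y - p)) F (cvec x) / F (cvec x))) * indicator (ball p \<eta>) x \<partial>lborel) < \<infinity>"
    if y: "y \<in> ball p \<epsilon>" "f y \<noteq> 0" for y
    by (rule log_derivative_integrable[OF \<epsilon> _ F Fr Fc good[OF y] ns]) (use y p0 in auto)
  show "\<exists>r>0. (AE x in lborel. x \<in> ball p r \<longrightarrow> f x \<noteq> 0) \<and>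
     (\<integral>\<^sup>+x. ennreal \<bar>ln \<bar>f x\<bar>\<bar> * indicator (ball p r) x \<partial>lborel) < \<infinity>"
  proof -
    obtain \<eta> \<tau> where \<eta>: "\<eta> > 0" and \<tau>: "\<tau> > 0"
      and AE: "AE x in lborel. x \<in> ball p \<eta> \<longrightarrow> F (cvec x) \<noteq> 0"
      and int: "(\<integral>\<^sup>+x. ennreal (cmod (F (cvec x)) powr (-\<tau>)) * indicator (ball p \<eta>) x \<partial>lborel) < \<infinity>"
      using negative_power_integrable[OF F _ good[OF x1]] \<epsilon>(1) by auto
    obtain r0 M where r0: "r0 > 0" "ball p r0 \<subseteq> V" "\<And>x. x \<in> ball p r0 \<Longrightarrow> \<bar>f x\<bar> \<le> M"
      using continuous_bounded_on_small_ball[OF fc(1) V] by blast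
    define r where "r = min \<eta> (min r0 \<epsilon>)"
    have r: "r > 0" "r \<le> \<eta>" "r \<le> r0" "r \<le> \<epsilon>" using \<eta> r0 \<epsilon> by (auto simp: r_def)
    have AE': "AE x in lborel. x \<in> ball p r \<longrightarrow> f x \<noteq> 0"
      using AE by eventually_elim (use r Fr in auto)
    have "(\<lambda>x. if x \<in> ball p r then cmod (F (cvec x)) else 0) \<in> borel_measurable borel"
    proof (rule borel_measurable_continuous_on_if)
      show "continuous_on (ball p r) (\<lambda>x. cmod (F (cvec x)))"
        by (intro continuous_intros continuous_on_compose2[OF line_holomorphic_on_continuous[OF F]]) (use r in auto)
    qed auto
    hence "(\<lambda>x. ennreal ((if x \<in> ball p r then cmod (F (cvec x)) else 0) powr (-\<tau>))) \<in> borel_measurable borel"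
      by measurable
    also have "(\<lambda>x. ennreal ((if x \<in> ball p r then cmod (F (cvec x)) else 0) powr (-\<tau>))) =
        (\<lambda>x. ennreal (cmod (F (cvec x)) powr (-\<tau>)) * indicator (ball p r) x)"
      by (auto simp: fun_eq_iff)
    finally have [measurable]: "(\<lambda>x. ennreal (cmod (F (cvec x)) powr (-\<tau>)) * indicator (ball p r) x) \<in> borel_measurable lborel"
      by simp
    have "(\<integral>\<^sup>+x. ennreal \<bar>ln \<bar>f x\<bar>\<bar> * indicator (ball p r) x \<partial>lborel) \<le>
       (\<integral>\<^sup>+x. (ennreal (1 / \<tau>) * (ennreal (cmod (F (cvec x)) powr (-\<tau>)) * indicator (ball p r) x) + ennreal M * indicator (ball p r) x) \<partial>lborel)"
    proof (rule nn_integral_mono_AE)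
      show "AE x in lborel. ennreal \<bar>ln \<bar>f x\<bar>\<bar> * indicator (ball p r) x \<le>
         ennreal (1 / \<tau>) * (ennreal (cmod (F (cvec x)) powr (-\<tau>)) * indicator (ball p r) x) + ennreal M * indicator (ball p r) x"
        using AE'
      proof eventually_elim
        case (elim x)
        show ?case
        proof (cases "x \<in> ball p r")
          case True
          have "\<bar>ln \<bar>f x\<bar>\<bar> \<le> \<bar>f x\<bar> powr (-\<tau>) / \<tau> + \<bar>f x\<bar>" using elim True \<tau> by (intro abs_ln_le) auto
          moreover have "\<bar>f x\<bar> \<le> M" using r0(3) True r by simp
          ultimately have "\<bar>ln \<bar>f x\<bar>\<bar> \<le> 1 / \<tau> * \<bar>f x\<bar> powr (-\<tau>) + M" by simp
          hence "ennreal \<bar>ln \<bar>f x\<bar>\<bar> \<le> ennreal (1 / \<tau> * \<bar>f x\<bar> powr (-\<tau>) + M)" by (rule ennreal_leI)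
          also have "\<dots> = ennreal (1 / \<tau>) * ennreal (\<bar>f x\<bar> powr (-\<tau>)) + ennreal M"
            using \<tau> \<open>\<bar>f x\<bar> \<le> M\<close> by (subst ennreal_plus) (auto simp flip: ennreal_mult)
          finally show ?thesis using True Fr[of x] r by simp
        qed simp
      qed
    qed
    also have "\<dots> = ennreal (1 / \<tau>) * (\<integral>\<^sup>+x. ennreal (cmod (F (cvec x)) powr (-\<tau>)) * indicator (ball p r) x \<partial>lborel) + ennreal M * emeasure lborel (ball p r)"
      by (subst nn_integral_add)
         (auto simp: nn_integral_cmult nn_integral_cmult_indicator intro!: borel_measurable_times_ennreal borel_measurable_indicator)
    also have "\<dots> < \<infinity>"
    proof -
      have "(\<integral>\<^sup>+x. ennreal (cmod (F (cvec x)) powr (-\<tau>)) * indicator (ball p r) x \<partial>lborel) \<le>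
         (\<integral>\<^sup>+x. ennreal (cmod (F (cvec x)) powr (-\<tau>)) * indicator (ball p \<eta>) x \<partial>lborel)"
        by (intro nn_integral_mono mult_left_mono) (use r in \<open>auto simp: indicator_def\<close>)
      hence "(\<integral>\<^sup>+x. ennreal (cmod (F (cvec x)) powr (-\<tau>)) * indicator (ball p r) x \<partial>lborel) < \<infinity>"
        using int by (rule le_less_trans)
      thus ?thesis using emeasure_lborel_ball_finite[of p r] by (auto simp: ennreal_mult_less_top)
    qed
    finally show ?thesis using r(1) AE' by blast
  qed
  show "\<exists>r>0. (\<integral>\<^sup>+x. ennreal \<bar>partial i f x / f x\<bar> * indicator (ball p r) x \<partial>lborel) < \<infinity>"
  proof -
    define e where "e = (axis i 1 :: real^'n)"
    have "isCont f x1" using fc(1) V(1) x1(1) \<epsilon>(2) by (auto simp: continuous_on_eq_continuous_at)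
    from continuous_at_avoid[OF this x1(2)] obtain d0 where d0: "d0 > 0" "\<And>y. dist x1 y < d0 \<Longrightarrow> f y \<noteq> 0" by auto
    \<comment> \<open>Half the minimum, so that \<open>x2\<close> stays inside
      \<open>ball p \<epsilon>\<close> and inside the neighbourhood of \<open>x1\<close> where
      \<open>f\<close> has no zero.\<close>
    define \<delta> where "\<delta> = min d0 (\<epsilon> - dist p x1) / 2"
    have \<delta>: "\<delta> > 0" "\<delta> < d0" "\<delta> < \<epsilon> - dist p x1" using d0 x1(1) by (auto simp: \<delta>_def min_def)
    define x2 where "x2 = x1 + \<delta> *\<^sub>R e"
    have dx: "dist x1 x2 = \<delta>" using \<delta>(1) by (simp add: x2_def dist_norm e_def)
    have x2: "x2 \<in> ball p \<epsilon>" "f x2 \<noteq> 0"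
      using dist_triangle[of p x2 x1] dx \<delta> d0(2)[of x2] by auto
    define L where "L y x = line_deriv (cvec (y - p)) F (cvec x)" for y x
    have der: "((\<lambda>s. f (x + s *\<^sub>R (y - p))) has_real_derivative Re (L y x)) (at 0)" if "x \<in> ball p \<epsilon>" for x y
      unfolding L_def by (rule complexification_line_derivative[OF F Fr that])
    \<comment> \<open>Additivity in the direction: the derivatives along \<open>x2 - p\<close> and
      \<open>x1 - p\<close> differ by \<open>\<delta>\<close> times the partial derivative.\<close>
    have part: "Re (L x2 x) = Re (L x1 x) + \<delta> * partial i f x" if x: "x \<in> ball p \<epsilon>" for x
    proof -
      have "((\<lambda>s. f (x + s *\<^sub>R ((x1 - p) + \<delta> *\<^sub>R e))) has_real_derivative Re (L x1 x) + \<delta> * partial i f x) (at 0)"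
      proof (rule line_derivative_add[OF V(1)])
        show "x \<in> V" using x \<epsilon> by blast
        show "((\<lambda>s. f (y + s *\<^sub>R \<delta> *\<^sub>R e)) has_real_derivative \<delta> * partial i f y) (at 0)" if "y \<in> V" for y
        proof -
          have 1: "((\<lambda>s. f (y + s *\<^sub>R e)) has_real_derivative partial i f y) (at (0 * \<delta>))"
            using fc(3)[OF that] by (simp add: e_def)
          have 2: "((\<lambda>s. s * \<delta>) has_real_derivative \<delta>) (at 0)" by (auto intro!: derivative_eq_intros)
          from DERIV_chain2[OF 1 2] show ?thesis by (simp add: mult.commute)
        qed
        show "isCont (\<lambda>y. \<delta> * partial i f y) x"
          using fc(2) V(1) x \<epsilon>(2) by (intro continuous_intros) (auto simp: continuous_on_eq_continuous_at)
      qed (rule der[OF x])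
      moreover have "(x1 - p) + \<delta> *\<^sub>R e = x2 - p" by (simp add: x2_def)
      ultimately show ?thesis using der[OF x, of x2] DERIV_unique by metis
    qed
    obtain \<eta>1 where \<eta>1: "\<eta>1 > 0" "(\<integral>\<^sup>+x. ennreal (cmod (L x1 x / F (cvec x))) * indicator (ball p \<eta>1) x \<partial>lborel) < \<infinity>"
      using logd[OF x1] unfolding L_def by blast
    obtain \<eta>2 where \<eta>2: "\<eta>2 > 0" "(\<integral>\<^sup>+x. ennreal (cmod (L x2 x / F (cvec x))) * indicator (ball p \<eta>2) x \<partial>lborel) < \<infinity>"
      using logd[OF x2] unfolding L_def by blast
    define r where "r = min \<epsilon> (min \<eta>1 \<eta>2)"
    have r: "r > 0" "r \<le> \<epsilon>" "r \<le> \<eta>1" "r \<le> \<eta>2" using \<epsilon> \<eta>1 \<eta>2 by (auto simp: r_def)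
    have pt: "\<bar>partial i f x / f x\<bar> \<le> 1 / \<delta> * (cmod (L x1 x / F (cvec x)) + cmod (L x2 x / F (cvec x)))" if x: "x \<in> ball p \<epsilon>" for x
    proof -
      have "partial i f x = (Re (L x2 x) - Re (L x1 x)) / \<delta>" using part[OF x] \<delta> by simp
      hence "\<bar>partial i f x\<bar> = \<bar>Re (L x2 x) - Re (L x1 x)\<bar> / \<delta>" using \<delta> by simp
      also have "\<dots> \<le> (cmod (L x1 x) + cmod (L x2 x)) / \<delta>"
        using abs_Re_le_cmod[of "L x1 x"] abs_Re_le_cmod[of "L x2 x"] \<delta> by (intro divide_right_mono) auto
      finally have "\<bar>partial i f x\<bar> / \<bar>f x\<bar> \<le> (cmod (L x1 x) + cmod (L x2 x)) / \<delta> / \<bar>f x\<bar>"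
        by (intro divide_right_mono) auto
      also have "\<dots> = 1 / \<delta> * (cmod (L x1 x / F (cvec x)) + cmod (L x2 x / F (cvec x)))"
        using Fr[OF x] by (simp add: norm_divide add_divide_distrib mult.commute)
      finally show ?thesis by simp
    qed
    have meas: "(\<lambda>x. ennreal (cmod (L y x / F (cvec x))) * indicator (ball p r) x) \<in> borel_measurable lborel" for y
    proof -
      have 1: "(\<lambda>x. if x \<in> ball p r then cmod (L y x) else 0) \<in> borel_measurable borel"
      proof (rule borel_measurable_continuous_on_if)
        show "continuous_on (ball p r) (\<lambda>x. cmod (L y x))" unfolding L_def
          by (intro continuous_intros continuous_on_compose2[OF line_holomorphic_on_continuous[OF line_holomorphic_on_line_deriv[OF F]]])
             (use r in auto)
      qed auto
      have 2: "(\<lambda>x. if x \<in> ball p r then cmod (F (cvec x)) else 0) \<in> borel_measurable borel"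
      proof (rule borel_measurable_continuous_on_if)
        show "continuous_on (ball p r) (\<lambda>x. cmod (F (cvec x)))"
          by (intro continuous_intros continuous_on_compose2[OF line_holomorphic_on_continuous[OF F]]) (use r in auto)
      qed auto
      have "(\<lambda>x. ennreal ((if x \<in> ball p r then cmod (L y x) else 0) / (if x \<in> ball p r then cmod (F (cvec x)) else 0))) \<in> borel_measurable borel"
        using 1 2 by measurable
      also have "(\<lambda>x. ennreal ((if x \<in> ball p r then cmod (L y x) else 0) / (if x \<in> ball p r then cmod (F (cvec x)) else 0))) =
          (\<lambda>x. ennreal (cmod (L y x / F (cvec x))) * indicator (ball p r) x)"
        by (auto simp: fun_eq_iff norm_divide)
      finally show ?thesis by simp
    qed
    have le: "(\<integral>\<^sup>+x. ennreal (cmod (L y x / F (cvec x))) * indicator (ball p r) x \<partial>lborel) \<le>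
        (\<integral>\<^sup>+x. ennreal (cmod (L y x / F (cvec x))) * indicator (ball p \<eta>') x \<partial>lborel)" if "r \<le> \<eta>'" for y \<eta>'
      by (intro nn_integral_mono mult_left_mono) (use that in \<open>auto simp: indicator_def\<close>)
    have "(\<integral>\<^sup>+x. ennreal \<bar>partial i f x / f x\<bar> * indicator (ball p r) x \<partial>lborel) \<le>
       (\<integral>\<^sup>+x. ennreal (1 / \<delta>) * (ennreal (cmod (L x1 x / F (cvec x))) * indicator (ball p r) x + ennreal (cmod (L x2 x / F (cvec x))) * indicator (ball p r) x) \<partial>lborel)"
    proof (rule nn_integral_mono)
      fix x
      show "ennreal \<bar>partial i f x / f x\<bar> * indicator (ball p r) x \<le>
        ennreal (1 / \<delta>) * (ennreal (cmod (L x1 x / F (cvec x))) * indicator (ball p r) x + ennreal (cmod (L x2 x / F (cvec x))) * indicator (ball p r) x)"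
      proof (cases "x \<in> ball p r")
        case True
        hence "ennreal \<bar>partial i f x / f x\<bar> \<le> ennreal (1 / \<delta> * (cmod (L x1 x / F (cvec x)) + cmod (L x2 x / F (cvec x))))"
          using r by (intro ennreal_leI pt) auto
        also have "\<dots> = ennreal (1 / \<delta>) * (ennreal (cmod (L x1 x / F (cvec x))) + ennreal (cmod (L x2 x / F (cvec x))))"
          using \<delta>(1) by (subst ennreal_mult) (auto simp: ennreal_plus)
        finally show ?thesis using True by simp
      qed simp
    qed
    also have "\<dots> = ennreal (1 / \<delta>) * ((\<integral>\<^sup>+x. ennreal (cmod (L x1 x / F (cvec x))) * indicator (ball p r) x \<partial>lborel) +
        (\<integral>\<^sup>+x. ennreal (cmod (L x2 x / F (cvec x))) * indicator (ball p r) x \<partial>lborel))"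
      using meas by (subst nn_integral_cmult) (auto simp: nn_integral_add)
    also have "\<dots> < \<infinity>"
      using le_less_trans[OF le[OF r(3)] \<eta>1(2)] le_less_trans[OF le[OF r(4)] \<eta>2(2)] by (auto simp: ennreal_mult_less_top)
    finally show ?thesis using r(1) by blast
  qed
qed

subsection \<open>The weak gradient\<close>

lemma continuous_compact_support_bounded:
  fixes w :: "'a::euclidean_space \<Rightarrow> real"
  assumes "compact K" "continuous_on UNIV w" "\<And>x. x \<notin> K \<Longrightarrow> w x = 0"
  shows "\<exists>M\<ge>0. \<forall>x. \<bar>w x\<bar> \<le> M"
proof -
  have "bounded (w ` K)"
    by (intro compact_imp_bounded compact_continuous_image continuous_on_subset[OF assms(2)] assms(1)) auto
  then obtain M where M: "M > 0" "\<And>x. x \<in> K \<Longrightarrow> \<bar>w x\<bar> \<le> M"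
    unfolding bounded_pos by auto
  have "\<bar>w x\<bar> \<le> M" for x using M assms(3)[of x] by (cases "x \<in> K") auto
  thus ?thesis using M(1) by (intro exI[of _ M]) auto
qed

lemma continuous_compact_support_integrable:
  fixes w :: "'a::euclidean_space \<Rightarrow> real"
  assumes "compact K" "continuous_on UNIV w" "\<And>x. x \<notin> K \<Longrightarrow> w x = 0"
  shows "integrable lborel w"
proof -
  have "integrable lborel (\<lambda>x. indicator K x *\<^sub>R w x)"
    by (rule borel_integrable_compact[OF assms(1) continuous_on_subset[OF assms(2)]]) auto
  also have "(\<lambda>x. indicator K x *\<^sub>R w x) = w"
    using assms(3) by (force simp: fun_eq_iff indicator_def)
  finally show ?thesis .
qed

lemma lborel_integral_translate:
  fixes w :: "'a::euclidean_space \<Rightarrow> real"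
  assumes "integrable lborel w"
  shows "integrable lborel (\<lambda>x. w (x + a))" "(\<integral>x. w (x + a) \<partial>lborel) = (\<integral>x. w x \<partial>lborel)"
proof -
  have [measurable]: "w \<in> borel_measurable borel" using assms by (simp add: borel_measurable_integrable)
  have "integrable (distr lborel borel ((+) a)) w" using assms by (simp add: lborel_distr_plus)
  thus "integrable lborel (\<lambda>x. w (x + a))"
    by (subst (asm) integrable_distr_eq) (auto simp: add.commute)
  have "(\<integral>x. w x \<partial>lborel) = (\<integral>x. w x \<partial>(distr lborel borel ((+) a)))" by (simp add: lborel_distr_plus)
  also have "\<dots> = (\<integral>x. w (a + x) \<partial>lborel)" by (rule integral_distr) auto
  finally show "(\<integral>x. w (x + a) \<partial>lborel) = (\<integral>x. w x \<partial>lborel)" by (simp add: add.commute)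
qed

text \<open>Difference quotients integrate to 0 by translation invariance, and dominated convergence
  passes to the derivative. This takes the place of Fubini with the fundamental theorem of calculus
  along \<open>e\<close>.\<close>

lemma integral_line_derivative_zero:
  fixes w dw :: "'a::euclidean_space \<Rightarrow> real"
  assumes K: "compact K" and w: "continuous_on UNIV w" "\<And>x. x \<notin> K \<Longrightarrow> w x = 0"
    and dw: "continuous_on UNIV dw" "\<And>x. x \<notin> K \<Longrightarrow> dw x = 0"
    and der: "\<And>x. ((\<lambda>s. w (x + s *\<^sub>R e)) has_real_derivative dw x) (at 0)"
  shows "(\<integral>x. dw x \<partial>lborel) = 0"
proof -
  obtain M where M: "M \<ge> 0" "\<And>x. \<bar>dw x\<bar> \<le> M" using continuous_compact_support_bounded[OF K dw] by blast
  obtain B where B: "\<And>x. x \<in> K \<Longrightarrow> norm x \<le> B" using compact_imp_bounded[OF K] unfolding bounded_iff by blast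
  define h where "h = (\<lambda>k. inverse (real (Suc k)))"
  have h: "h k > 0" "h k \<le> 1" for k by (auto simp: h_def field_simps)
  define q where "q k x = (w (x + h k *\<^sub>R e) - w x) / h k" for k x
  have iw: "integrable lborel w" by (rule continuous_compact_support_integrable[OF K w])
  note tr = lborel_integral_translate[OF iw]
  have q0: "(\<integral>x. q k x \<partial>lborel) = 0" for k
    unfolding q_def using tr[of "h k *\<^sub>R e"] iw by simp
  \<comment> \<open>By the mean value theorem a quotient is a value of \<open>dw\<close> at distance
    at most \<open>norm e\<close>, because the step \<open>h k\<close> is at most 1; so one ball
    supports all quotients.\<close>
  have bound: "\<bar>q k x\<bar> \<le> M * indicator (cball 0 (B + norm e)) x" for k x
  proof -
    have "((\<lambda>s. w (x + s *\<^sub>R e)) has_real_derivative dw (x + s *\<^sub>R e)) (at s)" for s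
      by (rule line_derivative_at[OF der])
    from MVT2[of 0 "h k" "\<lambda>s. w (x + s *\<^sub>R e)" "\<lambda>s. dw (x + s *\<^sub>R e)"] this h(1)[of k]
    obtain s where s: "0 < s" "s < h k" "w (x + h k *\<^sub>R e) - w (x + 0 *\<^sub>R e) = (h k - 0) * dw (x + s *\<^sub>R e)" by blast
    hence qe: "q k x = dw (x + s *\<^sub>R e)" using h(1)[of k] by (simp add: q_def)
    show ?thesis
    proof (cases "x \<in> cball 0 (B + norm e)")
      case True
      thus ?thesis using M(2) qe by simp
    next
      case False
      have "norm x \<le> norm (x + s *\<^sub>R e) + norm (s *\<^sub>R e)"
        using norm_triangle_ineq4[of "x + s *\<^sub>R e" "s *\<^sub>R e"] by simp
      also have "norm (s *\<^sub>R e) \<le> norm e" using s h(2)[of k] by (simp add: mult_left_le_one_le)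
      finally have "norm (x + s *\<^sub>R e) > B" using False by simp
      hence "x + s *\<^sub>R e \<notin> K" using B[of "x + s *\<^sub>R e"] by auto
      thus ?thesis using qe dw(2) M(1) by simp
    qed
  qed
  have "(\<lambda>k. \<integral>x. q k x \<partial>lborel) \<longlonglongrightarrow> (\<integral>x. dw x \<partial>lborel)"
  proof (rule integral_dominated_convergence)
    have [measurable]: "w \<in> borel_measurable borel" "dw \<in> borel_measurable borel"
      using w(1) dw(1) by (auto intro: borel_measurable_continuous_onI)
    show "dw \<in> borel_measurable lborel" "\<And>k. q k \<in> borel_measurable lborel"
      unfolding q_def by measurable
    show "integrable lborel (\<lambda>x. M * indicator (cball (0::'a) (B + norm e)) x)"
      using emeasure_lborel_cball_finite[of "0::'a" "B + norm e"] by (intro integrable_mult_right) (simp add: integrable_indicator_iff)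
    show "AE x in lborel. norm (q k x) \<le> M * indicator (cball 0 (B + norm e)) x" for k
      using bound by simp
    have "filterlim h (at 0) sequentially"
      unfolding filterlim_at using LIMSEQ_inverse_real_of_nat h(1) by (auto simp: h_def simp del: of_nat_Suc)
    moreover have "((\<lambda>s. (w (x + s *\<^sub>R e) - w x) / s) \<longlongrightarrow> dw x) (at 0)" for x
      using der[of x] by (simp add: DERIV_def)
    ultimately show "AE x in lborel. (\<lambda>k. q k x) \<longlonglongrightarrow> dw x"
      unfolding q_def by (intro AE_I2) (rule filterlim_compose)
  qed
  thus ?thesis by (simp add: q0 LIMSEQ_const_iff)
qed

section \<open>From local to global by compactness\<close>

lemma finite_ball_cover:
  fixes K :: "'a::metric_space set"
  assumes "compact K" "\<And>p. p \<in> K \<Longrightarrow> r p > 0"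
  obtains C where "finite C" "C \<subseteq> K" "K \<subseteq> (\<Union>p\<in>C. ball p (r p))"
proof -
  have "K \<subseteq> (\<Union>p\<in>K. ball p (r p))" using assms(2) by force
  from compactE_image[OF assms(1) _ this] obtain C where "C \<subseteq> K" "finite C" "K \<subseteq> (\<Union>p\<in>C. ball p (r p))"
    by auto
  thus ?thesis using that by blast
qed

text \<open>In the application \<open>h\<close> is arbitrary outside \<open>V\<close>, which
  explains the indicator of \<open>V\<close> in the measurability hypothesis.\<close>

lemma nn_integral_finite_of_local:
  fixes h :: "'a::euclidean_space \<Rightarrow> ennreal"
  assumes K: "compact K" "U \<subseteq> K" "K \<subseteq> V" and V: "open V"
    and h: "(\<lambda>x. h x * indicator V x) \<in> borel_measurable borel"
    and loc: "\<And>p. p \<in> K \<Longrightarrow> \<exists>r>0. (\<integral>\<^sup>+x. h x * indicator (ball p r) x \<partial>lborel) < \<infinity>"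
  shows "(\<integral>\<^sup>+x. h x * indicator U x \<partial>lborel) < \<infinity>"
proof -
  obtain r where r: "\<And>p. p \<in> K \<Longrightarrow> r p > 0" "\<And>p. p \<in> K \<Longrightarrow> (\<integral>\<^sup>+x. h x * indicator (ball p (r p)) x \<partial>lborel) < \<infinity>"
  proof -
    have "\<forall>p\<in>K. \<exists>r. r > 0 \<and> (\<integral>\<^sup>+x. h x * indicator (ball p r) x \<partial>lborel) < \<infinity>" using loc by blast
    from bchoice[OF this] show ?thesis using that by blast
  qed
  obtain C where C: "finite C" "C \<subseteq> K" "K \<subseteq> (\<Union>p\<in>C. ball p (r p))"
    by (rule finite_ball_cover[OF K(1) r(1)])
  have "(\<integral>\<^sup>+x. h x * indicator U x \<partial>lborel) \<le> (\<integral>\<^sup>+x. (\<Sum>p\<in>C. (h x * indicator V x) * indicator (ball p (r p)) x) \<partial>lborel)"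
  proof (rule nn_integral_mono)
    fix x
    show "h x * indicator U x \<le> (\<Sum>p\<in>C. (h x * indicator V x) * indicator (ball p (r p)) x)"
    proof (cases "x \<in> U")
      case True
      then obtain p where p: "p \<in> C" "x \<in> ball p (r p)" "x \<in> V" using K C(3) by blast
      have "h x * indicator U x = (h x * indicator V x) * indicator (ball p (r p)) x" using True p by simp
      also have "\<dots> \<le> (\<Sum>p\<in>C. (h x * indicator V x) * indicator (ball p (r p)) x)"
        using p(1) C(1) by (intro member_le_sum) auto
      finally show ?thesis .
    qed simp
  qed
  also have "\<dots> = (\<Sum>p\<in>C. \<integral>\<^sup>+x. (h x * indicator V x) * indicator (ball p (r p)) x \<partial>lborel)"
    by (rule nn_integral_sum) (use h in \<open>auto intro!: borel_measurable_times_ennreal borel_measurable_indicator\<close>)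
  also have "\<dots> \<le> (\<Sum>p\<in>C. \<integral>\<^sup>+x. h x * indicator (ball p (r p)) x \<partial>lborel)"
    by (intro sum_mono nn_integral_mono) (auto simp: indicator_def)
  also have "\<dots> < \<infinity>" using r(2) C by (auto simp: ennreal_sum_less_top subset_iff)
  finally show ?thesis .
qed

lemma AE_of_local:
  fixes K :: "'a::euclidean_space set"
  assumes K: "compact K" and loc: "\<And>p. p \<in> K \<Longrightarrow> \<exists>r>0. AE x in lborel. x \<in> ball p r \<longrightarrow> Q x"
  shows "AE x in lborel. x \<in> K \<longrightarrow> Q x"
proof -
  obtain r where r: "\<And>p. p \<in> K \<Longrightarrow> r p > 0" "\<And>p. p \<in> K \<Longrightarrow> AE x in lborel. x \<in> ball p (r p) \<longrightarrow> Q x"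
  proof -
    have "\<forall>p\<in>K. \<exists>r. r > 0 \<and> (AE x in lborel. x \<in> ball p r \<longrightarrow> Q x)" using loc by blast
    from bchoice[OF this] show ?thesis using that by blast
  qed
  obtain C where C: "finite C" "C \<subseteq> K" "K \<subseteq> (\<Union>p\<in>C. ball p (r p))"
    by (rule finite_ball_cover[OF K(1) r(1)])
  have "AE x in lborel. \<forall>p\<in>C. x \<in> ball p (r p) \<longrightarrow> Q x"
    using C r(2) by (intro AE_finite_allI) auto
  thus ?thesis by eventually_elim (use C(3) in blast)
qed

lemma test_function_line_derivative:
  fixes \<phi> :: "real^'n \<Rightarrow> real"
  assumes "test_function U \<phi>"
  shows "continuous_on UNIV \<phi>" "continuous_on UNIV (\<lambda>x. frechet_derivative \<phi> (at x) (axis i 1))"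
    "\<And>x. ((\<lambda>s. \<phi> (x + s *\<^sub>R axis i 1)) has_real_derivative frechet_derivative \<phi> (at x) (axis i 1)) (at 0)"
proof -
  have Ck: "Ck_on k UNIV \<phi>" for k using assms by (simp add: test_function_def)
  show "continuous_on UNIV \<phi>" using Ck[of 0] by simp
  show "continuous_on UNIV (\<lambda>x. frechet_derivative \<phi> (at x) (axis i 1))" using Ck[of "Suc 0"] by simp
  fix x
  have "\<phi> differentiable (at x)" using Ck[of "Suc 0"] by simp
  hence d: "(\<phi> has_derivative frechet_derivative \<phi> (at x)) (at x)" by (simp add: frechet_derivative_works)
  have "((\<lambda>s::real. x + s *\<^sub>R axis i 1) has_derivative (\<lambda>s. s *\<^sub>R axis i 1)) (at 0)"
    by (auto intro!: derivative_eq_intros)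
  from has_derivative_compose[OF this, of \<phi> "frechet_derivative \<phi> (at x)"] d
  have "((\<lambda>s. \<phi> (x + s *\<^sub>R axis i 1)) has_derivative (\<lambda>s. frechet_derivative \<phi> (at x) (s *\<^sub>R axis i 1))) (at 0)" by simp
  moreover have "frechet_derivative \<phi> (at x) (s *\<^sub>R axis i 1) = frechet_derivative \<phi> (at x) (axis i 1) * s" for s
    using linear_scale[OF has_derivative_linear[OF d], of s "axis i 1"] by simp
  ultimately show "((\<lambda>s. \<phi> (x + s *\<^sub>R axis i 1)) has_real_derivative frechet_derivative \<phi> (at x) (axis i 1)) (at 0)"
    by (simp add: has_field_derivative_def)
qed

text \<open>Adding \<open>\<epsilon>\<close> removes the singularity, so the regularized logarithm
  times \<open>\<phi>\<close> has compact support and a continuous derivative along the axis, which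
  integrates to 0. The halving reflects \<open>ln \<bar>f x\<bar> = ln ((f x)\<^sup>2) / 2\<close>
  for \<open>f x \<noteq> 0\<close>.\<close>

lemma regularized_integration_by_parts:
  fixes f \<phi> :: "real^'n \<Rightarrow> real" and i :: 'n
  assumes f: "real_analytic_on f V" and V: "open V" and UV: "U \<subseteq> V" and \<phi>: "test_function U \<phi>" and \<epsilon>: "\<epsilon> > 0"
  defines "d\<phi> \<equiv> \<lambda>x. frechet_derivative \<phi> (at x) (axis i 1)"
  shows "(\<integral>x. ln ((f x)\<^sup>2 + \<epsilon>) / 2 * d\<phi> x \<partial>lborel) = - (\<integral>x. f x * partial i f x / ((f x)\<^sup>2 + \<epsilon>) * \<phi> x \<partial>lborel)"
    and "\<And>x. x \<notin> U \<Longrightarrow> \<phi> x = 0 \<and> d\<phi> x = 0"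
    and "\<exists>M\<ge>0. \<forall>x. \<bar>\<phi> x\<bar> \<le> M \<and> \<bar>d\<phi> x\<bar> \<le> M"
proof -
  note fc = real_analytic_partial(1)[OF f V] real_analytic_partial(2,3)[OF f V, where i = i]
  have \<phi>c: "continuous_on UNIV \<phi>" "continuous_on UNIV d\<phi>"
    "\<And>x. ((\<lambda>s. \<phi> (x + s *\<^sub>R axis i 1)) has_real_derivative d\<phi> x) (at 0)"
    unfolding d\<phi>_def by (rule test_function_line_derivative[OF \<phi>])+
  define K where "K = closure {x. \<phi> x \<noteq> 0}"
  have K: "compact K" "K \<subseteq> U" using \<phi> by (auto simp: test_function_def K_def)
  have \<phi>0: "\<phi> x = 0" if "x \<notin> K" for x using that closure_subset[of "{x. \<phi> x \<noteq> 0}"] by (auto simp: K_def)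
  have opK: "open (- K)" using K(1) compact_imp_closed by blast
  \<comment> \<open>The complement of \<open>K\<close> is open, so a short segment from
    \<open>x\<close> stays where \<open>u\<close> vanishes.\<close>
  have ev0: "((\<lambda>s. u (x + s *\<^sub>R axis i 1)) has_real_derivative 0) (at 0)"
    if "x \<notin> K" "\<And>y. y \<notin> K \<Longrightarrow> u y = 0" for u :: "real^'n \<Rightarrow> real" and x
  proof -
    have "open ((\<lambda>s::real. x + s *\<^sub>R axis i 1) -` (- K))"
      by (intro open_vimage opK continuous_intros)
    thus ?thesis
      by (rule has_field_derivative_transform_within_open[OF DERIV_const[of 0]]) (use that in auto)
  qed
  have d\<phi>0: "d\<phi> x = 0" if "x \<notin> K" for x
    using DERIV_unique[OF \<phi>c(3) ev0[of x \<phi>]] that \<phi>0 by auto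
  show "\<And>x. x \<notin> U \<Longrightarrow> \<phi> x = 0 \<and> d\<phi> x = 0" using \<phi>0 d\<phi>0 K by blast
  obtain M1 where M1: "M1 \<ge> 0" "\<And>x. \<bar>\<phi> x\<bar> \<le> M1"
    using continuous_compact_support_bounded[OF K(1) \<phi>c(1) \<phi>0] by blast
  obtain M2 where M2: "M2 \<ge> 0" "\<And>x. \<bar>d\<phi> x\<bar> \<le> M2"
    using continuous_compact_support_bounded[OF K(1) \<phi>c(2) d\<phi>0] by blast
  show "\<exists>M\<ge>0. \<forall>x. \<bar>\<phi> x\<bar> \<le> M \<and> \<bar>d\<phi> x\<bar> \<le> M"
    using M1 M2 by (intro exI[of _ "max M1 M2"]) (auto simp: le_max_iff_disj)
  define u where "u x = ln ((f x)\<^sup>2 + \<epsilon>) / 2" for x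
  define du where "du x = f x * partial i f x / ((f x)\<^sup>2 + \<epsilon>)" for x
  have pos: "(f x)\<^sup>2 + \<epsilon> > 0" for x using \<epsilon> by (simp add: add_nonneg_pos)
  have KV: "V \<union> (- K) = UNIV" using K UV by auto
  \<comment> \<open>\<open>f\<close> is arbitrary outside \<open>V\<close>, so continuity is glued
    from \<open>V\<close> and the complement of \<open>K\<close>, where the second factor is
    0.\<close>
  have ext: "continuous_on UNIV (\<lambda>x. a x * b x)"
    if "continuous_on V a" "continuous_on UNIV b" "\<And>x. x \<notin> K \<Longrightarrow> b x = 0" for a b :: "real^'n \<Rightarrow> real"
  proof -
    have "continuous_on V (\<lambda>x. a x * b x)"
      by (intro continuous_intros that(1) continuous_on_subset[OF that(2)]) auto
    moreover have "continuous_on (- K) (\<lambda>x. a x * b x)"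
      by (rule continuous_on_eq[OF continuous_on_const[of _ 0]]) (use that(3) in auto)
    ultimately show ?thesis using continuous_on_open_Un[OF V opK] KV by metis
  qed
  have uc: "continuous_on V u" unfolding u_def
    by (intro continuous_intros fc(1)) (use pos in \<open>auto simp: less_imp_neq[symmetric]\<close>)
  have duc: "continuous_on V du" unfolding du_def
    by (intro continuous_intros fc(1,2)) (use pos in \<open>auto simp: less_imp_neq[symmetric]\<close>)
  have c1: "continuous_on UNIV (\<lambda>x. u x * \<phi> x)" by (rule ext[OF uc \<phi>c(1) \<phi>0])
  have c2: "continuous_on UNIV (\<lambda>x. u x * d\<phi> x)" by (rule ext[OF uc \<phi>c(2) d\<phi>0])
  have c3: "continuous_on UNIV (\<lambda>x. du x * \<phi> x)" by (rule ext[OF duc \<phi>c(1) \<phi>0])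
  have i2: "integrable lborel (\<lambda>x. u x * d\<phi> x)"
    by (rule continuous_compact_support_integrable[OF K(1) c2]) (simp add: d\<phi>0)
  have i3: "integrable lborel (\<lambda>x. du x * \<phi> x)"
    by (rule continuous_compact_support_integrable[OF K(1) c3]) (simp add: \<phi>0)
  have "(\<integral>x. du x * \<phi> x + u x * d\<phi> x \<partial>lborel) = 0"
  proof (rule integral_line_derivative_zero[OF K(1) c1])
    fix x
    show "((\<lambda>s. u (x + s *\<^sub>R axis i 1) * \<phi> (x + s *\<^sub>R axis i 1)) has_real_derivative du x * \<phi> x + u x * d\<phi> x) (at 0)"
    proof (cases "x \<in> K")
      case True
      hence xV: "x \<in> V" using K UV by auto
      have "((\<lambda>s. u (x + s *\<^sub>R axis i 1)) has_real_derivative du x) (at 0)"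
        unfolding u_def du_def using pos[of x]
        by (auto intro!: derivative_eq_intros fc(3)[OF xV] simp: field_simps)
      from DERIV_mult[OF this \<phi>c(3)[of x]] show ?thesis by (simp add: algebra_simps)
    next
      case False
      thus ?thesis using ev0[of x "\<lambda>y. u y * \<phi> y"] \<phi>0 d\<phi>0 by simp
    qed
  qed (use \<phi>0 d\<phi>0 in \<open>auto intro: continuous_on_add[OF c3 c2]\<close>)
  hence "(\<integral>x. u x * d\<phi> x \<partial>lborel) = - (\<integral>x. du x * \<phi> x \<partial>lborel)"
    using i2 i3 by simp
  thus "(\<integral>x. ln ((f x)\<^sup>2 + \<epsilon>) / 2 * d\<phi> x \<partial>lborel) = - (\<integral>x. f x * partial i f x / ((f x)\<^sup>2 + \<epsilon>) * \<phi> x \<partial>lborel)"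
    by (simp add: u_def du_def)
qed

text \<open>Majorants free of \<open>\<epsilon>\<close>, for dominated convergence: the regularized
  logarithm lies between \<open>ln \<bar>y\<bar>\<close> and half of
  \<open>ln (M\<^sup>2 + 1)\<close>, and the quotient only shrinks when its denominator
  \<open>y\<^sup>2\<close> is enlarged.\<close>

lemma regularized_log_bounds:
  fixes y \<epsilon> M :: real
  assumes "y \<noteq> 0" "0 < \<epsilon>" "\<epsilon> \<le> 1" "\<bar>y\<bar> \<le> M"
  shows "\<bar>ln (y\<^sup>2 + \<epsilon>) / 2\<bar> \<le> \<bar>ln \<bar>y\<bar>\<bar> + ln (M\<^sup>2 + 1)"
    and "\<bar>y * a / (y\<^sup>2 + \<epsilon>)\<bar> \<le> \<bar>a / y\<bar>"
proof -
  have y2: "y\<^sup>2 > 0" using assms by simp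
  have "ln (y\<^sup>2) = 2 * ln \<bar>y\<bar>" using assms by (metis ln_powr powr_realpow of_nat_numeral power2_abs zero_less_abs_iff)
  hence 1: "2 * ln \<bar>y\<bar> \<le> ln (y\<^sup>2 + \<epsilon>)" using y2 assms by (metis less_add_same_cancel1 less_imp_le ln_le_cancel_iff add_pos_pos)
  have "y\<^sup>2 \<le> M\<^sup>2" using assms by (metis abs_ge_zero power2_abs power_mono)
  hence 2: "ln (y\<^sup>2 + \<epsilon>) \<le> ln (M\<^sup>2 + 1)" using y2 assms by (subst ln_le_cancel_iff) (auto simp: add_pos_pos add_nonneg_pos)
  have "ln (M\<^sup>2 + 1) \<ge> 0" by (rule ln_ge_zero) simp
  with 1 2 show "\<bar>ln (y\<^sup>2 + \<epsilon>) / 2\<bar> \<le> \<bar>ln \<bar>y\<bar>\<bar> + ln (M\<^sup>2 + 1)" by linarith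
  have "\<bar>y * a / (y\<^sup>2 + \<epsilon>)\<bar> = \<bar>y * a\<bar> / (y\<^sup>2 + \<epsilon>)" using y2 assms by simp
  also have "\<dots> \<le> \<bar>y * a\<bar> / y\<^sup>2" using y2 assms by (intro divide_left_mono mult_pos_pos) (auto simp: add_nonneg_pos)
  also have "\<dots> = \<bar>a / y\<bar>" using assms by (cases "y > 0") (auto simp: abs_mult power2_eq_square field_simps)
  finally show "\<bar>y * a / (y\<^sup>2 + \<epsilon>)\<bar> \<le> \<bar>a / y\<bar>" .
qed

theorem theorem1p2:
  fixes U V :: "(real^'n) set" and f :: "real^'n \<Rightarrow> real"
  assumes "CARD('n) \<ge> 2"
    and "bounded U" and "open U"
    and "open V" and "closure U \<subseteq> V"
    and "real_analytic_on f V"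
    and "\<forall>p\<in>{x\<in>V. f x = 0} \<inter> closure U. analytic_codim_at {x\<in>V. f x = 0} p \<ge> 2"
  shows "(\<lambda>x. ln \<bar>f x\<bar>) \<in> W11 U"
proof -
  note V = \<open>open V\<close> and f = \<open>real_analytic_on f V\<close>
  define K where "K = closure U"
  have K: "compact K" "U \<subseteq> K" "K \<subseteq> V" "U \<subseteq> V"
    using assms closure_subset[of U] by (auto simp: K_def compact_closure)
  have [measurable]: "U \<in> sets borel" "V \<in> sets borel" using assms by auto
  have loc1: "\<exists>r>0. (AE x in lborel. x \<in> ball p r \<longrightarrow> f x \<noteq> 0) \<and>
     (\<integral>\<^sup>+x. ennreal \<bar>ln \<bar>f x\<bar>\<bar> * indicator (ball p r) x \<partial>lborel) < \<infinity>"
    and loc2: "\<exists>r>0. (\<integral>\<^sup>+x. ennreal \<bar>partial i f x / f x\<bar> * indicator (ball p r) x \<partial>lborel) < \<infinity>"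
    if p: "p \<in> K" for p i
  proof -
    have pV: "p \<in> V" using p K by auto
    have "analytic_codim_at {x\<in>V. f x = 0} p \<ge> 2" if "f p = 0"
      using assms(7) that p pV by (simp add: K_def)
    thus "\<exists>r>0. (AE x in lborel. x \<in> ball p r \<longrightarrow> f x \<noteq> 0) \<and>
     (\<integral>\<^sup>+x. ennreal \<bar>ln \<bar>f x\<bar>\<bar> * indicator (ball p r) x \<partial>lborel) < \<infinity>"
      "\<exists>r>0. (\<integral>\<^sup>+x. ennreal \<bar>partial i f x / f x\<bar> * indicator (ball p r) x \<partial>lborel) < \<infinity>"
      using nonvanishing_local_integrability[OF f V pV] vanishing_local_integrability[OF f V pV] by (cases "f p = 0"; blast)+
  qed
  have AE0: "AE x in lborel. x \<in> U \<longrightarrow> f x \<noteq> 0"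
  proof -
    have "AE x in lborel. x \<in> K \<longrightarrow> f x \<noteq> 0" by (rule AE_of_local[OF K(1)]) (use loc1 in blast)
    thus ?thesis by eventually_elim (use K(2) in blast)
  qed
  \<comment> \<open>\<open>f\<close> is arbitrary outside \<open>V\<close>, so measurability is
    shown for cut-off functions and transferred to products in which the cutoff is
    invisible.\<close>
  have fm [measurable]: "(\<lambda>x. if x \<in> V then f x else 0) \<in> borel_measurable borel"
    by (rule borel_measurable_continuous_on_if) (use real_analytic_partial(1)[OF f V] in auto)
  have pm [measurable]: "(\<lambda>x. if x \<in> V then partial i f x else 0) \<in> borel_measurable borel" for i
    by (rule borel_measurable_continuous_on_if) (use real_analytic_partial(2)[OF f V] in auto)
  have mV1: "(\<lambda>x. ennreal \<bar>ln \<bar>f x\<bar>\<bar> * indicator V x) \<in> borel_measurable borel"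
  proof -
    have "(\<lambda>x. ennreal \<bar>ln \<bar>if x \<in> V then f x else 0\<bar>\<bar> * indicator V x) \<in> borel_measurable borel" by measurable
    also have "(\<lambda>x. ennreal \<bar>ln \<bar>if x \<in> V then f x else 0\<bar>\<bar> * indicator V x) = (\<lambda>x. ennreal \<bar>ln \<bar>f x\<bar>\<bar> * indicator V x)"
      by (auto simp: fun_eq_iff indicator_def)
    finally show ?thesis .
  qed
  have mV2: "(\<lambda>x. ennreal \<bar>partial i f x / f x\<bar> * indicator V x) \<in> borel_measurable borel" for i
  proof -
    have "(\<lambda>x. ennreal \<bar>(if x \<in> V then partial i f x else 0) / (if x \<in> V then f x else 0)\<bar> * indicator V x) \<in> borel_measurable borel" by measurable
    also have "(\<lambda>x. ennreal \<bar>(if x \<in> V then partial i f x else 0) / (if x \<in> V then f x else 0)\<bar> * indicator V x) =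
        (\<lambda>x. ennreal \<bar>partial i f x / f x\<bar> * indicator V x)"
      by (auto simp: fun_eq_iff indicator_def)
    finally show ?thesis .
  qed
  have mU1: "(\<lambda>x. indicator U x * ln \<bar>f x\<bar>) \<in> borel_measurable borel"
  proof -
    have "(\<lambda>x. indicator U x * ln \<bar>if x \<in> V then f x else 0\<bar>) \<in> borel_measurable borel" by measurable
    also have "(\<lambda>x. indicator U x * ln \<bar>if x \<in> V then f x else 0\<bar>) = (\<lambda>x. indicator U x * ln \<bar>f x\<bar>)"
      using K(4) by (auto simp: fun_eq_iff indicator_def)
    finally show ?thesis .
  qed
  have mU2: "(\<lambda>x. indicator U x * (partial i f x / f x)) \<in> borel_measurable borel" for i
  proof -
    have "(\<lambda>x. indicator U x * ((if x \<in> V then partial i f x else 0) / (if x \<in> V then f x else 0))) \<in> borel_measurable borel" by measurable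
    also have "(\<lambda>x. indicator U x * ((if x \<in> V then partial i f x else 0) / (if x \<in> V then f x else 0))) =
        (\<lambda>x. indicator U x * (partial i f x / f x))"
      using K(4) by (auto simp: fun_eq_iff indicator_def)
    finally show ?thesis .
  qed
  have int1: "integrable lborel (\<lambda>x. indicator U x * ln \<bar>f x\<bar>)"
    unfolding integrable_iff_bounded
  proof
    have "(\<integral>\<^sup>+x. ennreal \<bar>ln \<bar>f x\<bar>\<bar> * indicator U x \<partial>lborel) < \<infinity>"
      by (rule nn_integral_finite_of_local[OF K(1-3) V mV1]) (use loc1 in blast)
    also have "(\<integral>\<^sup>+x. ennreal \<bar>ln \<bar>f x\<bar>\<bar> * indicator U x \<partial>lborel) = (\<integral>\<^sup>+x. ennreal (norm (indicator U x * ln \<bar>f x\<bar>)) \<partial>lborel)"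
      by (intro nn_integral_cong) (auto simp: indicator_def)
    finally show "(\<integral>\<^sup>+x. ennreal (norm (indicator U x * ln \<bar>f x\<bar>)) \<partial>lborel) < \<infinity>" .
  qed (use mU1 in simp)
  have int2: "integrable lborel (\<lambda>x. indicator U x * (partial i f x / f x))" for i
    unfolding integrable_iff_bounded
  proof
    have "(\<integral>\<^sup>+x. ennreal \<bar>partial i f x / f x\<bar> * indicator U x \<partial>lborel) < \<infinity>"
      by (rule nn_integral_finite_of_local[OF K(1-3) V mV2]) (use loc2 in blast)
    also have "(\<integral>\<^sup>+x. ennreal \<bar>partial i f x / f x\<bar> * indicator U x \<partial>lborel) = (\<integral>\<^sup>+x. ennreal (norm (indicator U x * (partial i f x / f x))) \<partial>lborel)"
      by (intro nn_integral_cong) (auto simp: indicator_def)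
    finally show "(\<integral>\<^sup>+x. ennreal (norm (indicator U x * (partial i f x / f x))) \<partial>lborel) < \<infinity>" .
  qed (use mU2 in simp)
  have intU: "integrable lborel (indicator U :: real^'n \<Rightarrow> real)"
    using emeasure_bounded_finite[OF assms(2)] by (simp add: integrable_indicator_iff)
  obtain M where M: "\<And>x. x \<in> U \<Longrightarrow> \<bar>f x\<bar> \<le> M"
  proof -
    have "bounded (f ` K)"
      by (intro compact_imp_bounded compact_continuous_image continuous_on_subset[OF real_analytic_partial(1)[OF f V]] K)
    then obtain M where "\<And>x. x \<in> K \<Longrightarrow> \<bar>f x\<bar> \<le> M" unfolding bounded_iff real_norm_def by blast
    thus ?thesis using that K(2) by blast
  qed
  have weak: "(LINT x:U|lebesgue. ln \<bar>f x\<bar> * frechet_derivative \<phi> (at x) (axis i 1)) =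
      - (LINT x:U|lebesgue. partial i f x / f x * \<phi> x)" if \<phi>: "test_function U \<phi>" for \<phi> i
  proof -
    define d\<phi> where "d\<phi> = (\<lambda>x. frechet_derivative \<phi> (at x) (axis i 1))"
    have \<phi>c: "continuous_on UNIV \<phi>" "continuous_on UNIV d\<phi>"
      unfolding d\<phi>_def by (rule test_function_line_derivative[OF \<phi>])+
    have [measurable]: "\<phi> \<in> borel_measurable borel" "d\<phi> \<in> borel_measurable borel"
      using \<phi>c by (auto intro: borel_measurable_continuous_onI)
    \<comment> \<open>Any null sequence in the interval from 0 to 1 would do; the bound by 1 keeps
      the majorant independent of \<open>k\<close>.\<close>
    define \<epsilon> where "\<epsilon> = (\<lambda>k. inverse (real (Suc k)))"
    have \<epsilon>: "\<epsilon> k > 0" "\<epsilon> k \<le> 1" for k by (auto simp: \<epsilon>_def field_simps)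
    have \<epsilon>0: "\<epsilon> \<longlonglongrightarrow> 0" unfolding \<epsilon>_def by (rule LIMSEQ_inverse_real_of_nat)
    note ibp = regularized_integration_by_parts[OF f V K(4) \<phi>, where i = i]
    have ibp1: "(\<integral>x. ln ((f x)\<^sup>2 + \<epsilon> k) / 2 * d\<phi> x \<partial>lborel) =
        - (\<integral>x. f x * partial i f x / ((f x)\<^sup>2 + \<epsilon> k) * \<phi> x \<partial>lborel)" for k
      unfolding d\<phi>_def by (rule ibp(1)[OF \<epsilon>(1)])
    have out: "\<phi> x = 0" "d\<phi> x = 0" if "x \<notin> U" for x
      using ibp(2)[OF zero_less_one that] by (auto simp: d\<phi>_def)
    obtain B where B: "B \<ge> 0" "\<And>x. \<bar>\<phi> x\<bar> \<le> B" "\<And>x. \<bar>d\<phi> x\<bar> \<le> B"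
      using ibp(3)[OF zero_less_one] unfolding d\<phi>_def by blast
    have fUm [measurable]: "(\<lambda>x. if x \<in> U then f x else 0) \<in> borel_measurable borel"
    proof -
      have "(\<lambda>x. indicator U x * (if x \<in> V then f x else 0)) \<in> borel_measurable borel" by measurable
      also have "(\<lambda>x. indicator U x * (if x \<in> V then f x else 0)) = (\<lambda>x. if x \<in> U then f x else 0)"
        using K(4) by (auto simp: fun_eq_iff indicator_def)
      finally show ?thesis .
    qed
    have s1m: "(\<lambda>x. ln ((f x)\<^sup>2 + \<epsilon> k) / 2 * d\<phi> x) \<in> borel_measurable lborel" for k
    proof -
      have "(\<lambda>x. ln ((if x \<in> U then f x else 0)\<^sup>2 + \<epsilon> k) / 2 * d\<phi> x) \<in> borel_measurable lborel" by measurable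
      also have "(\<lambda>x. ln ((if x \<in> U then f x else 0)\<^sup>2 + \<epsilon> k) / 2 * d\<phi> x) = (\<lambda>x. ln ((f x)\<^sup>2 + \<epsilon> k) / 2 * d\<phi> x)"
        using out by (auto simp: fun_eq_iff)
      finally show ?thesis .
    qed
    have s2m: "(\<lambda>x. f x * partial i f x / ((f x)\<^sup>2 + \<epsilon> k) * \<phi> x) \<in> borel_measurable lborel" for k
    proof -
      have "(\<lambda>x. (if x \<in> V then f x else 0) * (if x \<in> V then partial i f x else 0) / ((if x \<in> V then f x else 0)\<^sup>2 + \<epsilon> k) * \<phi> x) \<in> borel_measurable lborel"
        by measurable
      also have "(\<lambda>x. (if x \<in> V then f x else 0) * (if x \<in> V then partial i f x else 0) / ((if x \<in> V then f x else 0)\<^sup>2 + \<epsilon> k) * \<phi> x) =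
          (\<lambda>x. f x * partial i f x / ((f x)\<^sup>2 + \<epsilon> k) * \<phi> x)"
        using out K(4) by (auto simp: fun_eq_iff)
      finally show ?thesis .
    qed
    have L1m: "(\<lambda>x. (indicator U x * ln \<bar>f x\<bar>) * d\<phi> x) \<in> borel_measurable lborel"
      using mU1 by measurable
    have L2m: "(\<lambda>x. (indicator U x * (partial i f x / f x)) * \<phi> x) \<in> borel_measurable lborel"
      using mU2 by measurable
    have lim1: "(\<lambda>k. \<integral>x. ln ((f x)\<^sup>2 + \<epsilon> k) / 2 * d\<phi> x \<partial>lborel) \<longlonglongrightarrow> (\<integral>x. (indicator U x * ln \<bar>f x\<bar>) * d\<phi> x \<partial>lborel)"
    proof (rule integral_dominated_convergence)
      show "(\<lambda>x. (indicator U x * ln \<bar>f x\<bar>) * d\<phi> x) \<in> borel_measurable lborel"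
        "\<And>k. (\<lambda>x. ln ((f x)\<^sup>2 + \<epsilon> k) / 2 * d\<phi> x) \<in> borel_measurable lborel" by (fact L1m s1m)+
      show "integrable lborel (\<lambda>x. (\<bar>indicator U x * ln \<bar>f x\<bar>\<bar> + ln (M\<^sup>2 + 1) * indicator U x) * B)"
        using int1 intU by (intro integrable_mult_left Bochner_Integration.integrable_add integrable_mult_right integrable_abs)
      show "AE x in lborel. (\<lambda>k. ln ((f x)\<^sup>2 + \<epsilon> k) / 2 * d\<phi> x) \<longlonglongrightarrow> (indicator U x * ln \<bar>f x\<bar>) * d\<phi> x"
        using AE0
      proof eventually_elim
        case (elim x)
        show ?case
        proof (cases "x \<in> U")
          case True
          hence y: "f x \<noteq> 0" using elim by simp
          have "(\<lambda>k. ln ((f x)\<^sup>2 + \<epsilon> k) / 2 * d\<phi> x) \<longlonglongrightarrow> ln ((f x)\<^sup>2 + 0) / 2 * d\<phi> x"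
            using y by (intro tendsto_intros \<epsilon>0) auto
          moreover have "ln ((f x)\<^sup>2) = 2 * ln \<bar>f x\<bar>" using y ln_realpow[of "\<bar>f x\<bar>" 2] by simp
          ultimately show ?thesis using True by simp
        qed (simp add: out)
      qed
      show "AE x in lborel. norm (ln ((f x)\<^sup>2 + \<epsilon> k) / 2 * d\<phi> x) \<le> (\<bar>indicator U x * ln \<bar>f x\<bar>\<bar> + ln (M\<^sup>2 + 1) * indicator U x) * B" for k
        using AE0
      proof eventually_elim
        case (elim x)
        show ?case
        proof (cases "x \<in> U")
          case True
          hence "\<bar>ln ((f x)\<^sup>2 + \<epsilon> k) / 2\<bar> \<le> \<bar>ln \<bar>f x\<bar>\<bar> + ln (M\<^sup>2 + 1)"
            using elim M \<epsilon> by (intro regularized_log_bounds(1)) auto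
          hence "\<bar>ln ((f x)\<^sup>2 + \<epsilon> k) / 2\<bar> * \<bar>d\<phi> x\<bar> \<le> (\<bar>ln \<bar>f x\<bar>\<bar> + ln (M\<^sup>2 + 1)) * B"
            using B by (intro mult_mono) auto
          thus ?thesis using True by (simp add: abs_mult)
        qed (simp add: out)
      qed
    qed
    have lim2: "(\<lambda>k. \<integral>x. f x * partial i f x / ((f x)\<^sup>2 + \<epsilon> k) * \<phi> x \<partial>lborel) \<longlonglongrightarrow> (\<integral>x. (indicator U x * (partial i f x / f x)) * \<phi> x \<partial>lborel)"
    proof (rule integral_dominated_convergence)
      show "(\<lambda>x. (indicator U x * (partial i f x / f x)) * \<phi> x) \<in> borel_measurable lborel"
        "\<And>k. (\<lambda>x. f x * partial i f x / ((f x)\<^sup>2 + \<epsilon> k) * \<phi> x) \<in> borel_measurable lborel" by (fact L2m s2m)+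
      show "integrable lborel (\<lambda>x. \<bar>indicator U x * (partial i f x / f x)\<bar> * B)"
        using int2 by (intro integrable_mult_left integrable_abs)
      show "AE x in lborel. (\<lambda>k. f x * partial i f x / ((f x)\<^sup>2 + \<epsilon> k) * \<phi> x) \<longlonglongrightarrow> (indicator U x * (partial i f x / f x)) * \<phi> x"
        using AE0
      proof eventually_elim
        case (elim x)
        show ?case
        proof (cases "x \<in> U")
          case True
          hence y: "f x \<noteq> 0" using elim by simp
          have "(\<lambda>k. f x * partial i f x / ((f x)\<^sup>2 + \<epsilon> k) * \<phi> x) \<longlonglongrightarrow> f x * partial i f x / ((f x)\<^sup>2 + 0) * \<phi> x"
            using y by (intro tendsto_intros \<epsilon>0) auto
          thus ?thesis using True y by (simp add: power2_eq_square)
        qed (simp add: out)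
      qed
      show "AE x in lborel. norm (f x * partial i f x / ((f x)\<^sup>2 + \<epsilon> k) * \<phi> x) \<le> \<bar>indicator U x * (partial i f x / f x)\<bar> * B" for k
        using AE0
      proof eventually_elim
        case (elim x)
        show ?case
        proof (cases "x \<in> U")
          case True
          hence "\<bar>f x * partial i f x / ((f x)\<^sup>2 + \<epsilon> k)\<bar> \<le> \<bar>partial i f x / f x\<bar>"
            using elim M[OF True] \<epsilon> by (intro regularized_log_bounds(2)[where M = M]) auto
          hence "\<bar>f x * partial i f x / ((f x)\<^sup>2 + \<epsilon> k)\<bar> * \<bar>\<phi> x\<bar> \<le> \<bar>partial i f x / f x\<bar> * B"
            using B by (intro mult_mono) auto
          thus ?thesis using True by (simp add: abs_mult)
        qed (simp add: out)
      qed
    qed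
    have "(\<integral>x. (indicator U x * ln \<bar>f x\<bar>) * d\<phi> x \<partial>lborel) = - (\<integral>x. (indicator U x * (partial i f x / f x)) * \<phi> x \<partial>lborel)"
      using LIMSEQ_unique[OF lim1] tendsto_minus[OF lim2] unfolding ibp1 by blast
    \<comment> \<open>\<open>W11\<close> integrates over the completed measure; for a Borel
      integrand the value agrees with the integral over \<open>lborel\<close>.\<close>
    moreover have "(LINT x:U|lebesgue. ln \<bar>f x\<bar> * d\<phi> x) = (\<integral>x. (indicator U x * ln \<bar>f x\<bar>) * d\<phi> x \<partial>lborel)"
      unfolding set_lebesgue_integral_def
      by (subst integral_completion[symmetric]) (use L1m in \<open>auto simp: mult.assoc\<close>)
    moreover have "(LINT x:U|lebesgue. partial i f x / f x * \<phi> x) = (\<integral>x. (indicator U x * (partial i f x / f x)) * \<phi> x \<partial>lborel)"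
      unfolding set_lebesgue_integral_def
      by (subst integral_completion[symmetric]) (use L2m in \<open>auto simp: mult.assoc\<close>)
    ultimately show ?thesis by (simp add: d\<phi>_def)
  qed
  have set1: "set_integrable lebesgue U (\<lambda>x. ln \<bar>f x\<bar>)"
    unfolding set_integrable_def using int1 mU1 by (simp add: integrable_completion)
  have set2: "set_integrable lebesgue U (\<lambda>x. partial i f x / f x)" for i
    unfolding set_integrable_def using int2[of i] mU2[of i] by (simp add: integrable_completion)
  show ?thesis
    unfolding W11_def mem_Collect_eq
    by (intro conjI exI[of _ "\<lambda>i x. partial i f x / f x"] allI impI set1 set2 weak)
qed

end
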